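(* For every real $r>0$, $$S_1(1/r)=r\,S_1(r)+K\,(1-r)+\frac12(1+r)\log r,$$ $$S_2(1/r)=r\,S_2(r)+K_2\,(1-r)+K_1\,(1+r)\log r+\frac14(1-r)\log^2 r.$$
   Context: Notation: $H(x)=\sum_{1\le k\le x}1/k$ for $x>0$ (empty sums are $0$), $\{x\}=x-\lfloor x\rfloor$ is the fractional part, $\log^2x=(\log x)^2$, and $\gamma$, $\gamma_1$ are the first two Stieltjes constants: $\zeta(s)=\frac1{s-1}+\gamma-\gamma_1(s-1)+O((s-1)^2)$ as $s\to1$. For $x>0$, $$R_1(x)=\log x+\gamma-H(x)-\frac{\{x\}-1/2}{x},$$ $$R_2(x)=\frac1x\left(\frac12\log 2\pi+1+\frac12\log x\right)+(2-\gamma)\log x-\frac12\log^2x+2\gamma+\gamma_1-3+\frac1x\sum_{1\le\ell\le x}\left[\left(1+\frac x\ell\right)\log\frac x\ell+2\left(1-\frac x\ell\right)\right],$$ and $S_q(x)=\sum_{k\ge1}R_q(kx)$ for $q=1,2$ (these series converge absolutely for every $x>0$). The constants are $K=(\log 2\pi-\gamma+1)/2$, $K_1=(\log 2\pi-\gamma+2)/2$, and $K_2=\left(1-\frac{\gamma}{2}\right)\log 2\pi+\frac14\log^2 2\pi+\frac{\pi^2}{48}-\frac{\gamma^2}{4}-\gamma-\gamma_1+\frac32$. *)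

theory Defs
  imports "HOL-Complex_Analysis.Complex_Analysis" "HOL-Library.Landau_Symbols"
begin

(* The Riemann zeta function on the half-plane Re s > 0: its values there, except at s = 1,
   are uniquely determined by the identity theorem; the values outside are irrelevant. *)
definition zeta :: "complex \<Rightarrow> complex" where
  "zeta = (SOME f. f holomorphic_on ({s. Re s > 0} - {1}) \<and>
             (\<forall>s. Re s > 1 \<longrightarrow> (\<lambda>n. 1 / of_nat (Suc n) powr s) sums f s))"

definition stieltjes_gamma1 :: real where
  "stieltjes_gamma1 = (THE c.
     (\<lambda>s. zeta s - (1 / (s - 1) + complex_of_real euler_mascheroni
                      - complex_of_real c * (s - 1))) \<in> O[at 1](\<lambda>s. (s - 1)\<^sup>2))"

definition H :: "real \<Rightarrow> real" where
  "H x = (\<Sum>k=1..nat \<lfloor>x\<rfloor>. 1 / real k)"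

definition R1 :: "real \<Rightarrow> real" where
  "R1 x = ln x + euler_mascheroni - H x - (frac x - 1/2) / x"

definition R2 :: "real \<Rightarrow> real" where
  "R2 x = 1 / x * (1/2 * ln (2 * pi) + 1 + 1/2 * ln x)
        + (2 - euler_mascheroni) * ln x - 1/2 * (ln x)\<^sup>2
        + 2 * euler_mascheroni + stieltjes_gamma1 - 3
        + 1 / x * (\<Sum>l=1..nat \<lfloor>x\<rfloor>.
            (1 + x / real l) * ln (x / real l) + 2 * (1 - x / real l))"

definition S1 :: "real \<Rightarrow> real" where
  "S1 x = (\<Sum>k. R1 (real (Suc k) * x))"

definition S2 :: "real \<Rightarrow> real" where
  "S2 x = (\<Sum>k. R2 (real (Suc k) * x))"

definition const_K :: real where
  "const_K = (ln (2 * pi) - euler_mascheroni + 1) / 2"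

definition const_K1 :: real where
  "const_K1 = (ln (2 * pi) - euler_mascheroni + 2) / 2"

definition const_K2 :: real where
  "const_K2 = (1 - euler_mascheroni / 2) * ln (2 * pi) + 1/4 * (ln (2 * pi))\<^sup>2
            + pi\<^sup>2 / 48 - euler_mascheroni\<^sup>2 / 4
            - euler_mascheroni - stieltjes_gamma1 + 3/2"

end

theory Submission
  imports Defs "HOL-Real_Asymp.Real_Asymp"
begin

text \<open>
  Both summands have the shape of an elementary function plus a sum of a kernel
  \<open>\<phi> (x / l) / x\<close> over \<open>l \<le> x\<close>, where \<open>\<phi> (1 / u) = - \<phi> u / u\<close>. In \<open>S (1 / r) - r * S r\<close>, truncated at
  \<open>k \<le> N = \<lfloor>r M\<rfloor>\<close> and \<open>l \<le> M\<close>, the kernels therefore run over two complementary triangles of the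
  rectangle \<open>k \<le> N, l \<le> M\<close>, and the double sum factors into products of the sums of \<open>1 / k\<close>,
  \<open>ln k\<close>, \<open>ln k / k\<close> and \<open>(ln k)\<^sup>2\<close>. Their asymptotic expansions come from the Taylor coefficients
  of \<open>F s = (s - 1) * zeta s\<close> at \<open>1\<close> and at \<open>0\<close>: the Euler-Maclaurin approximants of \<open>F\<close>
  converge locally uniformly on \<open>Re s > -1\<close>, and Cauchy's inequality transfers the rate to the
  derivatives. The two coefficients at \<open>0\<close> are read off from the functional equation
  of \<open>zeta\<close>, which follows for \<open>-1 < s < 0\<close> by evaluating the Mellin transform of
  \<open>1 / (exp x - 1) - 1 / x + 1 / 2\<close> in two ways: through the trapezoid rule and through the partial
  fractions of \<open>coth\<close>.
\<close>

section \<open>The function (s - 1) zeta(s)\<close>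

text \<open>Multiplying by \<open>s - 1\<close> removes the pole, so the approximants are entire and
  one estimate serves both points: at 1 the derivatives produce the sums of 1/k and ln k / k, at 0
  those of ln k and (ln k)^2. Mere limits of these sums would not do. The double sum contains
  products such as N times the error of a harmonic sum, and a logarithm may come on top, so errors
  need a power rate: better than N^(-1) at the point 1, and some decay at 0. Cauchy's inequality on
  circles of radius 1/4 gives N^(-7/4) and N^(-3/4), which is enough; the same rates make the series
  for S absolutely convergent. At 1 the coefficients are the Stieltjes constants, known by
  definition. At 0 the sums of ln k and (ln k)^2 only define unknown constants, and the functional
  equation supplies their values. The interval -1 < s < 0 is where both expansions of the Mellin
  integrand have nonnegative terms and converge after integration, so Tonelli and monotone
  convergence justify every interchange. The resulting identity has no denominators, hence it
  extends to the point 0 itself.\<close>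

lemma telescoping_majorant:
  fixes a :: "nat \<Rightarrow> 'a::banach" and b :: "nat \<Rightarrow> real"
  assumes step: "\<And>n. n \<ge> m \<Longrightarrow> norm (a (Suc n) - a n) \<le> b n - b (Suc n)"
    and b: "b \<longlonglongrightarrow> 0"
  shows "convergent a" and "\<And>n. n \<ge> m \<Longrightarrow> norm (lim a - a n) \<le> b n"
proof -
  have diff: "norm (a k - a n) \<le> b n - b k" if "m \<le> n" "n \<le> k" for n k
    using that(2)
  proof (induction k rule: dec_induct)
    case (step k)
    have "norm (a (Suc k) - a n) \<le> norm (a (Suc k) - a k) + norm (a k - a n)"
      using norm_triangle_ineq[of "a (Suc k) - a k" "a k - a n"] by simp
    also have "\<dots> \<le> (b k - b (Suc k)) + (b n - b k)"
      using step.IH assms(1)[of k] step.hyps that(1) by linarith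
    finally show ?case by simp
  qed simp
  have "Cauchy a"
  proof (rule CauchyI)
    fix e :: real assume e: "e > 0"
    have "Cauchy b" using b by (simp add: LIMSEQ_imp_Cauchy)
    then obtain M where M: "\<And>n k. n \<ge> M \<Longrightarrow> k \<ge> M \<Longrightarrow> norm (b n - b k) < e"
      using CauchyD[OF _ e] by meson
    have "norm (a n - a k) < e" if "n \<ge> max m M" "k \<ge> max m M" for n k
    proof (cases "n \<le> k")
      case True
      then have "norm (a k - a n) < e" using diff[of n k] M[of n k] that by auto
      then show ?thesis by (simp add: norm_minus_commute)
    next
      case False
      then show ?thesis using diff[of k n] M[of k n] that by auto
    qed
    then show "\<exists>M. \<forall>m\<ge>M. \<forall>n\<ge>M. norm (a m - a n) < e" by blast
  qed
  then show conv: "convergent a" by (simp add: Cauchy_convergent)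
  show "norm (lim a - a n) \<le> b n" if "n \<ge> m" for n
  proof (rule LIMSEQ_le)
    show "(\<lambda>k. norm (a k - a n)) \<longlonglongrightarrow> norm (lim a - a n)"
      using conv by (intro tendsto_intros) (simp add: convergent_LIMSEQ_iff)
    show "(\<lambda>k. b n - b k) \<longlonglongrightarrow> b n"
      using tendsto_diff[OF tendsto_const b, of "b n"] by simp
    show "\<exists>N. \<forall>k\<ge>N. norm (a k - a n) \<le> b n - b k"
      using diff[OF that] by blast
  qed
qed

text \<open>Puts the bound n^(-p-1) into the telescoping form that
  \<open>telescoping_majorant\<close> asks for. The mean value point \<open>z\<close> lies below n +
  1, hence below 2n, and this costs the factor 2^(p+1).\<close>

lemma powr_neg_le_telescope:
  fixes p :: real
  assumes "p > 0" "n > 0"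
  shows "real n powr (-p-1) \<le> 2 powr (p+1) / p * (real n powr (-p) - real (Suc n) powr (-p))"
proof -
  have "\<exists>z. real n < z \<and> z < real (Suc n) \<and>
     real (Suc n) powr (-p) - real n powr (-p) = (real (Suc n) - real n) * (-p * z powr (-p-1))"
    by (rule MVT2) (use assms in \<open>auto intro!: derivative_eq_intros simp: powr_diff powr_minus field_simps\<close>)
  then obtain z where z: "real n < z" "z < real (Suc n)"
    "real n powr (-p) - real (Suc n) powr (-p) = p * z powr (-p-1)" by auto
  have "real n powr (-p-1) = 2 powr (p+1) * (2 * real n) powr (-p-1)"
    using assms by (simp add: powr_mult powr_add powr_diff powr_minus divide_simps)
  also have "(2 * real n) powr (-p-1) \<le> z powr (-p-1)"
    by (rule powr_mono2') (use assms z in auto)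
  finally show ?thesis using z assms by (simp add: field_simps)
qed

text \<open>\<open>s - 1\<close> times the Euler-Maclaurin approximation of zeta that stops after
  the endpoint correction -N^(-s)/2; the last term comes from the tail integral
  N^(1-s)/(s-1).\<close>

definition zeta_approx :: "nat \<Rightarrow> complex \<Rightarrow> complex" where
  "zeta_approx N s = (s - 1) * ((\<Sum>k=1..N. of_nat k powr (-s)) - of_nat N powr (-s) / 2)
     + of_nat N powr (1 - s)"

text \<open>The function (s - 1) zeta(s), here continued to Re s > -1; it is used only on that
  half-plane, where the limit exists.\<close>

definition zeta_reg :: "complex \<Rightarrow> complex" where
  "zeta_reg s = lim (\<lambda>N. zeta_approx N s)"

text \<open>With f(u) = u^(1-s), the increment is the trapezoidal error f(N+1) - f(N) - (f'(N) +
  f'(N+1))/2. Expanding f to second order and f' to first order at N, all terms up to f'' cancel and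
  only the third derivative remains; \<open>Re s \<ge> -2\<close> makes its bound largest at the
  left end N.\<close>

lemma norm_zeta_approx_step:
  assumes N: "N > 0" and s: "Re s \<ge> -2"
  shows "norm (zeta_approx (Suc N) s - zeta_approx N s) \<le>
           norm ((1 - s) * s * (1 + s)) * real N powr (- Re s - 2)"
proof -
  define S :: "complex set" where "S = closed_segment (of_nat N) (of_nat (Suc N))"
  \<comment> \<open>The segment consists of reals at least N, so it avoids the branch cut of
    \<open>powr\<close>.\<close>
  have S: "\<exists>t. x = of_real t \<and> real N \<le> t" if "x \<in> S" for x
  proof -
    have "S = closed_segment (complex_of_real (real N)) (complex_of_real (real (Suc N)))"
      by (simp add: S_def)
    also have "\<dots> = of_real ` closed_segment (real N) (real (Suc N))"
      by (rule closed_segment_of_real)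
    finally show ?thesis using that by (auto simp: closed_segment_eq_real_ivl)
  qed
  define f where "f = (\<lambda>i::nat. \<lambda>u::complex. if i = 0 then u powr (1 - s) else
    if i = 1 then (1 - s) * u powr (-s) else
    if i = 2 then (1 - s) * (-s) * u powr (-s-1) else (1 - s) * (-s) * (-s-1) * u powr (-s-2))"
  define B where "B = norm ((1 - s) * s * (1 + s)) * real N powr (- Re s - 2)"
  have der: "(f i has_field_derivative f (Suc i) x) (at x within S)" if xS: "x \<in> S" and i: "i \<le> 2" for i x
  proof -
    have x: "x \<notin> \<real>\<^sub>\<le>\<^sub>0" using S[OF xS] N by auto
    then have nz: "x \<noteq> 0" by auto
    consider "i = 0" | "i = 1" | "i = 2" using i by linarith
    then show ?thesis
    proof cases
      case 1
      then show ?thesis unfolding f_def using x by (auto intro!: derivative_eq_intros)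
    next
      case 2
      then show ?thesis unfolding f_def using x by (auto intro!: derivative_eq_intros)
    next
      case 3
      have "-2 - s = -s - 2" by (simp add: algebra_simps)
      then have "x powr (-2 - s) = x powr (-s - 2)" by (rule arg_cong)
      with 3 show ?thesis unfolding f_def using x by (auto intro!: derivative_eq_intros)
    qed
  qed
  have bound: "norm (f 3 x) \<le> B" if x: "x \<in> S" for x
  proof -
    obtain t where t: "x = of_real t" "real N \<le> t" using S[OF x] by blast
    have "norm (x powr (-s-2)) = t powr (-Re s - 2)"
      using t N by (simp add: norm_powr_real_powr)
    also have "\<dots> \<le> real N powr (- Re s - 2)"
      by (rule powr_mono2') (use s t N in auto)
    finally have 1: "norm (x powr (-s-2)) \<le> real N powr (- Re s - 2)" .
    have "(1 - s) * (-s) * (-s-1) = (1 - s) * s * (1 + s)" by (simp add: algebra_simps)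
    then have "norm (f 3 x) = norm ((1 - s) * s * (1 + s)) * norm (x powr (-s-2))"
      unfolding f_def by (simp only: norm_mult) (simp add: norm_mult)
    then show ?thesis unfolding B_def by (simp add: 1 mult_left_mono)
  qed
  have ends: "complex_of_nat N \<in> S" "complex_of_nat (Suc N) \<in> S" by (auto simp: S_def)
  have T0: "norm (f 0 (of_nat (Suc N)) - (\<Sum>i\<le>2. f i (of_nat N) * (of_nat (Suc N) - of_nat N) ^ i / fact i))
       \<le> B * norm (of_nat (Suc N) - of_nat N :: complex) ^ Suc 2 / fact 2"
    by (rule complex_Taylor[of S]) (use der bound ends in \<open>auto simp: S_def numeral_3_eq_3\<close>)
  have T1: "norm (f (Suc 0) (of_nat (Suc N)) - (\<Sum>i\<le>1. f (Suc i) (of_nat N) * (of_nat (Suc N) - of_nat N) ^ i / fact i))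
       \<le> B * norm (of_nat (Suc N) - of_nat N :: complex) ^ Suc 1 / fact 1"
    by (rule complex_Taylor[of S 1 "\<lambda>i. f (Suc i)"])
       (use der bound ends in \<open>auto simp: S_def numeral_3_eq_3\<close>)
  define e0 where "e0 = f 0 (of_nat (Suc N)) - (f 0 (of_nat N) + f 1 (of_nat N) + f 2 (of_nat N) / 2)"
  define e1 where "e1 = f 1 (of_nat (Suc N)) - (f 1 (of_nat N) + f 2 (of_nat N))"
  have e0: "norm e0 \<le> B / 2"
    using T0 by (simp add: e0_def eval_nat_numeral)
  have e1: "norm e1 \<le> B"
    using T1 by (simp add: e1_def eval_nat_numeral)
  have "zeta_approx (Suc N) s - zeta_approx N s =
     f 0 (of_nat (Suc N)) - f 0 (of_nat N) - (f 1 (of_nat N) + f 1 (of_nat (Suc N))) / 2"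
    by (simp add: zeta_approx_def f_def field_simps)
  also have "\<dots> = e0 - e1 / 2" by (simp add: e0_def e1_def field_simps)
  also have "norm \<dots> \<le> norm e0 + norm (e1 / 2)" by (rule norm_triangle_ineq4)
  also have "\<dots> \<le> B" using e0 e1 by simp
  finally show ?thesis by (simp add: B_def)
qed

text \<open>The polynomial factor of the step is at most (1+R) R (1+R) on the disc |s| \<le> R. The
  constant depends on \<open>p\<close> and \<open>R\<close> alone, which makes the convergence
  uniform on compact sets.\<close>

lemma zeta_approx_error:
  fixes p R :: real
  assumes "p > 0"
  defines "C \<equiv> (1 + R) * R * (1 + R) * (2 powr (p + 1) / p)"
  assumes s: "Re s \<ge> p - 1" "norm s \<le> R"
  shows "(\<lambda>N. zeta_approx N s) \<longlonglongrightarrow> zeta_reg s"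
    and "N > 0 \<Longrightarrow> norm (zeta_reg s - zeta_approx N s) \<le> C * real N powr (-p)"
proof -
  have R: "R \<ge> 0" using s(2) norm_ge_zero[of s] by linarith
  have step: "norm (zeta_approx (Suc n) s - zeta_approx n s) \<le>
     C * real n powr (-p) - C * real (Suc n) powr (-p)" if n: "n \<ge> 1" for n
  proof -
    have 1: "norm (1 - s) \<le> 1 + R" "norm (1 + s) \<le> 1 + R"
      using norm_triangle_ineq4[of 1 s] norm_triangle_ineq[of 1 s] s by auto
    have "norm (zeta_approx (Suc n) s - zeta_approx n s) \<le>
        norm ((1 - s) * s * (1 + s)) * real n powr (- Re s - 2)"
      by (rule norm_zeta_approx_step) (use n s assms in auto)
    also have "\<dots> \<le> ((1 + R) * R * (1 + R)) * real n powr (-p-1)"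
      unfolding norm_mult using 1 s n R by (intro mult_mono powr_mono mult_nonneg_nonneg) auto
    also have "\<dots> \<le> ((1 + R) * R * (1 + R)) * (2 powr (p+1) / p * (real n powr (-p) - real (Suc n) powr (-p)))"
      using R assms n by (intro mult_left_mono powr_neg_le_telescope) auto
    finally show ?thesis by (simp add: C_def right_diff_distrib mult.assoc)
  qed
  have lim: "(\<lambda>n. C * real n powr (-p)) \<longlonglongrightarrow> 0"
    using tendsto_mult_right_zero[OF tendsto_neg_powr[OF _ filterlim_real_sequentially], of "-p" C] assms
    by auto
  note T = telescoping_majorant[of 1 "\<lambda>N. zeta_approx N s", OF step lim]
  show "(\<lambda>N. zeta_approx N s) \<longlonglongrightarrow> zeta_reg s"
    using T(1) by (simp add: zeta_reg_def convergent_LIMSEQ_iff)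
  show "N > 0 \<Longrightarrow> norm (zeta_reg s - zeta_approx N s) \<le> C * real N powr (-p)"
    using T(2)[of N] by (simp add: zeta_reg_def)
qed

lemma zeta_reg_LIMSEQ: "Re s > -1 \<Longrightarrow> (\<lambda>N. zeta_approx N s) \<longlonglongrightarrow> zeta_reg s"
  using zeta_approx_error(1)[of "Re s + 1" s "norm s"] by simp

lemma holomorphic_zeta_approx [holomorphic_intros]: "N > 0 \<Longrightarrow> zeta_approx N holomorphic_on A"
  unfolding zeta_approx_def[abs_def] by (auto intro!: holomorphic_intros)

lemma holomorphic_zeta_reg: "zeta_reg holomorphic_on {s. Re s > -1}"
proof (rule holomorphic_uniform_sequence[where f = "\<lambda>n. zeta_approx (Suc n)"])
  show "open {s. Re s > -1}" by (rule open_halfspace_Re_gt)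
  show "zeta_approx (Suc n) holomorphic_on {s. Re s > -1}" for n
    by (rule holomorphic_zeta_approx) simp
  fix x assume x: "x \<in> {s. Re s > -1}"
  \<comment> \<open>Half the distance from \<open>x\<close> to the line Re s = -1: on the disc of
    radius \<open>p\<close> about \<open>x\<close> the real part stays at least
    \<open>p - 1\<close>.\<close>
  define p where "p = (Re x + 1) / 2"
  have p: "p > 0" using x by (simp add: p_def)
  define R where "R = norm x + p"
  define C where "C = (1 + R) * R * (1 + R) * (2 powr (p + 1) / p)"
  have s: "Re s \<ge> p - 1 \<and> norm s \<le> R" if "s \<in> cball x p" for s
  proof -
    have "norm (s - x) \<le> p" using that by (simp add: dist_norm norm_minus_commute)
    moreover have "\<bar>Re (s - x)\<bar> \<le> norm (s - x)" by (rule abs_Re_le_cmod)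
    moreover have "norm s \<le> norm x + norm (s - x)"
      using norm_triangle_ineq[of x "s - x"] by simp
    ultimately show ?thesis unfolding R_def p_def by (simp add: field_simps)
  qed
  have lim: "(\<lambda>n. C * real (Suc n) powr (-p)) \<longlonglongrightarrow> 0"
  proof -
    have "(\<lambda>n. C * real n powr (-p)) \<longlonglongrightarrow> 0"
      using tendsto_mult_right_zero[OF tendsto_neg_powr[OF _ filterlim_real_sequentially], of "-p" C] p
      by auto
    then show ?thesis by (subst filterlim_sequentially_Suc)
  qed
  have "uniform_limit (cball x p) (\<lambda>n. zeta_approx (Suc n)) zeta_reg sequentially"
  proof (rule uniform_limitI)
    fix e :: real assume "e > 0"
    then have "\<forall>\<^sub>F n in sequentially. C * real (Suc n) powr (-p) < e"
      using lim by (rule order_tendstoD(2)[rotated])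
    then show "\<forall>\<^sub>F n in sequentially. \<forall>s\<in>cball x p. dist (zeta_approx (Suc n) s) (zeta_reg s) < e"
    proof eventually_elim
      case (elim n)
      show ?case
      proof
        fix s assume "s \<in> cball x p"
        then have "norm (zeta_reg s - zeta_approx (Suc n) s) \<le> C * real (Suc n) powr (-p)"
          using zeta_approx_error(2)[OF p, of s R "Suc n"] s[of s] by (simp add: C_def)
        then show "dist (zeta_approx (Suc n) s) (zeta_reg s) < e"
          using elim by (simp add: dist_norm norm_minus_commute)
      qed
    qed
  qed
  moreover have "cball x p \<subseteq> {s. Re s > -1}" using s p by fastforce
  ultimately show "\<exists>d>0. cball x d \<subseteq> {s. - 1 < Re s} \<and>
      uniform_limit (cball x d) (\<lambda>n. zeta_approx (Suc n)) zeta_reg sequentially"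
    using p by blast
qed

section \<open>Derivatives of the approximants\<close>

text \<open>On the circle of radius \<open>d\<close> about \<open>z\<close> the real part can drop
  to Re z - d, so passing to derivatives costs a factor N^d in the rate.\<close>

lemma higher_deriv_zeta_approx_error:
  fixes z :: complex and d :: real and n :: nat
  assumes "d > 0" "Re z > d - 1"
  shows "\<exists>C. \<forall>N>0. norm ((deriv ^^ n) zeta_reg z - (deriv ^^ n) (zeta_approx N) z)
            \<le> C * real N powr (d - 1 - Re z)"
proof -
  define p where "p = Re z - d + 1"
  define R where "R = norm z + d"
  define C where "C = (1 + R) * R * (1 + R) * (2 powr (p + 1) / p)"
  have p: "p > 0" using assms by (simp add: p_def)
  have s: "Re s \<ge> p - 1 \<and> norm s \<le> R" if "s \<in> cball z d" for s
  proof -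
    have "norm (s - z) \<le> d" using that by (simp add: dist_norm norm_minus_commute)
    moreover have "\<bar>Re (s - z)\<bar> \<le> norm (s - z)" by (rule abs_Re_le_cmod)
    moreover have "norm s \<le> norm z + norm (s - z)"
      using norm_triangle_ineq[of z "s - z"] by simp
    ultimately show ?thesis unfolding R_def p_def by (simp add: field_simps)
  qed
  have sub: "cball z d \<subseteq> {s. Re s > -1}" using s p by fastforce
  have hol: "zeta_reg holomorphic_on cball z d"
    using holomorphic_zeta_reg sub by (rule holomorphic_on_subset)
  have "norm ((deriv ^^ n) zeta_reg z - (deriv ^^ n) (zeta_approx N) z)
      \<le> fact n * C / d ^ n * real N powr (d - 1 - Re z)" if N: "N > 0" for N
  proof -
    have "norm ((deriv ^^ n) (\<lambda>s. zeta_reg s - zeta_approx N s) z) \<le> fact n * (C * real N powr (-p)) / d ^ n"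
    proof (rule Cauchy_inequality)
      show h: "(\<lambda>s. zeta_reg s - zeta_approx N s) holomorphic_on ball z d"
        using hol ball_subset_cball holomorphic_on_subset N
        by (intro holomorphic_intros) blast+
      show "continuous_on (cball z d) (\<lambda>s. zeta_reg s - zeta_approx N s)"
        using hol N by (intro holomorphic_on_imp_continuous_on holomorphic_intros)
      show "norm (zeta_reg x - zeta_approx N x) \<le> C * real N powr - p" if "norm (z - x) = d" for x
        using zeta_approx_error(2)[OF p, of x R N] s[of x] that N by (simp add: C_def dist_norm)
    qed (use assms in auto)
    moreover have "(deriv ^^ n) (\<lambda>s. zeta_reg s - zeta_approx N s) z =
        (deriv ^^ n) zeta_reg z - (deriv ^^ n) (zeta_approx N) z"
      by (rule higher_deriv_diff[of _ "ball z d"])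
         (use hol N assms ball_subset_cball holomorphic_on_subset in \<open>auto intro!: holomorphic_intros\<close>)
    ultimately show ?thesis by (simp add: p_def algebra_simps)
  qed
  then show ?thesis by blast
qed

text \<open>The parameter \<open>c\<close> covers both powers in the approximant:
  \<open>c = 0\<close> for k^(-s) and \<open>c = 1\<close> for N^(1-s).\<close>

lemma has_field_derivative_of_nat_powr:
  assumes "k > 0"
  shows "((\<lambda>s::complex. of_nat k powr (c - s)) has_field_derivative
            - of_real (ln (real k)) * of_nat k powr (c - s)) (at s)"
proof -
  have "Ln (of_nat k) = of_real (ln (real k))"
    using assms by (metis Ln_of_nat)
  moreover have "((\<lambda>s::complex. of_nat k powr (c - s)) has_field_derivative
            (Ln (of_nat k) * of_nat k powr (c - s)) * (0 - 1)) (at s)"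
    by (rule DERIV_chain2[OF has_field_derivative_powr_right])
       (use assms in \<open>auto intro!: derivative_eq_intros\<close>)
  ultimately show ?thesis by simp
qed

lemma deriv_zeta_approx:
  assumes N: "N > 0"
  shows "deriv (zeta_approx N) s =
     ((\<Sum>k=1..N. of_nat k powr (-s)) - of_nat N powr (-s) / 2)
     + (s - 1) * (of_real (ln (real N)) * of_nat N powr (-s) / 2
                  - (\<Sum>k=1..N. of_real (ln (real k)) * of_nat k powr (-s)))
     - of_real (ln (real N)) * of_nat N powr (1 - s)"
proof -
  define P where "P = (\<lambda>s::complex. \<Sum>k=1..N. of_nat k powr (-s))"
  define Q where "Q = (\<lambda>s::complex. of_nat N powr (-s))"
  define T where "T = (\<lambda>s::complex. of_nat N powr (1 - s))"
  have P: "(P has_field_derivative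
       (\<Sum>k=1..N. - of_real (ln (real k)) * of_nat k powr (-s))) (at s)"
    unfolding P_def by (rule DERIV_sum) (use has_field_derivative_of_nat_powr[of _ 0 s] in auto)
  have Q: "(Q has_field_derivative - of_real (ln (real N)) * Q s) (at s)"
    unfolding Q_def using has_field_derivative_of_nat_powr[OF N, of 0 s] by simp
  have T: "(T has_field_derivative - of_real (ln (real N)) * T s) (at s)"
    unfolding T_def by (rule has_field_derivative_of_nat_powr[OF N])
  have "((\<lambda>s. (s - 1) * (P s - Q s / 2) + T s) has_field_derivative
     (P s - Q s / 2) + (s - 1) * (of_real (ln (real N)) * Q s / 2
        - (\<Sum>k=1..N. of_real (ln (real k)) * of_nat k powr (-s)))
     - of_real (ln (real N)) * T s) (at s)"
    by (auto intro!: derivative_eq_intros P Q T simp: sum_negf field_simps)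
  from DERIV_imp_deriv[OF this] show ?thesis
    by (simp add: P_def Q_def T_def zeta_approx_def[abs_def])
qed

lemma deriv2_zeta_approx:
  assumes N: "N > 0"
  shows "deriv (deriv (zeta_approx N)) s =
     2 * (of_real (ln (real N)) * of_nat N powr (-s) / 2
                  - (\<Sum>k=1..N. of_real (ln (real k)) * of_nat k powr (-s)))
     + (s - 1) * ((\<Sum>k=1..N. of_real ((ln (real k))\<^sup>2) * of_nat k powr (-s))
          - of_real ((ln (real N))\<^sup>2) * of_nat N powr (-s) / 2)
     + of_real ((ln (real N))\<^sup>2) * of_nat N powr (1 - s)"
proof -
  define P where "P = (\<lambda>s::complex. \<Sum>k=1..N. of_nat k powr (-s))"
  define L where "L = (\<lambda>s::complex. \<Sum>k=1..N. of_real (ln (real k)) * of_nat k powr (-s))"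
  define Q where "Q = (\<lambda>s::complex. of_nat N powr (-s))"
  define T where "T = (\<lambda>s::complex. of_nat N powr (1 - s))"
  have P: "(P has_field_derivative (- L s)) (at s)"
  proof -
    have "(P has_field_derivative (\<Sum>k=1..N. - of_real (ln (real k)) * of_nat k powr (-s))) (at s)"
      unfolding P_def by (rule DERIV_sum) (use has_field_derivative_of_nat_powr[of _ 0 s] in auto)
    then show ?thesis by (simp add: L_def sum_negf)
  qed
  have L: "(L has_field_derivative - (\<Sum>k=1..N. of_real ((ln (real k))\<^sup>2) * of_nat k powr (-s))) (at s)"
  proof -
    have "(L has_field_derivative
       (\<Sum>k=1..N. of_real (ln (real k)) * (- of_real (ln (real k)) * of_nat k powr (-s)))) (at s)"
      unfolding L_def
      by (intro DERIV_sum DERIV_cmult) (use has_field_derivative_of_nat_powr[of _ 0 s] in auto)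
    then show ?thesis by (simp add: sum_negf power2_eq_square mult.assoc)
  qed
  have Q: "(Q has_field_derivative - of_real (ln (real N)) * Q s) (at s)"
    unfolding Q_def using has_field_derivative_of_nat_powr[OF N, of 0 s] by simp
  have T: "(T has_field_derivative - of_real (ln (real N)) * T s) (at s)"
    unfolding T_def by (rule has_field_derivative_of_nat_powr[OF N])
  have "((\<lambda>s. (P s - Q s / 2) + (s - 1) * (of_real (ln (real N)) * Q s / 2 - L s)
     - of_real (ln (real N)) * T s) has_field_derivative
     2 * (of_real (ln (real N)) * Q s / 2 - L s) +
     (s - 1) * ((\<Sum>k=1..N. of_real ((ln (real k))\<^sup>2) * of_nat k powr (-s))
          - of_real ((ln (real N))\<^sup>2) * Q s / 2)
     + of_real ((ln (real N))\<^sup>2) * T s) (at s)"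
    by (auto intro!: derivative_eq_intros P Q T L simp: field_simps power2_eq_square)
  from DERIV_imp_deriv[OF this] show ?thesis
    by (simp add: P_def Q_def T_def L_def deriv_zeta_approx[OF N, abs_def])
qed

section \<open>Values and real expansions at the points 1 and 0\<close>

text \<open>At 1, and likewise at 0 below, the approximants are constant for N > 0. The shift to
  \<open>Suc N\<close> skips N = 0, where \<open>0 powr _ = 0\<close> breaks the pattern.\<close>

lemma zeta_reg_1: "zeta_reg 1 = 1"
proof -
  have "(\<lambda>N. zeta_approx (Suc N) 1) \<longlonglongrightarrow> zeta_reg 1"
    using zeta_reg_LIMSEQ[of 1] by (subst filterlim_sequentially_Suc) simp
  moreover have "zeta_approx (Suc N) 1 = 1" for N
    using of_nat_neq_0[of N, where ?'a = complex] by (simp add: zeta_approx_def)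
  ultimately show ?thesis by (simp add: LIMSEQ_const_iff)
qed

lemma zeta_reg_0: "zeta_reg 0 = 1/2"
proof -
  have "(\<lambda>N. zeta_approx (Suc N) 0) \<longlonglongrightarrow> zeta_reg 0"
    using zeta_reg_LIMSEQ[of 0] by (subst filterlim_sequentially_Suc) simp
  moreover have "zeta_approx (Suc N) 0 = 1/2" for N
  proof -
    have "(\<Sum>k=1..Suc N. of_nat k powr (0::complex)) = (\<Sum>k=1..Suc N. 1)"
      by (intro sum.cong) auto
    then show ?thesis using of_nat_neq_0[of N, where ?'a = complex]
      by (simp add: zeta_approx_def field_simps)
  qed
  ultimately show ?thesis by (simp add: LIMSEQ_const_iff)
qed

lemma powr_tendsto_0_real: "d < 0 \<Longrightarrow> (\<lambda>N. C * real N powr d) \<longlonglongrightarrow> 0"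
  using tendsto_mult_right_zero[OF tendsto_neg_powr[OF _ filterlim_real_sequentially], of d C] by auto

lemma tendsto_of_le_powr:
  fixes f :: "nat \<Rightarrow> 'a::real_normed_vector"
  assumes "\<And>N. N > 0 \<Longrightarrow> norm (l - f N) \<le> C * real N powr d" "d < 0"
  shows "f \<longlonglongrightarrow> l"
proof -
  have "(\<lambda>N. l - f N) \<longlonglongrightarrow> 0"
    by (rule Lim_null_comparison[OF _ powr_tendsto_0_real[OF assms(2)]])
       (use assms(1) in \<open>auto intro!: eventually_mono[OF eventually_gt_at_top[of 0]]\<close>)
  then have "(\<lambda>N. l - (l - f N)) \<longlonglongrightarrow> l - 0" by (intro tendsto_intros)
  then show ?thesis by simp
qed

lemma Im_limit_of_real_eq_0:
  assumes "(\<lambda>N. complex_of_real (f N)) \<longlonglongrightarrow> l"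
  shows "l = of_real (Re l)"
proof -
  have "(\<lambda>N. Im (complex_of_real (f N))) \<longlonglongrightarrow> Im l" using assms by (rule tendsto_Im)
  then have "Im l = 0" by (simp add: LIMSEQ_const_iff)
  then show ?thesis by (simp add: complex_eq_iff)
qed

lemma H_of_nat: "H (real n) = (\<Sum>k=1..n. 1 / real k)"
  by (simp add: H_def)

lemma of_nat_powr_minus_1: "of_nat k powr (-1) = complex_of_real (1 / real k)"
  by (cases "k = 0") (simp_all add: powr_minus divide_inverse)

lemma deriv_zeta_approx_1:
  assumes "N > 0"
  shows "deriv (zeta_approx N) 1 = of_real (H (real N) - 1 / (2 * real N) - ln (real N))"
  using assms by (simp add: deriv_zeta_approx H_of_nat of_nat_powr_minus_1)

lemma deriv2_zeta_approx_1:
  assumes "N > 0"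
  shows "deriv (deriv (zeta_approx N)) 1 =
     of_real (ln (real N) / real N - 2 * (\<Sum>k=1..N. ln (real k) / real k) + (ln (real N))\<^sup>2)"
  using assms by (simp add: deriv2_zeta_approx of_nat_powr_minus_1 algebra_simps)

lemma deriv_zeta_approx_0:
  assumes "N > 0"
  shows "deriv (zeta_approx N) 0 =
    of_real (real N - 1/2 + (\<Sum>k=1..N. ln (real k)) - ln (real N) / 2 - real N * ln (real N))"
proof -
  have "(\<Sum>k=1..N. of_nat k powr (0::complex)) = (\<Sum>k=1..N. 1)"
    "(\<Sum>k=1..N. of_real (ln (real k)) * of_nat k powr (0::complex)) = (\<Sum>k=1..N. of_real (ln (real k)))"
    by (intro sum.cong; auto)+
  then show ?thesis using assms by (simp add: deriv_zeta_approx algebra_simps)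
qed

lemma deriv2_zeta_approx_0:
  assumes "N > 0"
  shows "deriv (deriv (zeta_approx N)) 0 =
    of_real (ln (real N) - 2 * (\<Sum>k=1..N. ln (real k)) - (\<Sum>k=1..N. (ln (real k))\<^sup>2)
      + (ln (real N))\<^sup>2 / 2 + real N * (ln (real N))\<^sup>2)"
proof -
  have "(\<Sum>k=1..N. of_real ((ln (real k))\<^sup>2) * of_nat k powr (0::complex)) = (\<Sum>k=1..N. of_real ((ln (real k))\<^sup>2))"
    "(\<Sum>k=1..N. of_real (ln (real k)) * of_nat k powr (0::complex)) = (\<Sum>k=1..N. of_real (ln (real k)))"
    by (intro sum.cong; auto)+
  then show ?thesis using assms by (simp add: deriv2_zeta_approx algebra_simps)
qed

lemma real_limit_with_error:
  assumes f: "\<And>N. N > 0 \<Longrightarrow> g N = complex_of_real (f N)"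
    and err: "\<exists>C. \<forall>N>0. norm (l - g N) \<le> C * real N powr d" and d: "d < 0"
  shows "l = of_real (Re l)" "\<exists>C. \<forall>N>0. \<bar>f N - Re l\<bar> \<le> C * real N powr d" "f \<longlonglongrightarrow> Re l"
proof -
  obtain C where C: "\<And>N. N > 0 \<Longrightarrow> norm (l - of_real (f N)) \<le> C * real N powr d"
    using err f by metis
  from tendsto_of_le_powr[OF C d] show *: "l = of_real (Re l)" by (rule Im_limit_of_real_eq_0)
  have **: "\<bar>f N - Re l\<bar> \<le> C * real N powr d" if "N > 0" for N
  proof -
    have "norm (l - of_real (f N)) = \<bar>f N - Re l\<bar>"
      using * by (metis of_real_diff norm_of_real abs_minus_commute)
    then show ?thesis using C[OF that] by simp
  qed
  then show "\<exists>C. \<forall>N>0. \<bar>f N - Re l\<bar> \<le> C * real N powr d" by blast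
  show "f \<longlonglongrightarrow> Re l"
    by (rule tendsto_of_le_powr[OF _ d]) (use ** in \<open>auto simp: abs_minus_commute\<close>)
qed

text \<open>Radius 1/4 in Cauchy's inequality: the exponent is -7/4 at the point 1 and -3/4 at the
  point 0.\<close>

lemma deriv_zeta_reg_error:
  assumes "Re z \<ge> 0" "n = 1 \<or> n = 2"
  shows "\<exists>C. \<forall>N>0. norm ((deriv ^^ n) zeta_reg z - (deriv ^^ n) (zeta_approx N) z)
            \<le> C * real N powr (- Re z - 3/4)"
proof -
  have "1/4 - 1 - Re z = - Re z - 3/4" by simp
  from higher_deriv_zeta_approx_error[of "1/4" z n, unfolded this] assms show ?thesis by simp
qed

text \<open>At 1 the factor \<open>s - 1\<close> kills the logarithmic sum, and the derivative of
  the approximant is exactly H(N) - 1/(2N) - ln N. Its limit is known, so the Cauchy error is the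
  error of the harmonic sum.\<close>

lemma deriv_zeta_reg_1: "deriv zeta_reg 1 = of_real euler_mascheroni"
  and harmonic_error:
    "\<exists>C. \<forall>N>0. \<bar>H (real N) - (ln (real N) + euler_mascheroni + 1 / (2 * real N))\<bar> \<le> C * real N powr (-7/4)"
proof -
  note R = real_limit_with_error[where l = "deriv zeta_reg 1" and d = "-7/4" and g = "\<lambda>N. deriv (zeta_approx N) 1"
      and f = "\<lambda>N. H (real N) - 1 / (2 * real N) - ln (real N)", OF deriv_zeta_approx_1]
  have err: "\<exists>C. \<forall>N>0. norm (deriv zeta_reg 1 - deriv (zeta_approx N) 1) \<le> C * real N powr (-7/4)"
    using deriv_zeta_reg_error[of 1 1] by simp
  have "(\<lambda>N. harm N - ln (real N) - (1/2) * (1 / real N)) \<longlonglongrightarrow> euler_mascheroni - (1/2) * 0"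
    by (intro tendsto_intros euler_mascheroni_LIMSEQ)
  moreover have "harm N - ln (real N) - (1/2) * (1 / real N) =
      H (real N) - 1 / (2 * real N) - ln (real N)" for N
    by (simp add: H_of_nat harm_def inverse_eq_divide)
  ultimately have lim: "(\<lambda>N. H (real N) - 1 / (2 * real N) - ln (real N)) \<longlonglongrightarrow> euler_mascheroni"
    by (simp only: mult_zero_right diff_zero)
  have Re: "Re (deriv zeta_reg 1) = euler_mascheroni"
    by (rule LIMSEQ_unique[OF R(3)[OF _ err] lim]) simp_all
  then show "deriv zeta_reg 1 = of_real euler_mascheroni" using R(1)[OF _ err] by simp
  show "\<exists>C. \<forall>N>0. \<bar>H (real N) - (ln (real N) + euler_mascheroni + 1 / (2 * real N))\<bar> \<le> C * real N powr (-7/4)"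
    using R(2)[OF _ err] Re by (simp add: algebra_simps)
qed

section \<open>Identification with zeta and its Laurent expansion at 1\<close>

text \<open>The definition of the approximant, solved for the partial sum; both boundary powers of N
  vanish for Re s > 1.\<close>

lemma zeta_reg_sums:
  assumes s: "Re s > 1"
  shows "(\<lambda>n. 1 / of_nat (Suc n) powr s) sums (zeta_reg s / (s - 1))"
proof -
  have s1: "s \<noteq> 1" using s by auto
  have "(\<lambda>n. (zeta_approx n s - of_nat n powr (1 - s)) / (s - 1) + of_nat n powr (-s) / 2)
      \<longlonglongrightarrow> (zeta_reg s - 0) / (s - 1) + 0 / 2"
    using s s1 by (intro tendsto_intros zeta_reg_LIMSEQ tendsto_neg_powr_complex_of_nat filterlim_ident) auto
  moreover have "(zeta_approx n s - of_nat n powr (1 - s)) / (s - 1) + of_nat n powr (-s) / 2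
      = (\<Sum>k<n. 1 / of_nat (Suc k) powr s)" for n
  proof -
    have "(\<Sum>k=1..n. of_nat k powr (-s)) = (\<Sum>k<n. 1 / of_nat (Suc k) powr s)"
      by (simp add: powr_minus inverse_eq_divide sum.atLeast1_atMost_eq)
    then show ?thesis using s1 by (simp add: zeta_approx_def)
  qed
  ultimately show ?thesis by (simp add: sums_def)
qed

text \<open>\<open>zeta\<close> is a Hilbert choice, so its characteristic property is available
  only once a witness is exhibited, and \<open>zeta_reg s / (s - 1)\<close> is one. The punctured
  half-plane is connected, hence the two agree by the identity theorem.\<close>

lemma zeta_eq_zeta_reg:
  assumes "Re s > 0" "s \<noteq> 1"
  shows "zeta s = zeta_reg s / (s - 1)"
proof -
  let ?S = "{s. Re s > 0} - {1::complex}"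
  let ?P = "\<lambda>f. f holomorphic_on ?S \<and> (\<forall>s. Re s > 1 \<longrightarrow> (\<lambda>n. 1 / of_nat (Suc n) powr s) sums f s)"
  have hol: "(\<lambda>s. zeta_reg s / (s - 1)) holomorphic_on ?S"
    by (intro holomorphic_intros holomorphic_on_subset[OF holomorphic_zeta_reg]) auto
  have "?P (\<lambda>s. zeta_reg s / (s - 1))" using hol zeta_reg_sums by blast
  then have "?P (SOME f. ?P f)" by (rule someI[of ?P])
  then have P: "?P zeta" unfolding zeta_def[symmetric] .
  show ?thesis
  proof (rule analytic_continuation_open[where s = "{s. Re s > 1}" and s' = ?S and f = zeta
        and g = "\<lambda>s. zeta_reg s / (s - 1)"])
    show "open {s. Re s > 1}" by (rule open_halfspace_Re_gt)
    show "open ?S" by (intro open_Diff open_halfspace_Re_gt) auto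
    have "(2::complex) \<in> {s. Re s > 1}" by simp
    then show "{s. Re s > 1} \<noteq> {}" by blast
    show "connected ?S"
      by (intro connected_open_delete open_halfspace_Re_gt convex_connected convex_halfspace_Re_gt) simp
    show "zeta z = zeta_reg z / (z - 1)" if "z \<in> {s. Re s > 1}" for z
      using that P zeta_reg_sums by (auto intro: sums_unique2)
  qed (use P hol assms in auto)
qed

text \<open>A cubic remainder is what is needed: dividing by \<open>s - 1\<close> leaves the
  O((s-1)^2) in the definition of \<open>stieltjes_gamma1\<close>.\<close>

lemma zeta_reg_Taylor:
  "\<exists>B. \<forall>s\<in>cball 1 (1/2). norm (zeta_reg s - (1 + of_real euler_mascheroni * (s - 1)
       + deriv (deriv zeta_reg) 1 / 2 * (s - 1)\<^sup>2)) \<le> B * norm (s - 1) ^ 3"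
proof -
  have sub: "cball 1 (1/2) \<subseteq> {s::complex. Re s > -1}"
  proof
    fix s :: complex assume "s \<in> cball 1 (1/2)"
    then have "norm (1 - s) \<le> 1/2" by (simp add: dist_norm)
    then show "s \<in> {s. Re s > -1}" using abs_Re_le_cmod[of "1 - s"] by simp
  qed
  have hol: "(deriv ^^ i) zeta_reg holomorphic_on {s. Re s > -1}" for i
    by (intro holomorphic_higher_deriv holomorphic_zeta_reg open_halfspace_Re_gt)
  have "compact ((deriv ^^ 3) zeta_reg ` cball 1 (1/2))"
    using hol sub by (intro compact_continuous_image holomorphic_on_imp_continuous_on)
       (blast intro: holomorphic_on_subset compact_cball)+
  then obtain B where B: "\<And>s. s \<in> cball 1 (1/2) \<Longrightarrow> norm ((deriv ^^ 3) zeta_reg s) \<le> B"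
    by (force dest!: compact_imp_bounded simp: bounded_iff)
  have "norm (zeta_reg s - (1 + of_real euler_mascheroni * (s - 1)
       + deriv (deriv zeta_reg) 1 / 2 * (s - 1)\<^sup>2)) \<le> B / 2 * norm (s - 1) ^ 3"
    if "s \<in> cball 1 (1/2)" for s
  proof -
    have "norm ((deriv ^^ 0) zeta_reg s - (\<Sum>i\<le>2. (deriv ^^ i) zeta_reg 1 * (s - 1) ^ i / fact i))
       \<le> B * norm (s - 1) ^ Suc 2 / fact 2"
    proof (rule complex_Taylor[of "cball 1 (1/2)"])
      fix i and x :: complex assume "x \<in> cball 1 (1/2)"
      then show "((deriv ^^ i) zeta_reg has_field_derivative (deriv ^^ Suc i) zeta_reg x) (at x within cball 1 (1/2))"
        using sub holomorphic_derivI[OF hol open_halfspace_Re_gt, of x i] by auto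
    qed (use B that in \<open>auto simp: numeral_3_eq_3\<close>)
    then show ?thesis
      by (simp add: eval_nat_numeral zeta_reg_1 deriv_zeta_reg_1 field_simps)
  qed
  then show ?thesis by blast
qed

text \<open>The linear Laurent coefficient of zeta is half the second derivative of
  \<open>zeta_reg\<close> at 1, and the definition writes this coefficient as minus gamma_1. The
  definite description requires existence and uniqueness of the constant.\<close>

lemma deriv2_zeta_reg_1: "deriv (deriv zeta_reg) 1 = of_real (- 2 * stieltjes_gamma1)"
  and log_harmonic_error: "\<exists>C. \<forall>N>0. \<bar>(\<Sum>k=1..N. ln (real k) / real k) -
       ((ln (real N))\<^sup>2 / 2 + stieltjes_gamma1 + ln (real N) / (2 * real N))\<bar> \<le> C * real N powr (-7/4)"
proof -
  define D where "D = deriv (deriv zeta_reg) 1"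
  note R = real_limit_with_error[where l = D and d = "-7/4" and g = "\<lambda>N. deriv (deriv (zeta_approx N)) 1"
      and f = "\<lambda>N. ln (real N) / real N - 2 * (\<Sum>k=1..N. ln (real k) / real k) + (ln (real N))\<^sup>2",
      OF deriv2_zeta_approx_1]
  have err: "\<exists>C. \<forall>N>0. norm (D - deriv (deriv (zeta_approx N)) 1) \<le> C * real N powr (-7/4)"
    using deriv_zeta_reg_error[of 1 2] by (simp add: eval_nat_numeral D_def)
  define c where "c = - Re D / 2"
  have D: "D = - 2 * of_real c" using R(1)[OF _ err] by (simp add: c_def)
  let ?Z = "\<lambda>c s. zeta s - (1 / (s - 1) + complex_of_real euler_mascheroni - complex_of_real c * (s - 1))"
  have c: "?Z c \<in> O[at 1](\<lambda>s. (s - 1)\<^sup>2)"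
  proof -
    obtain B where B: "\<And>s. s \<in> cball 1 (1/2) \<Longrightarrow> norm (zeta_reg s - (1 + of_real euler_mascheroni * (s - 1)
       + D / 2 * (s - 1)\<^sup>2)) \<le> B * norm (s - 1) ^ 3"
      using zeta_reg_Taylor unfolding D_def by blast
    have "\<forall>\<^sub>F s in at 1. s \<in> ball 1 (1/2) - {1::complex}"
      by (intro eventually_at_in_open) auto
    then have "\<forall>\<^sub>F s in at 1. norm (?Z c s) \<le> B * norm ((s - 1)\<^sup>2)"
    proof eventually_elim
      case (elim s)
      then have s: "s \<noteq> 1" "s \<in> cball 1 (1/2)" by auto
      have "Re s > 0"
        using abs_Re_le_cmod[of "1 - s"] s by (auto simp: dist_norm)
      then have z: "zeta s = zeta_reg s / (s - 1)" using s by (intro zeta_eq_zeta_reg)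
      have "z / w - (1 / w + e - of_real c * w) = (z - (1 + e * w + D / 2 * w\<^sup>2)) / w"
        if "w \<noteq> 0" for z w e :: complex
        using that by (simp add: D field_simps power2_eq_square)
      from this[of "s - 1"] z s have "?Z c s = (zeta_reg s - (1 + of_real euler_mascheroni * (s - 1) + D / 2 * (s - 1)\<^sup>2)) / (s - 1)"
        by simp
      also have "norm \<dots> \<le> B * norm (s - 1) ^ 3 / norm (s - 1)"
        unfolding norm_divide by (intro divide_right_mono B s) simp
      also have "\<dots> = B * norm ((s - 1)\<^sup>2)"
        using s by (simp add: norm_mult power3_eq_cube power2_eq_square)
      finally show ?case .
    qed
    then show ?thesis by (rule bigoI)
  qed
  \<comment> \<open>Two admissible constants differ by at most a multiple of |s - 1| for all s near
    1; let s tend to 1.\<close>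
  have uniq: "c' = c" if c': "?Z c' \<in> O[at 1](\<lambda>s. (s - 1)\<^sup>2)" for c'
  proof -
    have "(\<lambda>s. ?Z c' s - ?Z c s) \<in> O[at 1](\<lambda>s. (s - 1)\<^sup>2)"
      by (rule sum_in_bigo[OF c' c])
    then obtain K where "\<forall>\<^sub>F s in at 1. norm (?Z c' s - ?Z c s) \<le> K * norm ((s - 1)\<^sup>2)"
      by (elim landau_o.bigE)
    moreover have "\<forall>\<^sub>F s in at 1. s \<in> UNIV - {1::complex}"
      by (intro eventually_at_in_open) auto
    ultimately have ev: "\<forall>\<^sub>F s in at 1. \<bar>c' - c\<bar> \<le> K * norm (s - (1::complex))"
    proof eventually_elim
      case (elim s)
      have "?Z c' s - ?Z c s = of_real (c' - c) * (s - 1)" by (simp add: algebra_simps)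
      then have "\<bar>c' - c\<bar> * norm (s - 1) \<le> K * norm (s - 1) * norm (s - 1)"
        using elim by (simp add: norm_mult power2_eq_square flip: of_real_diff)
      moreover have "norm (s - 1) > 0" using elim by simp
      ultimately show ?case by (rule mult_right_le_imp_le)
    qed
    have "((\<lambda>s. K * norm (s - (1::complex))) \<longlongrightarrow> K * norm (1 - (1::complex))) (at 1)"
      by (intro tendsto_intros)
    then have "\<bar>c' - c\<bar> \<le> K * norm (1 - (1::complex))"
      by (rule tendsto_lowerbound[OF _ ev]) simp
    then show ?thesis by simp
  qed
  have "stieltjes_gamma1 = c"
    unfolding stieltjes_gamma1_def using c uniq by (rule the_equality)
  then show "deriv (deriv zeta_reg) 1 = of_real (- 2 * stieltjes_gamma1)"
    using D by (simp add: D_def)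
  have "\<exists>C. \<forall>N>0. \<bar>(ln (real N) / real N - 2 * (\<Sum>k=1..N. ln (real k) / real k)
      + (ln (real N))\<^sup>2) - Re D\<bar> \<le> C * real N powr (-7/4)"
    by (rule R(2)[OF _ err]) simp_all
  then obtain C where C: "\<And>N. N > 0 \<Longrightarrow> \<bar>(ln (real N) / real N - 2 * (\<Sum>k=1..N. ln (real k) / real k)
      + (ln (real N))\<^sup>2) - Re D\<bar> \<le> C * real N powr (-7/4)"
    by blast
  have "\<bar>(\<Sum>k=1..N. ln (real k) / real k) -
       ((ln (real N))\<^sup>2 / 2 + stieltjes_gamma1 + ln (real N) / (2 * real N))\<bar> \<le> (C / 2) * real N powr (-7/4)"
    if N: "N > 0" for N
  proof -
    have "l / n - 2 * L + q - Re D = - 2 * (L - (q / 2 + stieltjes_gamma1 + l / (2 * n)))" for l n L q :: real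
      using \<open>stieltjes_gamma1 = c\<close> by (simp add: c_def field_simps)
    then have "\<bar>l / n - 2 * L + q - Re D\<bar> = 2 * \<bar>L - (q / 2 + stieltjes_gamma1 + l / (2 * n))\<bar>"
      for l n L q :: real by (simp only: abs_mult abs_minus_cancel abs_numeral)
    note * = C[OF N, unfolded this]
    have "x \<le> C / 2 * e" if "2 * x \<le> C * e" for x e :: real using that by simp
    from this[OF *] show ?thesis .
  qed
  then show "\<exists>C. \<forall>N>0. \<bar>(\<Sum>k=1..N. ln (real k) / real k) -
       ((ln (real N))\<^sup>2 / 2 + stieltjes_gamma1 + ln (real N) / (2 * real N))\<bar> \<le> C * real N powr (-7/4)"
    by blast
qed

text \<open>Here and in the next lemma the constants stay expressed through derivatives at 0; the
  functional equation evaluates them later.\<close>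

lemma sum_ln_error:
  "\<exists>C. \<forall>N>0. \<bar>(\<Sum>k=1..N. ln (real k)) - (real N * ln (real N) - real N + ln (real N) / 2
       + (Re (deriv zeta_reg 0) + 1/2))\<bar> \<le> C * real N powr (-3/4)"
proof -
  note R = real_limit_with_error[where l = "deriv zeta_reg 0" and d = "-3/4"
      and g = "\<lambda>N. deriv (zeta_approx N) 0"
      and f = "\<lambda>N. real N - 1/2 + (\<Sum>k=1..N. ln (real k)) - ln (real N) / 2 - real N * ln (real N)",
      OF deriv_zeta_approx_0]
  have err: "\<exists>C. \<forall>N>0. norm (deriv zeta_reg 0 - deriv (zeta_approx N) 0) \<le> C * real N powr (-3/4)"
    using deriv_zeta_reg_error[of 0 1] by simp
  have eq: "n - 1/2 + s - l / 2 - n * l - d = s - (n * l - n + l / 2 + (d + 1/2))" for n s l d :: real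
    by simp
  show ?thesis using R(2)[OF _ err, unfolded eq] by simp
qed

lemma sum_ln_squared_error:
  "\<exists>C. \<forall>N>0. \<bar>(\<Sum>k=1..N. (ln (real k))\<^sup>2) - (real N * (ln (real N))\<^sup>2 - 2 * real N * ln (real N)
       + 2 * real N + (ln (real N))\<^sup>2 / 2
       - (2 * Re (deriv zeta_reg 0) + 1 + Re (deriv (deriv zeta_reg) 0)))\<bar> \<le> C * real N powr (-3/4)"
proof -
  note R = real_limit_with_error[where l = "deriv (deriv zeta_reg) 0" and d = "-3/4"
      and g = "\<lambda>N. deriv (deriv (zeta_approx N)) 0"
      and f = "\<lambda>N. ln (real N) - 2 * (\<Sum>k=1..N. ln (real k)) - (\<Sum>k=1..N. (ln (real k))\<^sup>2)
      + (ln (real N))\<^sup>2 / 2 + real N * (ln (real N))\<^sup>2", OF deriv2_zeta_approx_0]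
  have err: "\<exists>C. \<forall>N>0. norm (deriv (deriv zeta_reg) 0 - deriv (deriv (zeta_approx N)) 0) \<le> C * real N powr (-3/4)"
    using deriv_zeta_reg_error[of 0 2] by (simp add: eval_nat_numeral)
  have "\<exists>C. \<forall>N>0. \<bar>ln (real N) - 2 * (\<Sum>k=1..N. ln (real k)) - (\<Sum>k=1..N. (ln (real k))\<^sup>2)
      + (ln (real N))\<^sup>2 / 2 + real N * (ln (real N))\<^sup>2 - Re (deriv (deriv zeta_reg) 0)\<bar> \<le> C * real N powr (-3/4)"
    by (rule R(2)[OF _ err]) simp_all
  then obtain C2 where C2: "\<And>N. N > 0 \<Longrightarrow> \<bar>ln (real N) - 2 * (\<Sum>k=1..N. ln (real k)) - (\<Sum>k=1..N. (ln (real k))\<^sup>2)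
      + (ln (real N))\<^sup>2 / 2 + real N * (ln (real N))\<^sup>2 - Re (deriv (deriv zeta_reg) 0)\<bar> \<le> C2 * real N powr (-3/4)"
    by blast
  obtain C1 where C1: "\<And>N. N > 0 \<Longrightarrow> \<bar>(\<Sum>k=1..N. ln (real k)) - (real N * ln (real N) - real N + ln (real N) / 2
       + (Re (deriv zeta_reg 0) + 1/2))\<bar> \<le> C1 * real N powr (-3/4)"
    using sum_ln_error by blast
  \<comment> \<open>The second derivative at 0 contains the sum of (ln k)^2 together with twice the
    sum of ln k; the preceding expansion removes the latter, whence
    \<open>c2 + 2 * c1\<close>.\<close>
  have arith: "\<bar>q - (n * l\<^sup>2 - 2 * n * l + 2 * n + l\<^sup>2 / 2 - (2 * d1 + 1 + d2))\<bar> \<le> (c2 + 2 * c1) * e"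
    if "\<bar>l - 2 * s - q + l\<^sup>2 / 2 + n * l\<^sup>2 - d2\<bar> \<le> c2 * e"
       "\<bar>s - (n * l - n + l / 2 + (d1 + 1/2))\<bar> \<le> c1 * e" for q n l d1 d2 c1 c2 e s :: real
  proof -
    have "q - (n * l\<^sup>2 - 2 * n * l + 2 * n + l\<^sup>2 / 2 - (2 * d1 + 1 + d2)) =
       - (l - 2 * s - q + l\<^sup>2 / 2 + n * l\<^sup>2 - d2) - 2 * (s - (n * l - n + l / 2 + (d1 + 1/2)))"
      by (simp add: algebra_simps)
    moreover have "(c2 + 2 * c1) * e = c2 * e + 2 * (c1 * e)" by (simp add: algebra_simps)
    ultimately show ?thesis using that by linarith
  qed
  show ?thesis using arith[OF C2 C1] by blast
qed

section \<open>The functional equation\<close>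

text \<open>Both sides of the reflection formula for \<open>Gamma\<close> are differentiated, and
  the common factor pi / sin(pi z) is cancelled.\<close>

lemma Digamma_reflection:
  fixes z :: complex
  assumes z: "z \<notin> \<int>"
  shows "Digamma z - Digamma (1 - z) = - of_real pi * cos (of_real pi * z) / sin (of_real pi * z)"
proof -
  have nonpos: "z \<notin> \<int>\<^sub>\<le>\<^sub>0" "1 - z \<notin> \<int>\<^sub>\<le>\<^sub>0"
    using z nonpos_Ints_subset_Ints Ints_diff[OF Ints_1, of "1 - z"] by auto
  have s: "sin (of_real pi * z) \<noteq> 0"
    using z by (auto simp: sin_eq_0 mult.commute)
  have "((\<lambda>w. Gamma w * Gamma (1 - w)) has_field_derivative
      Gamma z * Gamma (1 - z) * (Digamma z - Digamma (1 - z))) (at z)"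
    using nonpos by (auto intro!: derivative_eq_intros simp: algebra_simps)
  moreover have "((\<lambda>w. of_real pi / sin (of_real pi * w)) has_field_derivative
      - (of_real pi / sin (of_real pi * z)) * (of_real pi * cos (of_real pi * z) / sin (of_real pi * z))) (at z)"
    using s by (auto intro!: derivative_eq_intros simp: field_simps)
  ultimately have "Gamma z * Gamma (1 - z) * (Digamma z - Digamma (1 - z)) =
     - (of_real pi / sin (of_real pi * z)) * (of_real pi * cos (of_real pi * z) / sin (of_real pi * z))"
    unfolding Gamma_reflection_complex by (rule DERIV_unique)
  then have "(of_real pi / sin (of_real pi * z)) * (Digamma z - Digamma (1 - z)) =
     (of_real pi / sin (of_real pi * z)) * (- of_real pi * cos (of_real pi * z) / sin (of_real pi * z))"
    unfolding Gamma_reflection_complex by simp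
  then show ?thesis using s by (subst (asm) mult_cancel_left) auto
qed

text \<open>Digamma(1+z) - Digamma(1-z) at z = i y, evaluated twice: the limit formula gives the
  series, the recurrence with the reflection formula gives the closed form.\<close>

lemma coth_partial_fractions:
  fixes y :: real
  assumes y: "y > 0"
  shows "(\<lambda>n. 2 * y / (y\<^sup>2 + (real (Suc n))\<^sup>2)) sums
           (pi * (exp (2 * pi * y) + 1) / (exp (2 * pi * y) - 1) - 1 / y)"
proof -
  define z where "z = \<i> * complex_of_real y"
  have z: "z \<notin> \<int>" "z \<noteq> 0" using y by (auto simp: z_def elim!: Ints_cases dest!: arg_cong[where f = Im])
  have nz: "1 + z \<noteq> 0" "1 - z \<noteq> 0" by (auto simp: z_def complex_eq_iff)
  have "(\<lambda>m. (of_real (ln (real m)) - (\<Sum>n<m. inverse (1 + z + of_nat n)))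
        - (of_real (ln (real m)) - (\<Sum>n<m. inverse (1 - z + of_nat n))))
      \<longlonglongrightarrow> Digamma (1 + z) - Digamma (1 - z)"
    by (intro tendsto_diff Digamma_LIMSEQ nz)
  moreover have "inverse (1 - z + of_nat n) - inverse (1 + z + of_nat n) =
       \<i> * of_real (2 * y / (y\<^sup>2 + (real (Suc n))\<^sup>2))" for n
  proof -
    have "1 - z + of_nat n \<noteq> 0" "1 + z + of_nat n \<noteq> 0"
      by (auto simp: z_def complex_eq_iff)
    then have "inverse (1 - z + of_nat n) - inverse (1 + z + of_nat n) =
       2 * z / ((1 - z + of_nat n) * (1 + z + of_nat n))"
      by (simp add: divide_simps; simp add: algebra_simps)
    also have "(1 - z + of_nat n) * (1 + z + of_nat n) = of_real (y\<^sup>2 + (real (Suc n))\<^sup>2)"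
      by (simp add: z_def algebra_simps power2_eq_square)
    finally show ?thesis by (simp add: z_def)
  qed
  ultimately have "(\<lambda>n. \<i> * of_real (2 * y / (y\<^sup>2 + (real (Suc n))\<^sup>2))) sums (Digamma (1 + z) - Digamma (1 - z))"
    by (simp add: sums_def flip: sum_subtractf)
  from sums_mult[OF this, of "-\<i>"]
  have S: "(\<lambda>n. of_real (2 * y / (y\<^sup>2 + (real (Suc n))\<^sup>2))) sums (- \<i> * (Digamma (1 + z) - Digamma (1 - z)))"
    by (simp flip: mult.assoc)
  \<comment> \<open>At the imaginary argument i pi y, sine and cosine are rational in
    \<open>E\<close>.\<close>
  define E where "E = exp (pi * y)"
  have E: "E > 1" using y by (simp add: E_def)
  have E2: "exp (2 * pi * y) = E\<^sup>2" by (simp add: E_def power2_eq_square flip: exp_add)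
  have arg: "\<i> * (of_real pi * z) = of_real (- (pi * y))" by (simp add: z_def complex_eq_iff)
  have cos: "cos (of_real pi * z) = of_real ((1 / E + E) / 2)"
    unfolding cos_exp_eq arg minus_mult_right[symmetric]
    by (simp add: E_def exp_minus inverse_eq_divide flip: exp_of_real)
  have sin: "sin (of_real pi * z) = of_real (1 / E - E) / (2 * \<i>)"
    unfolding sin_exp_eq arg minus_mult_right[symmetric]
    by (simp add: E_def exp_minus inverse_eq_divide flip: exp_of_real)
  have "- \<i> * (Digamma (1 + z) - Digamma (1 - z)) = - \<i> * (1 / z + (Digamma z - Digamma (1 - z)))"
    using Digamma_plus1[OF z(2)] by (simp add: add.commute)
  also have "\<dots> = - \<i> * (1 / z - of_real pi * cos (of_real pi * z) / sin (of_real pi * z))"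
    using Digamma_reflection[OF z(1)] by simp
  also have "\<dots> = of_real (- 1 / y + pi * (1 / E + E) / (E - 1 / E))"
  proof -
    have d: "1 / E - E \<noteq> 0" using E by (simp add: field_simps power2_eq_1_iff flip: power2_eq_square)
    have "- \<i> * (1 / z) = of_real (- 1 / y)"
      using y by (simp add: z_def field_simps)
    moreover have "- \<i> * (of_real pi * of_real c / (of_real d / (2 * \<i>))) = of_real (2 * pi * c / d)"
      if "d \<noteq> 0" for c d :: real
      using that by (simp add: field_simps)
    from this[OF d, of "(1 / E + E) / 2"]
    have "- \<i> * (of_real pi * cos (of_real pi * z) / sin (of_real pi * z)) = of_real (pi * (1 / E + E) / (1 / E - E))"
      unfolding cos sin by simp
    moreover have "pi * (1 / E + E) / (1 / E - E) = - (pi * (1 / E + E) / (E - 1 / E))"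
      by (subst minus_divide_right) simp
    ultimately show ?thesis by (simp only: right_diff_distrib of_real_add) simp
  qed
  also have "- 1 / y + pi * (1 / E + E) / (E - 1 / E) =
     pi * (exp (2 * pi * y) + 1) / (exp (2 * pi * y) - 1) - 1 / y"
  proof -
    have "E - 1 / E = (E\<^sup>2 - 1) / E" "1 / E + E = (E\<^sup>2 + 1) / E"
      using E by (simp_all add: field_simps power2_eq_square)
    note eqs = this
    have "pi * (1 / E + E) / (E - 1 / E) = pi * (E\<^sup>2 + 1) / (E\<^sup>2 - 1)"
      unfolding eqs using E by simp
    then show ?thesis unfolding E2 by simp
  qed
  finally show ?thesis using S by (simp only: sums_of_real_iff)
qed

text \<open>The previous expansion at y = x / (2 pi), divided by 2 pi; here 1/(exp x - 1) + 1/2 is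
  coth(x/2)/2.\<close>

lemma planck_partial_fractions:
  fixes x :: real
  assumes x: "x > 0"
  shows "(\<lambda>n. 2 * x / (x\<^sup>2 + (2 * pi * real (Suc n))\<^sup>2)) sums (1 / (exp x - 1) - 1 / x + 1 / 2)"
proof -
  define y where "y = x / (2 * pi)"
  have y: "y > 0" and xy: "x = 2 * pi * y" using x by (auto simp: y_def)
  have E: "exp x > 1" using x by simp
  have "(\<lambda>n. 1 / (2 * pi) * (2 * y / (y\<^sup>2 + (real (Suc n))\<^sup>2))) sums
     (1 / (2 * pi) * (pi * (exp (2 * pi * y) + 1) / (exp (2 * pi * y) - 1) - 1 / y))"
    by (rule sums_mult[OF coth_partial_fractions[OF y]])
  moreover have "1 / (2 * pi) * (2 * y / (y\<^sup>2 + (real (Suc n))\<^sup>2)) =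
      2 * x / (x\<^sup>2 + (2 * pi * real (Suc n))\<^sup>2)" for n
  proof -
    have "x\<^sup>2 + (2 * pi * real (Suc n))\<^sup>2 = (2 * pi)\<^sup>2 * (y\<^sup>2 + (real (Suc n))\<^sup>2)"
      unfolding xy power_mult_distrib by (simp add: algebra_simps)
    then show ?thesis unfolding xy by (simp add: power2_eq_square)
  qed
  moreover have "1 / (2 * pi) * (pi * (exp (2 * pi * y) + 1) / (exp (2 * pi * y) - 1) - 1 / y) =
      1 / (exp x - 1) - 1 / x + 1 / 2"
  proof -
    have "1 / (2 * pi) * (pi * (e + 1) / (e - 1) - 1 / y) = 1 / (e - 1) - 1 / (2 * pi * y) + 1 / 2"
      if "e > 1" for e
      using that y by (simp add: divide_simps; simp add: algebra_simps)
    from this[OF E] show ?thesis by (simp add: xy)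
  qed
  ultimately show ?thesis by simp
qed

section \<open>Gamma integrals and the Mellin transform of a partial fraction\<close>

text \<open>Stated, like all integrals up to the functional equation, for \<open>ennreal\<close>
  values: the later interchanges then rest on measurability alone.\<close>

lemma nn_integral_Gamma_scaled:
  fixes a c :: real
  assumes a: "a > 0" and c: "c > 0"
  shows "(\<integral>\<^sup>+x. ennreal (x powr (a - 1) * exp (- c * x)) * indicator {0<..} x \<partial>lborel) =
           ennreal (Gamma a * c powr (-a))"
proof -
  let ?I = "\<integral>\<^sup>+x. ennreal (x powr (a - 1) * exp (- c * x)) * indicator {0<..} x \<partial>lborel"
  have "ennreal (Gamma a) = (\<integral>\<^sup>+t. ennreal (indicator {0..} t * t powr (a - 1) / exp t) \<partial>lborel)"
    by (rule Gamma_conv_nn_integral_real[OF a])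
  also have "\<dots> = ennreal \<bar>c\<bar> * (\<integral>\<^sup>+x. ennreal (indicator {0..} (0 + c * x) * (0 + c * x) powr (a - 1) / exp (0 + c * x)) \<partial>lborel)"
    by (rule nn_integral_real_affine) (use c in auto)
  also have "(\<integral>\<^sup>+x. ennreal (indicator {0..} (0 + c * x) * (0 + c * x) powr (a - 1) / exp (0 + c * x)) \<partial>lborel)
     = (\<integral>\<^sup>+x. ennreal (c powr (a - 1)) * (ennreal (x powr (a - 1) * exp (- c * x)) * indicator {0<..} x) \<partial>lborel)"
  proof (rule nn_integral_cong)
    fix x :: real
    show "ennreal (indicator {0..} (0 + c * x) * (0 + c * x) powr (a - 1) / exp (0 + c * x)) =
      ennreal (c powr (a - 1)) * (ennreal (x powr (a - 1) * exp (- c * x)) * indicator {0<..} x)"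
    proof (cases "x > 0")
      case True
      then show ?thesis using c by (simp add: powr_mult exp_minus divide_inverse mult.assoc flip: ennreal_mult)
    next
      case False
      then show ?thesis using c by (cases "x = 0") (auto simp: indicator_def zero_le_mult_iff)
    qed
  qed
  also have "\<dots> = ennreal (c powr (a - 1)) * ?I"
    by (rule nn_integral_cmult) auto
  also have "ennreal \<bar>c\<bar> * (ennreal (c powr (a - 1)) * ?I) = ennreal (c powr a) * ?I"
    using c by (simp add: powr_diff flip: mult.assoc ennreal_mult)
  finally have *: "ennreal (Gamma a) = ennreal (c powr a) * ?I" .
  have "?I = ennreal (c powr (-a)) * (ennreal (c powr a) * ?I)"
    using c by (simp flip: mult.assoc ennreal_mult powr_add)
  also have "\<dots> = ennreal (Gamma a * c powr (-a))"
    unfolding *[symmetric] using c Gamma_real_pos[OF a] by (simp add: mult.commute flip: ennreal_mult)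
  finally show ?thesis .
qed

text \<open>Substitution u = t x^2 in the Gamma integral.\<close>

lemma nn_integral_Gamma_gaussian:
  fixes z t :: real
  assumes z: "z > 0" and t: "t > 0"
  shows "(\<integral>\<^sup>+x. ennreal (2 * x powr (2 * z - 1) * exp (- t * x\<^sup>2)) * indicator {0<..} x \<partial>lborel) =
           ennreal (Gamma z * t powr (-z))"
proof -
  let ?I = "\<integral>\<^sup>+x. ennreal (2 * x powr (2 * z - 1) * exp (- t * x\<^sup>2)) * indicator {0<..} x \<partial>lborel"
  let ?g = "\<lambda>x::real. t * x\<^sup>2" and ?f = "\<lambda>u::real. u powr (z - 1) / exp u"
  have img: "?g ` {0..} = {0..}"
  proof (intro equalityI subsetI)
    fix y :: real assume y: "y \<in> {0..}"
    then have "y = ?g (sqrt (y / t))" "sqrt (y / t) \<in> {0..}" using t by auto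
    then show "y \<in> ?g ` {0..}" by blast
  qed (use t in auto)
  have inj: "inj_on ?g {0..}" using t by (intro inj_onI) (auto simp: power2_eq_iff_nonneg)
  have "?f absolutely_integrable_on ?g ` {0..} \<and> integral (?g ` {0..}) ?f = Gamma z"
    unfolding img using Gamma_integral_real[OF z]
    by (auto intro!: nonnegative_absolutely_integrable_1 simp: has_integral_iff)
  then have "(\<lambda>x. \<bar>2 * t * x\<bar> * ?f (?g x)) absolutely_integrable_on {0..} \<and>
      integral {0..} (\<lambda>x. \<bar>2 * t * x\<bar> * ?f (?g x)) = Gamma z"
    by (subst has_absolute_integral_change_of_variables_1'[OF _ _ inj])
       (auto intro!: derivative_eq_intros)
  then have "((\<lambda>x. \<bar>2 * t * x\<bar> * ?f (?g x)) has_integral Gamma z) {0..}"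
    by (auto simp: has_integral_iff absolutely_integrable_on_def)
  then have "(\<integral>\<^sup>+x. ennreal (\<bar>2 * t * x\<bar> * ?f (?g x)) * indicator {0..} x \<partial>lborel) = ennreal (Gamma z)"
    by (rule nn_integral_has_integral_lebesgue'[rotated]) auto
  also have "(\<integral>\<^sup>+x. ennreal (\<bar>2 * t * x\<bar> * ?f (?g x)) * indicator {0..} x \<partial>lborel) =
     (\<integral>\<^sup>+x. ennreal (t powr z) * (ennreal (2 * x powr (2 * z - 1) * exp (- t * x\<^sup>2)) * indicator {0<..} x) \<partial>lborel)"
  proof (rule nn_integral_cong)
    fix x :: real
    show "ennreal (\<bar>2 * t * x\<bar> * ?f (?g x)) * indicator {0..} x =
       ennreal (t powr z) * (ennreal (2 * x powr (2 * z - 1) * exp (- t * x\<^sup>2)) * indicator {0<..} x)"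
    proof (cases "x > 0")
      case True
      have "(x\<^sup>2) powr (z - 1) = x powr (2 * z - 2)"
        using True by (simp add: powr_powr algebra_simps flip: powr_numeral)
      moreover have "x * x powr (2 * z - 2) = x powr (2 * z - 1)"
        using True by (simp add: powr_mult_base)
      moreover have "t * t powr (z - 1) = t powr z"
        using t by (simp add: powr_mult_base)
      moreover have "\<bar>2 * t * x\<bar> * ?f (?g x) =
          2 * (t * t powr (z - 1)) * (x * (x\<^sup>2) powr (z - 1)) * exp (- t * x\<^sup>2)"
        using True t by (simp add: powr_mult exp_minus divide_inverse mult_ac)
      ultimately have "\<bar>2 * t * x\<bar> * ?f (?g x) = t powr z * (2 * x powr (2 * z - 1) * exp (- t * x\<^sup>2))"
        by (simp only: mult_ac)
      then show ?thesis using True by (simp flip: ennreal_mult)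
    next
      case False
      then show ?thesis by (cases "x = 0") auto
    qed
  qed
  also have "\<dots> = ennreal (t powr z) * ?I"
    by (rule nn_integral_cmult) auto
  finally have *: "ennreal (Gamma z) = ennreal (t powr z) * ?I" by simp
  have "?I = ennreal (t powr (-z)) * (ennreal (t powr z) * ?I)"
    using t by (simp flip: mult.assoc ennreal_mult powr_add)
  also have "\<dots> = ennreal (Gamma z * t powr (-z))"
    unfolding *[symmetric] using Gamma_real_pos[OF z] by (simp add: mult.commute flip: ennreal_mult)
  finally show ?thesis .
qed

lemma Gamma_reflection_real:
  fixes z :: real
  shows "Gamma z * Gamma (1 - z) = pi / sin (pi * z)"
proof -
  have "complex_of_real (Gamma z * Gamma (1 - z)) = Gamma (of_real z) * Gamma (1 - of_real z)"
    by (simp flip: Gamma_complex_of_real)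
  also have "\<dots> = of_real (pi / sin (pi * z))"
    unfolding Gamma_reflection_complex by (simp flip: sin_of_real)
  finally show ?thesis by (simp only: of_real_eq_iff)
qed

text \<open>Write 1/(x^2 + c^2) as the integral of exp(-t (x^2 + c^2)) over t > 0 and exchange the
  order. The Gaussian integral in x and the Gamma integral in t give Gamma(z) Gamma(1-z) with z =
  (s+1)/2, and reflection turns sin(pi z) into cos(pi s/2).\<close>

lemma nn_integral_Mellin_rational:
  fixes s c :: real
  assumes s: "-1 < s" "s < 1" and c: "c > 0"
  shows "(\<integral>\<^sup>+x. ennreal (2 * x powr s / (x\<^sup>2 + c\<^sup>2)) * indicator {0<..} x \<partial>lborel) =
           ennreal (pi / cos (pi * s / 2) * c powr (s - 1))"
proof -
  define z where "z = (s + 1) / 2"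
  have z: "z > 0" "1 - z > 0" "s = 2 * z - 1" using s by (auto simp: z_def field_simps)
  let ?k = "\<lambda>x t. ennreal (2 * x powr s * exp (- t * x\<^sup>2) * exp (- (c\<^sup>2) * t)) * indicator {0<..} x * indicator {0<..} t"
  have "(\<integral>\<^sup>+x. ennreal (2 * x powr s / (x\<^sup>2 + c\<^sup>2)) * indicator {0<..} x \<partial>lborel) =
     (\<integral>\<^sup>+x. \<integral>\<^sup>+t. ?k x t \<partial>lborel \<partial>lborel)"
  proof (rule nn_integral_cong)
    fix x :: real
    show "ennreal (2 * x powr s / (x\<^sup>2 + c\<^sup>2)) * indicator {0<..} x = (\<integral>\<^sup>+t. ?k x t \<partial>lborel)"
    proof (cases "x > 0")
      case True
      have pos: "x\<^sup>2 + c\<^sup>2 > 0" using c by (simp add: add_nonneg_pos)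
      have "(\<integral>\<^sup>+t. ?k x t \<partial>lborel) =
        (\<integral>\<^sup>+t. ennreal (2 * x powr s) * (ennreal (t powr (1 - 1) * exp (- (x\<^sup>2 + c\<^sup>2) * t)) * indicator {0<..} t) \<partial>lborel)"
        by (rule nn_integral_cong)
           (use True in \<open>auto simp: indicator_def algebra_simps exp_add[symmetric] simp flip: ennreal_mult\<close>)
      also have "\<dots> = ennreal (2 * x powr s) * ennreal (Gamma 1 * (x\<^sup>2 + c\<^sup>2) powr (-1))"
        by (subst nn_integral_cmult, simp, subst nn_integral_Gamma_scaled[OF _ pos]) auto
      also have "\<dots> = ennreal (2 * x powr s / (x\<^sup>2 + c\<^sup>2))"
        using pos by (simp add: powr_minus divide_inverse flip: ennreal_mult)
      finally show ?thesis using True by simp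
    qed auto
  qed
  also have "\<dots> = (\<integral>\<^sup>+t. \<integral>\<^sup>+x. ?k x t \<partial>lborel \<partial>lborel)"
    by (rule lborel_pair.Fubini'[symmetric]) measurable
  also have "\<dots> = (\<integral>\<^sup>+t. ennreal (Gamma z) * (ennreal (t powr ((1 - z) - 1) * exp (- (c\<^sup>2) * t)) * indicator {0<..} t) \<partial>lborel)"
  proof (rule nn_integral_cong)
    fix t :: real
    show "(\<integral>\<^sup>+x. ?k x t \<partial>lborel) =
      ennreal (Gamma z) * (ennreal (t powr ((1 - z) - 1) * exp (- (c\<^sup>2) * t)) * indicator {0<..} t)"
    proof (cases "t > 0")
      case True
      have "(\<integral>\<^sup>+x. ?k x t \<partial>lborel) = (\<integral>\<^sup>+x. ennreal (exp (- (c\<^sup>2) * t)) *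
          (ennreal (2 * x powr (2 * z - 1) * exp (- t * x\<^sup>2)) * indicator {0<..} x) \<partial>lborel)"
        by (rule nn_integral_cong)
           (use True z in \<open>auto simp: indicator_def mult_ac simp flip: ennreal_mult\<close>)
      also have "\<dots> = ennreal (exp (- (c\<^sup>2) * t)) * ennreal (Gamma z * t powr (-z))"
        by (subst nn_integral_cmult, simp, subst nn_integral_Gamma_gaussian[OF z(1) True]) auto
      also have "\<dots> = ennreal (Gamma z) * ennreal (t powr ((1 - z) - 1) * exp (- (c\<^sup>2) * t))"
        using Gamma_real_pos[OF z(1)] by (simp add: mult_ac flip: ennreal_mult)
      finally show ?thesis using True by simp
    qed auto
  qed
  also have "\<dots> = ennreal (Gamma z) * ennreal (Gamma (1 - z) * (c\<^sup>2) powr (-(1 - z)))"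
    by (subst nn_integral_cmult, simp, subst nn_integral_Gamma_scaled[OF z(2)]) (use c in auto)
  also have "\<dots> = ennreal (Gamma z * Gamma (1 - z) * c powr (s - 1))"
  proof -
    have "(c\<^sup>2) powr (-(1 - z)) = c powr (s - 1)"
      unfolding z(3) using c by (simp add: powr_powr algebra_simps flip: powr_numeral)
    then show ?thesis
      using Gamma_real_pos[OF z(1)] by (simp add: mult_ac flip: ennreal_mult')
  qed
  also have "Gamma z * Gamma (1 - z) = pi / cos (pi * s / 2)"
  proof -
    have "sin (pi * z) = cos (pi / 2 - pi * z)" by (simp add: cos_diff)
    also have "pi / 2 - pi * z = - (pi * s / 2)" by (simp add: z_def field_simps)
    finally show ?thesis by (simp add: Gamma_reflection_real)
  qed
  finally show ?thesis .
qed

section \<open>Trapezoidal errors and the two evaluations of the Mellin transform\<close>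

text \<open>For x > 0, the error of the trapezoidal rule for u \<mapsto> exp(-u x) on
  [k, k+1].\<close>

definition planck_term :: "nat \<Rightarrow> real \<Rightarrow> real" where
  "planck_term k x = exp (- real k * x) * ((1 + exp (-x)) / 2 - (1 - exp (-x)) / x)"

text \<open>Peano kernel form of the trapezoidal error: the weight (u-k)(k+1-u)/2 against the second
  derivative of exp(-u x). The antiderivative comes from integrating by parts twice.\<close>

lemma planck_term_integral:
  assumes x: "x > 0"
  shows "((\<lambda>u. (u - real k) * (real k + 1 - u) / 2 * x\<^sup>2 * exp (- u * x)) has_integral planck_term k x)
           {real k..real k + 1}"
proof -
  let ?w = "\<lambda>u::real. (u - real k) * (real k + 1 - u) / 2"
  let ?F = "\<lambda>u::real. - exp (- u * x) * (?w u * x + (2 * real k + 1 - 2 * u) / 2 - 1 / x)"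
  have "((\<lambda>u. ?w u * x\<^sup>2 * exp (- u * x)) has_integral (?F (real k + 1) - ?F (real k))) {real k..real k + 1}"
  proof (rule fundamental_theorem_of_calculus)
    fix u assume "u \<in> {real k..real k + 1}"
    have "(?F has_real_derivative ?w u * x\<^sup>2 * exp (- u * x)) (at u)"
      using x by (auto intro!: derivative_eq_intros simp: field_simps power2_eq_square)
    then show "(?F has_vector_derivative ?w u * x\<^sup>2 * exp (- u * x)) (at u within {real k..real k + 1})"
      by (simp add: has_real_derivative_iff_has_vector_derivative has_vector_derivative_at_within)
  qed simp
  also have "?F (real k + 1) - ?F (real k) = planck_term k x"
  proof -
    have e: "exp (- (real k + 1) * x) = exp (- real k * x) * exp (-x)"
      by (simp add: algebra_simps flip: exp_add)
    show ?thesis unfolding planck_term_def e using x by (simp add: field_simps)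
  qed
  finally show ?thesis .
qed

lemma planck_term_nonneg: "x > 0 \<Longrightarrow> planck_term k x \<ge> 0"
  by (rule has_integral_nonneg[OF planck_term_integral]) auto

lemma planck_term_sums:
  assumes x: "x > 0"
  shows "(\<lambda>k. planck_term k x) sums (1 / (exp x - 1) - 1 / x + 1 / 2)"
proof -
  have q: "exp (-x) < 1" using x by simp
  have "(\<lambda>k. exp (-x) ^ k * ((1 + exp (-x)) / 2 - (1 - exp (-x)) / x)) sums
     (1 / (1 - exp (-x)) * ((1 + exp (-x)) / 2 - (1 - exp (-x)) / x))"
    by (intro sums_mult2 geometric_sums) (use q in auto)
  moreover have "exp (-x) ^ k = exp (- real k * x)" for k
    by (simp flip: exp_of_nat_mult)
  moreover have "1 / (1 - exp (-x)) * ((1 + exp (-x)) / 2 - (1 - exp (-x)) / x) = 1 / (exp x - 1) - 1 / x + 1 / 2"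
  proof -
    have "1 / (1 - 1 / e) * ((1 + 1 / e) / 2 - (1 - 1 / e) / x) = 1 / (e - 1) - 1 / x + 1 / 2"
      if "e > 1" for e :: real
    proof -
      have "1 / (1 - 1 / e) = e / (e - 1)" using that by (simp add: field_simps)
      then show ?thesis using that x by (simp add: divide_simps; simp add: algebra_simps)
    qed
    from this[of "exp x"] x show ?thesis by (simp add: exp_minus inverse_eq_divide)
  qed
  ultimately show ?thesis by (simp add: planck_term_def)
qed

text \<open>The trapezoidal error again, now for u \<mapsto> u^(-s) on [k, k+1].\<close>

definition trapezoid_defect :: "real \<Rightarrow> nat \<Rightarrow> real" where
  "trapezoid_defect s k = (real k powr (-s) + real (Suc k) powr (-s)) / 2
      - (real (Suc k) powr (1 - s) - real k powr (1 - s)) / (1 - s)"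

text \<open>The same Peano kernel; the second derivative of u^(-s) is s(s+1) u^(-s-2). Dividing by
  s(s+1), which is negative on this range of s, leaves a nonnegative integral.\<close>

lemma trapezoid_defect_integral:
  fixes s :: real
  assumes s: "-1 < s" "s < 0"
  shows "((\<lambda>u. (u - real k) * (real k + 1 - u) / 2 * u powr (- s - 2)) has_integral
           trapezoid_defect s k / (s * (s + 1))) {real k..real k + 1}"
proof -
  let ?w = "\<lambda>u::real. (u - real k) * (real k + 1 - u) / 2"
  let ?F = "\<lambda>u::real. (real k * (real k + 1) * u powr (- s - 1) / (s + 1)
      - (2 * real k + 1) * u powr (-s) / s - u powr (1 - s) / (1 - s)) / 2"
  have "((\<lambda>u. ?w u * u powr (- s - 2)) has_integral (?F (real k + 1) - ?F (real k))) {real k..real k + 1}"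
  proof (rule fundamental_theorem_of_calculus_interior)
    \<comment> \<open>For \<open>k = 0\<close> the power is unbounded near 0, but its coefficient
      vanishes; this is why the coefficient stays inside the function.\<close>
    have c1: "continuous_on {real k..real k + 1} (\<lambda>u. real k * (real k + 1) * u powr (- s - 1))"
    proof (cases "k = 0")
      case False
      then have "continuous_on {real k..real k + 1} (\<lambda>u. u powr (- s - 1))"
        by (intro continuous_on_powr continuous_on_id continuous_on_const) auto
      then show ?thesis by (rule continuous_on_mult_left)
    qed simp
    have c2: "continuous_on {real k..real k + 1} (\<lambda>u. u powr r)" if "r > 0" for r
      by (intro continuous_on_powr' continuous_on_id continuous_on_const) (use that in auto)
    show "continuous_on {real k..real k + 1} ?F"
      using s by (intro continuous_on_divide continuous_on_diff continuous_on_mult_left c1 c2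
          continuous_on_const) auto
    fix u assume u: "u \<in> {real k<..<real k + 1}"
    then have u0: "u > 0" by (smt (verit) greaterThanLessThan_iff of_nat_0_le_iff)
    have p: "u powr (-s-1) = u * u powr (-s-2)" "u powr (-s) = u * (u * u powr (-s-2))"
    proof -
      have e: "1 + (-s-2) = -s-1" "1 + (-s-1) = -s" by simp_all
      show 1: "u powr (-s-1) = u * u powr (-s-2)"
        using powr_add[of u 1 "-s-2", unfolded e] u0 by simp
      show "u powr (-s) = u * (u * u powr (-s-2))"
        using powr_add[of u 1 "-s-1", unfolded e] u0 1 by simp
    qed
    have e: "-s-1-1 = -s-2" "1-s-1 = -s" by simp_all
    note d = has_real_derivative_powr[OF u0, of "-s-1", unfolded e]
      has_real_derivative_powr[OF u0, of "-s"] has_real_derivative_powr[OF u0, of "1-s", unfolded e]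
    have "(?F has_real_derivative (real k * (real k + 1) * ((- s - 1) * u powr (- s - 2)) / (s + 1)
      - (2 * real k + 1) * ((-s) * u powr (- s - 1)) / s - (1 - s) * u powr (-s) / (1 - s)) / 2) (at u)"
      by (intro DERIV_cdivide DERIV_diff DERIV_cmult d)
    also have "(real k * (real k + 1) * ((- s - 1) * u powr (- s - 2)) / (s + 1)
      - (2 * real k + 1) * ((-s) * u powr (- s - 1)) / s - (1 - s) * u powr (-s) / (1 - s)) / 2 =
       ?w u * u powr (- s - 2)"
    proof -
      have h: "K * ((- s - 1) * q) / (s + 1) = - K * q" "L * ((-s) * r) / s = - L * r" "(1 - s) * v / (1 - s) = v"
        for K L q r v :: real
      proof -
        have "s + 1 \<noteq> 0" "s \<noteq> 0" "1 - s \<noteq> 0" using s by auto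
        then show "K * ((- s - 1) * q) / (s + 1) = - K * q" "L * ((-s) * r) / s = - L * r" "(1 - s) * v / (1 - s) = v"
          by (simp_all add: divide_eq_eq) (simp_all add: algebra_simps)
      qed
      show ?thesis unfolding h p by (simp add: algebra_simps)
    qed
    finally show "(?F has_vector_derivative ?w u * u powr (- s - 2)) (at u)"
      by (simp add: has_real_derivative_iff_has_vector_derivative)
  qed simp
  also have "?F (real k + 1) - ?F (real k) = trapezoid_defect s k / (s * (s + 1))"
  proof -
    define a b where "a = real k powr (-s)" and "b = (real k + 1) powr (-s)"
    have 1: "real k powr (1 - s) = real k * a" "(real k + 1) powr (1 - s) = (real k + 1) * b"
      by (simp_all add: a_def b_def powr_mult_base)
    have 2: "real k * (real k + 1) * real k powr (- s - 1) = (real k + 1) * a"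
      by (simp add: a_def powr_mult_base mult.assoc)
    have 3: "real k * (real k + 1) * (real k + 1) powr (- s - 1) = real k * b"
      by (simp add: b_def powr_mult_base mult.assoc)
    have "trapezoid_defect s k = (a + b) / 2 - ((real k + 1) * b - real k * a) / (1 - s)"
      by (simp add: trapezoid_defect_def 1 add.commute[of 1] flip: a_def b_def)
    moreover have "(1 - s) \<noteq> 0" "s \<noteq> 0" "s + 1 \<noteq> 0" using s by auto
    ultimately show ?thesis unfolding 1 2 3 a_def[symmetric] b_def[symmetric]
      by (simp add: divide_simps) (simp add: algebra_simps power2_eq_square)
  qed
  finally show ?thesis .
qed

lemma trapezoid_defect_nonneg:
  assumes s: "-1 < s" "s < 0"
  shows "trapezoid_defect s k / (s * (s + 1)) \<ge> 0"
  by (rule has_integral_nonneg[OF trapezoid_defect_integral[OF s]]) auto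

text \<open>After inserting the Peano kernel form, the x-integral is done first: x^(s-1) x^2 exp(-u
  x) integrates to Gamma(s+2) u^(-s-2), and the remaining u-integral is the kernel form of
  \<open>trapezoid_defect\<close>.\<close>

lemma nn_integral_Mellin_planck_term:
  assumes s: "-1 < s" "s < 0"
  shows "(\<integral>\<^sup>+x. ennreal (x powr (s - 1) * planck_term k x) * indicator {0<..} x \<partial>lborel) =
           ennreal (Gamma (s + 2) * (trapezoid_defect s k / (s * (s + 1))))"
proof -
  let ?w = "\<lambda>u::real. (u - real k) * (real k + 1 - u) / 2"
  let ?J = "{real k..real k + 1}"
  let ?k = "\<lambda>x u. ennreal (x powr (s - 1) * (?w u * x\<^sup>2 * exp (- u * x))) * indicator {0<..} x * indicator ?J u"
  have G: "Gamma (s + 2) > 0" using s by (intro Gamma_real_pos) auto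
  have "(\<integral>\<^sup>+x. ennreal (x powr (s - 1) * planck_term k x) * indicator {0<..} x \<partial>lborel) =
     (\<integral>\<^sup>+x. \<integral>\<^sup>+u. ?k x u \<partial>lborel \<partial>lborel)"
  proof (rule nn_integral_cong)
    fix x :: real
    show "ennreal (x powr (s - 1) * planck_term k x) * indicator {0<..} x = (\<integral>\<^sup>+u. ?k x u \<partial>lborel)"
    proof (cases "x > 0")
      case True
      have "(\<integral>\<^sup>+u. ?k x u \<partial>lborel) = (\<integral>\<^sup>+u. ennreal (x powr (s - 1)) *
          (ennreal (?w u * x\<^sup>2 * exp (- u * x)) * indicator ?J u) \<partial>lborel)"
        by (rule nn_integral_cong) (use True in \<open>auto simp: indicator_def simp flip: ennreal_mult'\<close>)
      also have "\<dots> = ennreal (x powr (s - 1)) * ennreal (planck_term k x)"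
        by (subst nn_integral_cmult, simp, subst nn_integral_has_integral_lebesgue'[OF _ planck_term_integral[OF True]])
           auto
      finally show ?thesis using True by (simp add: ennreal_mult')
    qed auto
  qed
  also have "\<dots> = (\<integral>\<^sup>+u. \<integral>\<^sup>+x. ?k x u \<partial>lborel \<partial>lborel)"
    by (rule lborel_pair.Fubini'[symmetric]) measurable
  also have "\<dots> = (\<integral>\<^sup>+u. ennreal (Gamma (s + 2)) * (ennreal (?w u * u powr (- s - 2)) * indicator ?J u) \<partial>lborel)"
  proof (rule nn_integral_cong)
    fix u :: real
    show "(\<integral>\<^sup>+x. ?k x u \<partial>lborel) = ennreal (Gamma (s + 2)) * (ennreal (?w u * u powr (- s - 2)) * indicator ?J u)"
    proof (cases "u \<in> ?J \<and> u \<noteq> 0")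
      case True
      then have u: "u > 0" "?w u \<ge> 0" by auto
      have "(\<integral>\<^sup>+x. ?k x u \<partial>lborel) = (\<integral>\<^sup>+x. ennreal (?w u) *
          (ennreal (x powr ((s + 2) - 1) * exp (- u * x)) * indicator {0<..} x) \<partial>lborel)"
      proof (rule nn_integral_cong)
        fix x :: real
        show "?k x u = ennreal (?w u) * (ennreal (x powr ((s + 2) - 1) * exp (- u * x)) * indicator {0<..} x)"
        proof (cases "x > 0")
          case x: True
          have "x powr (s - 1) * x\<^sup>2 = x powr (s + 2 - 1)"
            using x by (simp add: algebra_simps flip: powr_add powr_numeral)
          moreover have "x powr (s - 1) * (w * x\<^sup>2 * e) = w * ((x powr (s - 1) * x\<^sup>2) * e)" for w e
            by simp
          ultimately have "x powr (s - 1) * (?w u * x\<^sup>2 * exp (- u * x)) = ?w u * (x powr (s + 2 - 1) * exp (- u * x))"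
            by (simp only:)
          moreover have "ennreal (?w u * (x powr (s + 2 - 1) * exp (- u * x))) =
              ennreal (?w u) * ennreal (x powr (s + 2 - 1) * exp (- u * x))"
            using u by (intro ennreal_mult) auto
          moreover have "indicator {0<..} x = (1::ennreal)" "indicator ?J u = (1::ennreal)"
            using x True by auto
          ultimately show ?thesis by (simp only: mult_1_right)
        qed simp
      qed
      also have "\<dots> = ennreal (?w u) * ennreal (Gamma (s + 2) * u powr (-(s + 2)))"
        by (subst nn_integral_cmult, simp, subst nn_integral_Gamma_scaled) (use s u in auto)
      also have "\<dots> = ennreal (Gamma (s + 2)) * ennreal (?w u * u powr (- s - 2))"
      proof -
        have "ennreal a * ennreal (g * b) = ennreal g * ennreal (a * b)" if "a \<ge> 0" "g \<ge> 0" "b \<ge> 0" for a g b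
          using that by (simp add: mult_ac flip: ennreal_mult)
        moreover have "-(s + 2) = - s - 2" by simp
        ultimately show ?thesis using G u by simp
      qed
      finally show ?thesis using True by simp
    next
      \<comment> \<open>Inside the interval this case is only u = 0 with \<open>k = 0\<close>, where
        the kernel weight vanishes.\<close>
      case False
      then show ?thesis by (cases "k = 0") (auto simp: indicator_def)
    qed
  qed
  also have "\<dots> = ennreal (Gamma (s + 2)) * ennreal (trapezoid_defect s k / (s * (s + 1)))"
    by (subst nn_integral_cmult, simp, subst nn_integral_has_integral_lebesgue'[OF _ trapezoid_defect_integral[OF s]])
       auto
  finally show ?thesis using G trapezoid_defect_nonneg[OF s] by (simp flip: ennreal_mult)
qed

text \<open>Termwise integration of a nonnegative series, shared by the trapezoidal and the partial
  fraction expansion of the same function.\<close>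

lemma nn_integral_Mellin_planck:
  assumes f: "\<And>x. x > 0 \<Longrightarrow> (\<lambda>k. f k x) sums (1 / (exp x - 1) - 1 / x + 1 / 2)"
    and f_nonneg: "\<And>k x. x > 0 \<Longrightarrow> f k x \<ge> 0"
    and [measurable]: "\<And>k. f k \<in> borel_measurable borel"
    and I: "\<And>k. (\<integral>\<^sup>+x. ennreal (x powr (s - 1) * f k x) * indicator {0<..} x \<partial>lborel) = ennreal (a k)"
    and a: "\<And>k. a k \<ge> 0" "a sums A"
  shows "(\<integral>\<^sup>+x. ennreal (x powr (s - 1) * (1 / (exp x - 1) - 1 / x + 1 / 2)) * indicator {0<..} x \<partial>lborel) = ennreal A"
proof -
  have "(\<integral>\<^sup>+x. ennreal (x powr (s - 1) * (1 / (exp x - 1) - 1 / x + 1 / 2)) * indicator {0<..} x \<partial>lborel) =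
     (\<integral>\<^sup>+x. (\<Sum>k. ennreal (x powr (s - 1) * f k x) * indicator {0<..} x) \<partial>lborel)"
  proof (rule nn_integral_cong)
    fix x :: real
    show "ennreal (x powr (s - 1) * (1 / (exp x - 1) - 1 / x + 1 / 2)) * indicator {0<..} x =
       (\<Sum>k. ennreal (x powr (s - 1) * f k x) * indicator {0<..} x)"
    proof (cases "x > 0")
      case True
      have "(\<Sum>k. ennreal (x powr (s - 1) * f k x)) =
          ennreal (x powr (s - 1) * (1 / (exp x - 1) - 1 / x + 1 / 2))"
        by (rule suminf_ennreal_eq) (use True f_nonneg f in \<open>auto intro: sums_mult\<close>)
      then show ?thesis using True by simp
    qed simp
  qed
  also have "\<dots> = (\<Sum>k. \<integral>\<^sup>+x. ennreal (x powr (s - 1) * f k x) * indicator {0<..} x \<partial>lborel)"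
    by (rule nn_integral_suminf) measurable
  also have "\<dots> = (\<Sum>k. ennreal (a k))" by (simp only: I)
  also have "\<dots> = ennreal A" by (rule suminf_ennreal_eq[OF a])
  finally show ?thesis .
qed

lemma zeta_approx_of_real:
  "zeta_approx N (of_real s) = of_real ((s - 1) * ((\<Sum>k=1..N. real k powr (-s)) - real N powr (-s) / 2)
     + real N powr (1 - s))"
proof -
  have "of_nat k powr (- complex_of_real s) = of_real (real k powr (-s))"
    "of_nat k powr (1 - complex_of_real s) = of_real (real k powr (1 - s))" for k
    using powr_of_real[of "real k" "-s"] powr_of_real[of "real k" "1 - s"] by simp_all
  then show ?thesis by (simp add: zeta_approx_def)
qed

lemma zeta_reg_of_real:
  assumes "s > -1"
  shows "zeta_reg (of_real s) = of_real (Re (zeta_reg (of_real s)))"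
  by (rule Im_limit_of_real_eq_0[OF zeta_reg_LIMSEQ[of "of_real s", unfolded zeta_approx_of_real]])
     (use assms in simp)

text \<open>Summing the trapezoidal errors over [0, N] telescopes the integrals. For negative
  \<open>s\<close> the summation can start at 0, since u^(-s) vanishes there.\<close>

lemma sum_trapezoid_defect:
  assumes s: "s < 0"
  shows "complex_of_real ((\<Sum>k<N. trapezoid_defect s k) * (s - 1)) = zeta_approx N (of_real s)"
proof -
  have "(\<Sum>k<N. trapezoid_defect s k) * (s - 1) =
    (s - 1) * ((\<Sum>k=1..N. real k powr (-s)) - real N powr (-s) / 2) + real N powr (1 - s)"
  proof (induction N)
    case 0
    then show ?case using s by simp
  next
    case (Suc N)
    have "trapezoid_defect s N * (s - 1) = (s - 1) * ((real N powr (-s) + real (Suc N) powr (-s)) / 2)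
       + (real (Suc N) powr (1 - s) - real N powr (1 - s))"
      using s unfolding trapezoid_defect_def by (simp add: field_simps)
    then show ?case using Suc.IH by (simp add: field_simps)
  qed
  then show ?thesis by (simp only: zeta_approx_of_real)
qed

text \<open>The two evaluations are \<open>?A\<close>, which is Gamma(s+2) F(s) / ((s-1) s (s+1)),
  and \<open>?B\<close>, where the sum of n^(s-1) gives F(1-s)/(-s). Clearing denominators makes the
  identity meaningful at s = 0.\<close>

lemma zeta_reg_functional_equation_real:
  fixes s :: real
  assumes s: "-1 < s" "s < 0"
  defines "F \<equiv> \<lambda>s. Re (zeta_reg (of_real s))"
  shows "2 * cos (pi * s / 2) * Gamma (1 + s) * F s = (1 - s) * (2 * pi) powr s * F (1 - s)"
proof -
  have G: "Gamma (s + 2) > 0" using s by (intro Gamma_real_pos) auto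
  have F: "zeta_reg (of_real s) = of_real (F s)" "zeta_reg (of_real (1 - s)) = of_real (F (1 - s))"
    using zeta_reg_of_real[of s] zeta_reg_of_real[of "1 - s"] s by (simp_all add: F_def)
  let ?a = "\<lambda>k. Gamma (s + 2) * (trapezoid_defect s k / (s * (s + 1)))"
  let ?A = "Gamma (s + 2) * (F s / (s - 1) / (s * (s + 1)))"
  have "(\<lambda>N. complex_of_real ((\<Sum>k<N. trapezoid_defect s k) * (s - 1))) \<longlonglongrightarrow> of_real (F s)"
    unfolding sum_trapezoid_defect[OF s(2)] F(1)[symmetric] using s by (intro zeta_reg_LIMSEQ) simp
  then have "(\<lambda>N. (\<Sum>k<N. trapezoid_defect s k) * (s - 1)) \<longlonglongrightarrow> F s"
    by (simp only: tendsto_of_real_iff)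
  then have "(\<lambda>N. (\<Sum>k<N. trapezoid_defect s k) * (s - 1) / (s - 1)) \<longlonglongrightarrow> F s / (s - 1)"
    using s by (intro tendsto_divide tendsto_const) auto
  then have "trapezoid_defect s sums (F s / (s - 1))"
    using s by (simp add: sums_def)
  then have a: "?a sums ?A" by (intro sums_mult sums_divide)
  have a0: "?a k \<ge> 0" for k
    by (intro mult_nonneg_nonneg trapezoid_defect_nonneg s) (use G in simp)
  let ?b = "\<lambda>n. pi / cos (pi * s / 2) * (2 * pi * real (Suc n)) powr (s - 1)"
  let ?B = "pi / cos (pi * s / 2) * ((2 * pi) powr (s - 1) * (F (1 - s) / (-s)))"
  have "(\<lambda>n. 1 / of_nat (Suc n) powr (complex_of_real (1 - s))) sums (zeta_reg (of_real (1 - s)) / (of_real (1 - s) - 1))"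
    by (rule zeta_reg_sums) (use s in simp)
  moreover have "1 / of_nat (Suc n) powr (complex_of_real (1 - s)) = of_real (real (Suc n) powr (s - 1))" for n
  proof -
    have "of_nat (Suc n) powr (complex_of_real (1 - s)) = of_real (real (Suc n) powr (1 - s))"
      using powr_of_real[of "real (Suc n)" "1 - s"] by (simp del: of_nat_Suc)
    moreover have "real (Suc n) powr (s - 1) = inverse (real (Suc n) powr (1 - s))"
      by (simp flip: powr_minus)
    ultimately show ?thesis by (simp add: inverse_eq_divide)
  qed
  moreover have "zeta_reg (of_real (1 - s)) / (of_real (1 - s) - 1) = of_real (F (1 - s) / (-s))"
    unfolding F by simp
  ultimately have "(\<lambda>n. real (Suc n) powr (s - 1)) sums (F (1 - s) / (-s))"
    by (simp only: sums_of_real_iff)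
  then have "(\<lambda>n. pi / cos (pi * s / 2) * ((2 * pi) powr (s - 1) * real (Suc n) powr (s - 1))) sums ?B"
    by (intro sums_mult)
  then have b: "?b sums ?B" by (simp add: powr_mult del: of_nat_Suc)
  have cos: "cos (pi * s / 2) > 0"
  proof (rule cos_gt_zero_pi)
    have "pi * s > pi * (-1)" "pi * s < pi * 1" using s by (intro mult_strict_left_mono; simp)+
    then show "- (pi / 2) < pi * s / 2" "pi * s / 2 < pi / 2" by simp_all
  qed
  then have b0: "?b n \<ge> 0" for n by simp
  have "(\<integral>\<^sup>+x. ennreal (x powr (s - 1) * (1 / (exp x - 1) - 1 / x + 1 / 2)) * indicator {0<..} x \<partial>lborel) = ennreal ?A"
    by (rule nn_integral_Mellin_planck[OF planck_term_sums planck_term_nonneg _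
          nn_integral_Mellin_planck_term[OF s] a0 a])
       (simp_all add: planck_term_def[abs_def])
  moreover have "(\<integral>\<^sup>+x. ennreal (x powr (s - 1) * (1 / (exp x - 1) - 1 / x + 1 / 2)) * indicator {0<..} x \<partial>lborel) = ennreal ?B"
  proof (rule nn_integral_Mellin_planck[OF planck_partial_fractions _ _ _ b0 b])
    fix n
    have "(\<integral>\<^sup>+x. ennreal (x powr (s - 1) * (2 * x / (x\<^sup>2 + (2 * pi * real (Suc n))\<^sup>2))) * indicator {0<..} x \<partial>lborel) =
      (\<integral>\<^sup>+x. ennreal (2 * x powr s / (x\<^sup>2 + (2 * pi * real (Suc n))\<^sup>2)) * indicator {0<..} x \<partial>lborel)"
    proof (rule nn_integral_cong)
      fix x :: real
      have eq: "x powr (s - 1) * (2 * x / d) = 2 * x powr s / d" if "x > 0" for d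
        using that by (simp add: powr_diff)
      show "ennreal (x powr (s - 1) * (2 * x / (x\<^sup>2 + (2 * pi * real (Suc n))\<^sup>2))) * indicator {0<..} x =
         ennreal (2 * x powr s / (x\<^sup>2 + (2 * pi * real (Suc n))\<^sup>2)) * indicator {0<..} x"
        by (cases "x > 0") (simp_all only: eq, simp)
    qed
    also have "\<dots> = ennreal (?b n)"
      by (rule nn_integral_Mellin_rational) (use s in auto)
    finally show "(\<integral>\<^sup>+x. ennreal (x powr (s - 1) * (2 * x / (x\<^sup>2 + (2 * pi * real (Suc n))\<^sup>2))) * indicator {0<..} x \<partial>lborel) = ennreal (?b n)" .
  qed (auto simp del: of_nat_Suc)
  ultimately have "ennreal ?A = ennreal ?B" by simp
  \<comment> \<open>\<open>ennreal\<close> sends negative numbers to 0, so the signs are needed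
    before it can be cancelled.\<close>
  moreover have "?A \<ge> 0" using a0 a sums_le[OF _ sums_zero a] by simp
  moreover have "?B \<ge> 0" using b0 b sums_le[OF _ sums_zero b] by simp
  ultimately have eq: "?A = ?B" by (simp only: ennreal_inj)
  have "Gamma (s + 2) = (s + 1) * Gamma (1 + s)"
  proof -
    have "s + 1 \<notin> \<int>\<^sub>\<le>\<^sub>0" using s nonpos_Ints_nonpos[of "s + 1"] by auto
    then show ?thesis using Gamma_plus1[of "s + 1"] by (simp add: add.commute add.assoc)
  qed
  then have "?A = Gamma (1 + s) * F s / (s * (s - 1))"
    using s by (simp add: divide_simps)
  moreover have "?B = pi / cos (pi * s / 2) * ((2 * pi) powr s / (2 * pi) * (F (1 - s) / (-s)))"
    by (simp add: powr_diff)
  ultimately have eq': "G * f / (s * (s - 1)) = pi / c * (w / (2 * pi) * (g / (-s)))"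
    if "G = Gamma (1 + s)" "f = F s" "c = cos (pi * s / 2)" "w = (2 * pi) powr s" "g = F (1 - s)" for G f c w g
    using eq that by simp
  have fin: "2 * c * G * f = (1 - s) * w * g"
    if "G * f / (s * (s - 1)) = pi / c * (w / (2 * pi) * (g / (-s)))" "c \<noteq> 0" for G f c w g
  proof -
    have "s * (2 * c * G * f) = s * ((1 - s) * w * g)"
      using that s by (simp add: field_simps)
    then show ?thesis using s by simp
  qed
  show ?thesis by (rule fin[OF eq']) (use cos in auto)
qed

text \<open>On the unit disc 1 + s avoids the poles of \<open>Gamma\<close>, and s and 1 - s both
  have real part above -1. Both sides are therefore holomorphic there and agree on the real interval
  (-1, 0), which accumulates at -1/2.\<close>

theorem zeta_reg_functional_equation:
  assumes s: "norm s < 1"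
  shows "2 * cos (of_real pi * s / 2) * Gamma (1 + s) * zeta_reg s =
           (1 - s) * exp (of_real (ln (2 * pi)) * s) * zeta_reg (1 - s)"
proof -
  let ?f = "\<lambda>s. 2 * cos (of_real pi * s / 2) * Gamma (1 + s) * zeta_reg s -
           (1 - s) * exp (of_real (ln (2 * pi)) * s) * zeta_reg (1 - s)"
  let ?U = "complex_of_real ` {-1<..<0}"
  have Re: "\<bar>Re z\<bar> < 1" if "z \<in> ball 0 1" for z :: complex
    using that abs_Re_le_cmod[of z] by simp
  have "?f s = 0"
  proof (rule analytic_continuation[where S = "ball 0 1" and U = ?U and \<xi> = "of_real (-1/2)" and f = ?f])
    have "1 + z \<notin> \<int>\<^sub>\<le>\<^sub>0" if "z \<in> ball 0 1" for z :: complex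
      using Re[OF that] by (auto elim!: nonpos_Ints_cases simp: complex_eq_iff)
    then have 1: "(\<lambda>s. Gamma (1 + s)) holomorphic_on ball (0::complex) 1"
      by (intro holomorphic_intros) auto
    have 2: "zeta_reg holomorphic_on ball 0 1"
      by (rule holomorphic_on_subset[OF holomorphic_zeta_reg]) (use Re in fastforce)
    have 3: "(\<lambda>s. zeta_reg (1 - s)) holomorphic_on ball 0 1"
      by (rule holomorphic_on_compose_gen[OF _ holomorphic_zeta_reg, unfolded o_def])
         (use Re in \<open>fastforce intro!: holomorphic_intros\<close>)+
    show "?f holomorphic_on ball 0 1"
      by (intro holomorphic_intros 1 2 3) auto
    show "complex_of_real (-1/2) islimpt ?U"
      unfolding islimpt_approachable
    proof safe
      fix e :: real assume e: "e > 0"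
      let ?d = "min (e / 2) (1 / 4)"
      show "\<exists>x'\<in>?U. x' \<noteq> complex_of_real (- 1 / 2) \<and> dist x' (complex_of_real (- 1 / 2)) < e"
      proof (intro bexI conjI)
        show "complex_of_real (-1/2 + ?d) \<in> ?U" by (intro imageI) (use e in auto)
        show "complex_of_real (-1/2 + ?d) \<noteq> complex_of_real (- 1 / 2)"
          using e unfolding of_real_eq_iff by simp
        have "dist (complex_of_real (-1/2 + ?d)) (complex_of_real (- 1 / 2)) = ?d"
          using e by (simp only: dist_of_real dist_real_def)
        then show "dist (complex_of_real (-1/2 + ?d)) (complex_of_real (- 1 / 2)) < e"
          using e by simp
      qed
    qed
    fix z assume "z \<in> ?U"
    then obtain t where t: "z = of_real t" "-1 < t" "t < 0" by auto
    have F: "zeta_reg z = of_real (Re (zeta_reg (of_real t)))"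
      "zeta_reg (1 - z) = of_real (Re (zeta_reg (of_real (1 - t))))"
      using zeta_reg_of_real[of t] zeta_reg_of_real[of "1 - t"] t by simp_all
    have E: "exp (of_real (ln (2 * pi)) * z) = of_real ((2 * pi) powr t)"
      using t by (simp add: powr_def mult.commute flip: exp_of_real)
    have G: "Gamma (1 + z) = of_real (Gamma (1 + t))"
      using t by (simp flip: Gamma_complex_of_real)
    have C: "cos (of_real pi * z / 2) = of_real (cos (pi * t / 2))"
      using t by (simp flip: cos_of_real)
    have "?f z = of_real (2 * cos (pi * t / 2) * Gamma (1 + t) * Re (zeta_reg (of_real t))
        - (1 - t) * (2 * pi) powr t * Re (zeta_reg (of_real (1 - t))))"
      unfolding F E G C using t by simp
    then show "?f z = 0"
      using zeta_reg_functional_equation_real[OF t(2,3)] by simp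
  qed (use s in auto)
  then show ?thesis by simp
qed

section \<open>Taylor coefficients at 0\<close>

text \<open>Since Gamma' = Gamma * Digamma, the second derivative at 1 is Digamma(1)^2 +
  Digamma'(1), and the last term is the Basel sum.\<close>

lemma deriv2_Gamma_1: "deriv (deriv Gamma) (1::complex) = of_real (euler_mascheroni\<^sup>2 + pi\<^sup>2 / 6)"
  and deriv_Gamma_1: "deriv Gamma (1::complex) = - of_real euler_mascheroni"
proof -
  have nonpos: "z \<notin> \<int>\<^sub>\<le>\<^sub>0" if "Re z > 0" for z :: complex
    using that by (auto elim!: nonpos_Ints_cases)
  have d: "deriv Gamma z = Gamma z * Digamma z" if "Re z > 0" for z :: complex
    by (rule DERIV_imp_deriv) (use nonpos[OF that] in \<open>auto intro!: derivative_eq_intros\<close>)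
  show "deriv Gamma (1::complex) = - of_real euler_mascheroni"
    by (simp add: d)
  have "(\<lambda>k. complex_of_real (1 / (real k + 1)\<^sup>2)) sums of_real (pi\<^sup>2 / 6)"
    using inverse_squares_sums by (simp only: sums_of_real_iff) (simp add: add.commute)
  then have P: "Polygamma 1 (1::complex) = of_real (pi\<^sup>2 / 6)"
    by (simp add: Polygamma_def sums_iff inverse_eq_divide add.commute power2_eq_square)
  have "((\<lambda>z. Gamma z * Digamma z) has_field_derivative (- of_real euler_mascheroni)\<^sup>2 + Polygamma 1 1) (at (1::complex))"
    by (auto intro!: derivative_eq_intros simp: power2_eq_square)
  then have "(deriv Gamma has_field_derivative (- of_real euler_mascheroni)\<^sup>2 + Polygamma 1 1) (at (1::complex))"
    by (rule has_field_derivative_transform_within_open[OF _ open_halfspace_Re_gt[of 0]]) (auto simp: d)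
  then show "deriv (deriv Gamma) (1::complex) = of_real (euler_mascheroni\<^sup>2 + pi\<^sup>2 / 6)"
    unfolding P by (simp add: DERIV_imp_deriv)
qed

text \<open>Comparison of the coefficients of orders 1 and 2 in the functional equation, where
  \<open>zeta_reg (1 - s)\<close> contributes the known expansion at 1.\<close>

lemma deriv_zeta_reg_0: "deriv zeta_reg 0 = of_real ((ln (2 * pi) - 1) / 2)"
  and deriv2_zeta_reg_0: "deriv (deriv zeta_reg) 0 =
    of_real ((ln (2 * pi))\<^sup>2 / 2 - ln (2 * pi) - stieltjes_gamma1 - euler_mascheroni\<^sup>2 / 2 + pi\<^sup>2 / 24)"
proof -
  define L where "L = complex_of_real (ln (2 * pi))"
  let ?G = "\<lambda>s::complex. Gamma (1 + s)" and ?R = "\<lambda>s. zeta_reg (1 - s)"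
  have Re: "\<bar>Re z\<bar> < 1" if "z \<in> ball 0 1" for z :: complex
    using that abs_Re_le_cmod[of z] by simp
  have hG: "Gamma holomorphic_on {z::complex. Re z > 0}"
    by (intro holomorphic_intros) (auto elim!: nonpos_Ints_cases)
  have h1: "?G holomorphic_on ball 0 1"
    by (rule holomorphic_on_compose_gen[OF _ hG, unfolded o_def])
       (use Re in \<open>fastforce intro!: holomorphic_intros\<close>)+
  have h2: "zeta_reg holomorphic_on ball 0 1"
    by (rule holomorphic_on_subset[OF holomorphic_zeta_reg]) (use Re in fastforce)
  have h3: "?R holomorphic_on ball 0 1"
    by (rule holomorphic_on_compose_gen[OF _ holomorphic_zeta_reg, unfolded o_def])
       (use Re in \<open>fastforce intro!: holomorphic_intros\<close>)+
  have G: "(deriv ^^ n) ?G 0 = (deriv ^^ n) Gamma 1" for n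
    using higher_deriv_compose_linear'[OF hG, where S = "ball 0 1" and u = 1 and c = 1 and z = 0 and n = n] Re
    by (fastforce simp: open_halfspace_Re_gt add.commute)
  have R: "(deriv ^^ n) ?R 0 = (-1) ^ n * (deriv ^^ n) zeta_reg 1" for n
    using higher_deriv_compose_linear'[OF holomorphic_zeta_reg, where S = "ball 0 1" and u = "-1" and c = 1 and z = 0 and n = n] Re
    by (fastforce simp: open_halfspace_Re_gt)
  let ?FG = "fps_expansion ?G 0" and ?FF = "fps_expansion zeta_reg 0" and ?FR = "fps_expansion ?R 0"
  have eG: "?G has_fps_expansion ?FG" and eF: "zeta_reg has_fps_expansion ?FF" and eR: "?R has_fps_expansion ?FR"
    using h1 h2 h3 by (auto intro!: has_fps_expansion_fps_expansion[of "ball 0 1"])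
  have l: "(\<lambda>s. 2 * cos (of_real (pi / 2) * s) * ?G s * zeta_reg s) has_fps_expansion
      fps_const 2 * fps_cos (of_real (pi / 2)) * ?FG * ?FF"
    by (intro fps_expansion_intros eG eF)
  have "(\<lambda>s. (1 - s) * exp (L * s) * ?R s) has_fps_expansion (1 - fps_X) * fps_exp L * ?FR"
    by (intro fps_expansion_intros eR)
  moreover have "eventually (\<lambda>s. 2 * cos (of_real (pi / 2) * s) * ?G s * zeta_reg s = (1 - s) * exp (L * s) * ?R s) (nhds 0)"
    using eventually_nhds_in_open[of "ball 0 1" "0::complex", simplified]
    by eventually_elim (use zeta_reg_functional_equation in \<open>simp add: L_def\<close>)
  ultimately have "(\<lambda>s. 2 * cos (of_real (pi / 2) * s) * ?G s * zeta_reg s) has_fps_expansion (1 - fps_X) * fps_exp L * ?FR"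
    by (subst has_fps_expansion_cong[OF _ refl])
  with l have eq: "fps_const 2 * fps_cos (of_real (pi / 2)) * ?FG * ?FF = (1 - fps_X) * fps_exp L * ?FR"
    by (rule fps_expansion_unique_complex)
  have c0: "fps_nth ?FG 0 = 1" "fps_nth ?FF 0 = 1/2" "fps_nth ?FR 0 = 1"
    by (simp_all add: fps_expansion_def zeta_reg_0 zeta_reg_1)
  have c1: "fps_nth ?FG 1 = - of_real euler_mascheroni" "fps_nth ?FF 1 = deriv zeta_reg 0"
      "fps_nth ?FR 1 = - of_real euler_mascheroni"
    using G[of 1] R[of 1] by (simp_all add: fps_expansion_def deriv_Gamma_1 deriv_zeta_reg_1)
  have c2: "fps_nth ?FG 2 = of_real (euler_mascheroni\<^sup>2 + pi\<^sup>2 / 6) / 2" "fps_nth ?FF 2 = deriv (deriv zeta_reg) 0 / 2"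
      "fps_nth ?FR 2 = - of_real stieltjes_gamma1"
    using G[of 2] R[of 2] by (simp_all add: fps_expansion_def deriv2_Gamma_1 deriv2_zeta_reg_1 eval_nat_numeral)
  \<comment> \<open>In order 2 the cosine contributes -pi^2/8 and the Gamma factor pi^2/12; the
    difference is the pi^2/24 of the second derivative and, halved, the pi^2/48 of
    \<open>const_K2\<close>.\<close>
  have cos: "fps_nth (fps_cos (complex_of_real (pi / 2))) 0 = 1"
    "fps_nth (fps_cos (complex_of_real (pi / 2))) 1 = 0"
    "fps_nth (fps_cos (complex_of_real (pi / 2))) 2 = - of_real (pi\<^sup>2 / 8)"
    by (simp_all add: fps_cos_def power2_eq_square)
  have mult: "fps_nth (A * B) 0 = fps_nth A 0 * fps_nth B 0"
    "fps_nth (A * B) 1 = fps_nth A 0 * fps_nth B 1 + fps_nth A 1 * fps_nth B 0"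
    "fps_nth (A * B) 2 = fps_nth A 0 * fps_nth B 2 + fps_nth A 1 * fps_nth B 1 + fps_nth A 2 * fps_nth B 0"
    for A B :: "complex fps"
    by (simp_all add: fps_mult_nth numeral_2_eq_2)
  have basic: "fps_nth (fps_const 2) 0 = (2::complex)" "fps_nth (fps_const 2) 1 = (0::complex)"
    "fps_nth (fps_const 2) 2 = (0::complex)" "fps_nth (1 - fps_X) 0 = (1::complex)" "fps_nth (1 - fps_X) 1 = (-1::complex)"
    "fps_nth (1 - fps_X) 2 = (0::complex)" "fps_nth (fps_exp L) 0 = 1" "fps_nth (fps_exp L) 1 = L"
    "fps_nth (fps_exp L) 2 = L\<^sup>2 / 2"
    by (simp_all add: fact_numeral)
  have "fps_nth (fps_const 2 * fps_cos (of_real (pi / 2)) * ?FG * ?FF) 1 = fps_nth ((1 - fps_X) * fps_exp L * ?FR) 1"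
    by (simp only: eq)
  then have f1: "deriv zeta_reg 0 = (L - 1) / 2"
    unfolding mult cos basic c0 c1 by (simp add: field_simps)
  then show "deriv zeta_reg 0 = of_real ((ln (2 * pi) - 1) / 2)" by (simp add: L_def)
  have "fps_nth (fps_const 2 * fps_cos (of_real (pi / 2)) * ?FG * ?FF) 2 = fps_nth ((1 - fps_X) * fps_exp L * ?FR) 2"
    by (simp only: eq)
  then have "16 * deriv (deriv zeta_reg) 0 =
      16 * (L\<^sup>2 / 2 - L - of_real stieltjes_gamma1 - (of_real euler_mascheroni)\<^sup>2 / 2 + (of_real pi)\<^sup>2 / 24)"
    unfolding mult cos basic c0 c1 c2 f1 by (simp add: field_simps)
  then have "deriv (deriv zeta_reg) 0 =
      L\<^sup>2 / 2 - L - of_real stieltjes_gamma1 - (of_real euler_mascheroni)\<^sup>2 / 2 + (of_real pi)\<^sup>2 / 24"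
    by (subst (asm) mult_cancel_left) auto
  then show "deriv (deriv zeta_reg) 0 =
    of_real ((ln (2 * pi))\<^sup>2 / 2 - ln (2 * pi) - stieltjes_gamma1 - euler_mascheroni\<^sup>2 / 2 + pi\<^sup>2 / 24)"
    by (simp add: L_def)
qed

section \<open>Error terms and the double sums\<close>

definition ln_sum :: "nat \<Rightarrow> real" where "ln_sum n = (\<Sum>k=1..n. ln (real k))"
definition ln_over_sum :: "nat \<Rightarrow> real" where "ln_over_sum n = (\<Sum>k=1..n. ln (real k) / real k)"
definition ln_squared_sum :: "nat \<Rightarrow> real" where "ln_squared_sum n = (\<Sum>k=1..n. (ln (real k))\<^sup>2)"

text \<open>In this and the next three definitions the subtracted expressions are Euler-Maclaurin
  expansions. Their constants are gamma, -zeta'(0) = ln(2 pi)/2, gamma_1 and zeta''(0), zeta being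
  continued to 0.\<close>

definition harmonic_err :: "nat \<Rightarrow> real" where
  "harmonic_err n = H (real n) - (ln (real n) + euler_mascheroni + 1 / (2 * real n))"
definition ln_sum_err :: "nat \<Rightarrow> real" where
  "ln_sum_err n = ln_sum n - (real n * ln (real n) - real n + ln (real n) / 2 + ln (2 * pi) / 2)"
definition ln_over_sum_err :: "nat \<Rightarrow> real" where
  "ln_over_sum_err n = ln_over_sum n - ((ln (real n))\<^sup>2 / 2 + stieltjes_gamma1 + ln (real n) / (2 * real n))"
definition ln_squared_sum_err :: "nat \<Rightarrow> real" where
  "ln_squared_sum_err n = ln_squared_sum n - (real n * (ln (real n))\<^sup>2 - 2 * real n * ln (real n)
       + 2 * real n + (ln (real n))\<^sup>2 / 2
       + (stieltjes_gamma1 + euler_mascheroni\<^sup>2 / 2 - pi\<^sup>2 / 24 - (ln (2 * pi))\<^sup>2 / 2))"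

lemma bigo_powrI:
  assumes "\<exists>C. \<forall>N>0. \<bar>f N\<bar> \<le> C * real N powr p"
  shows "f \<in> O(\<lambda>N. real N powr p)"
proof -
  obtain C where "\<And>N. N > 0 \<Longrightarrow> \<bar>f N\<bar> \<le> C * real N powr p" using assms by blast
  then show ?thesis
    by (intro bigoI[of _ C]) (auto intro: eventually_mono[OF eventually_gt_at_top[of 0]])
qed

lemma harmonic_err_bigo: "harmonic_err \<in> O(\<lambda>n. real n powr (-7/4))"
  unfolding harmonic_err_def by (rule bigo_powrI[OF harmonic_error])

lemma ln_over_sum_err_bigo: "ln_over_sum_err \<in> O(\<lambda>n. real n powr (-7/4))"
  unfolding ln_over_sum_err_def ln_over_sum_def by (rule bigo_powrI[OF log_harmonic_error])

lemma ln_sum_err_bigo: "ln_sum_err \<in> O(\<lambda>n. real n powr (-3/4))"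
proof -
  have *: "Re (deriv zeta_reg 0) + 1/2 = ln (2 * pi) / 2"
    by (simp add: deriv_zeta_reg_0 field_simps)
  show ?thesis
    unfolding ln_sum_err_def ln_sum_def by (rule bigo_powrI[OF sum_ln_error[unfolded *]])
qed

lemma ln_squared_sum_err_bigo: "ln_squared_sum_err \<in> O(\<lambda>n. real n powr (-3/4))"
proof -
  have *: "x - (2 * Re (deriv zeta_reg 0) + 1 + Re (deriv (deriv zeta_reg) 0)) =
      x + (stieltjes_gamma1 + euler_mascheroni\<^sup>2 / 2 - pi\<^sup>2 / 24 - (ln (2 * pi))\<^sup>2 / 2)" for x
    by (simp add: deriv_zeta_reg_0 deriv2_zeta_reg_0 del: of_real_diff of_real_add of_real_divide of_real_power)
       (simp add: field_simps)
  show ?thesis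
    unfolding ln_squared_sum_err_def ln_squared_sum_def
    by (rule bigo_powrI[OF sum_ln_squared_error[unfolded *]])
qed

section \<open>Orders of growth along the floor function\<close>

lemma bigo_powr_mult:
  assumes "f1 \<in> O[F](\<lambda>x. g x powr p)" "f2 \<in> O[F](\<lambda>x. g x powr q)" "p + q \<le> u"
    "filterlim g at_top F"
  shows "(\<lambda>x. f1 x * f2 x :: real) \<in> O[F](\<lambda>x. g x powr u)"
proof -
  have "(\<lambda>x. f1 x * f2 x) \<in> O[F](\<lambda>x. g x powr p * g x powr q)"
    by (rule landau_o.big.mult[OF assms(1,2)])
  also have "(\<lambda>x. g x powr p * g x powr q) = (\<lambda>x. g x powr (p + q))" by (simp add: powr_add)
  also have "(\<lambda>x. g x powr (p + q)) \<in> O[F](\<lambda>x. g x powr u)"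
  proof (rule bigoI[of _ 1])
    have "eventually (\<lambda>x. g x \<ge> 1) F" using assms(4) by (auto simp: filterlim_at_top)
    then show "eventually (\<lambda>x. norm (g x powr (p + q)) \<le> 1 * norm (g x powr u)) F"
      by eventually_elim (use assms(3) in \<open>auto intro: powr_mono\<close>)
  qed
  finally show ?thesis .
qed

lemma tendsto_0_bigo_powr:
  assumes "f \<in> O[F](\<lambda>x. g x powr p)" "p < 0" "filterlim g at_top F"
  shows "(f \<longlongrightarrow> (0::real)) F"
proof -
  have "((\<lambda>x. g x powr p) \<longlongrightarrow> 0) F"
    using assms(2,3) by (rule tendsto_neg_powr)
  moreover obtain C where "eventually (\<lambda>x. norm (f x) \<le> C * norm (g x powr p)) F"
    using assms(1) by (elim landau_o.bigE)
  ultimately show ?thesis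
    by (intro Lim_null_comparison[of f "\<lambda>x. C * norm (g x powr p)"]
          tendsto_mult_right_zero tendsto_norm_zero)
qed

lemma filterlim_nat_floor: "filterlim (\<lambda>x::real. nat \<lfloor>x\<rfloor>) sequentially at_top"
  by (intro filterlim_compose[OF filterlim_nat_sequentially] filterlim_floor_sequentially)

text \<open>For x \<ge> 2 the floor is at least x/2, and a power with nonpositive exponent is
  antitone.\<close>

lemma bigo_nat_floor:
  fixes f :: "nat \<Rightarrow> real"
  assumes "f \<in> O(\<lambda>n. real n powr p)" "p \<le> 0"
  shows "(\<lambda>x. f (nat \<lfloor>x\<rfloor>)) \<in> O[at_top](\<lambda>x::real. x powr p)"
proof -
  have "(\<lambda>x. f (nat \<lfloor>x\<rfloor>)) \<in> O[at_top](\<lambda>x::real. real (nat \<lfloor>x\<rfloor>) powr p)"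
    by (rule landau_o.big.compose[OF assms(1) filterlim_nat_floor])
  also have "(\<lambda>x. real (nat \<lfloor>x\<rfloor>) powr p) \<in> O[at_top](\<lambda>x::real. x powr p)"
  proof (rule bigoI[of _ "(1/2) powr p"], rule eventually_mono[OF eventually_ge_at_top[of 2]])
    fix x :: real assume x: "x \<ge> 2"
    have "real (nat \<lfloor>x\<rfloor>) \<ge> 1/2 * x" using x by linarith
    then have "real (nat \<lfloor>x\<rfloor>) powr p \<le> (1/2 * x) powr p"
      using x assms(2) by (intro powr_mono2') auto
    then show "norm (real (nat \<lfloor>x\<rfloor>) powr p) \<le> (1/2) powr p * norm (x powr p)"
      using x by (subst (asm) powr_mult) auto
  qed
  finally show ?thesis .
qed

lemma nat_floor_frac: "x \<ge> 0 \<Longrightarrow> x = real (nat \<lfloor>x\<rfloor>) + frac x"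
  by (simp add: frac_def)

definition ln_gap :: "real \<Rightarrow> real" where
  "ln_gap x = ln x - ln (real (nat \<lfloor>x\<rfloor>))"

text \<open>With n the floor of x and u = frac x / n the gap is ln(1+u), which lies between u - u^2
  and u. The second bound is the sharper fact that n times the gap equals frac x up to
  O(1/x).\<close>

lemma ln_gap_bounds:
  assumes x: "x \<ge> 1"
  shows "\<bar>ln_gap x\<bar> \<le> 2 / x" "\<bar>real (nat \<lfloor>x\<rfloor>) * ln_gap x - frac x\<bar> \<le> 2 / x"
    "\<bar>1 / real (nat \<lfloor>x\<rfloor>) - 1 / x\<bar> \<le> 2 / x\<^sup>2"
proof -
  define n where "n = real (nat \<lfloor>x\<rfloor>)"
  define f where "f = frac x"
  have f: "0 \<le> f" "f < 1" by (simp_all add: f_def frac_lt_1)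
  have xn: "x = n + f" using nat_floor_frac[of x] x by (simp add: n_def f_def)
  have "\<lfloor>x\<rfloor> \<ge> 1" using x by simp
  then have n: "n \<ge> 1" unfolding n_def by linarith
  have n2: "1 / n \<le> 2 / x" using n f xn by (simp add: field_simps)
  define u where "u = f / n"
  have u: "0 \<le> u" "u \<le> 1" "u \<le> 1 / n" using f n by (simp_all add: u_def field_simps)
  have g: "ln_gap x = ln (1 + u)"
  proof -
    have "1 + u = x / n" using n xn by (simp add: u_def field_simps)
    then show ?thesis using n x by (simp add: ln_gap_def ln_div flip: n_def)
  qed
  have b: "ln (1 + u) \<le> u" "u - u\<^sup>2 \<le> ln (1 + u)" "0 \<le> ln (1 + u)"
    using u by (simp_all add: ln_add_one_self_le_self ln_one_plus_pos_lower_bound)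
  show "\<bar>ln_gap x\<bar> \<le> 2 / x" using b u n2 g by simp
  have nu: "n * u = f" using n by (simp add: u_def)
  have "n * (u - u\<^sup>2) \<le> n * ln (1 + u)" "n * ln (1 + u) \<le> n * u"
    using b n by (simp_all add: mult_left_mono)
  moreover have "n * (u - u\<^sup>2) = f - f * u" by (simp add: right_diff_distrib power2_eq_square nu flip: mult.assoc)
  moreover have "f * u \<le> 1 * u" using f u by (intro mult_right_mono) auto
  ultimately have "\<bar>n * ln (1 + u) - f\<bar> \<le> 1 / n" using nu u by linarith
  then show "\<bar>real (nat \<lfloor>x\<rfloor>) * ln_gap x - frac x\<bar> \<le> 2 / x"
    using n2 by (simp add: g n_def f_def)
  have "1 / n - 1 / x = f / (n * x)" using n x xn by (simp add: field_simps)
  moreover have "f / (n * x) \<le> 1 / (n * x)" using f n x by (intro divide_right_mono) auto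
  moreover have "1 / (n * x) \<le> 2 / x\<^sup>2" using n2 x n by (simp add: field_simps power2_eq_square)
  moreover have "f / (n * x) \<ge> 0" using f n x by simp
  ultimately show "\<bar>1 / real (nat \<lfloor>x\<rfloor>) - 1 / x\<bar> \<le> 2 / x\<^sup>2" unfolding n_def[symmetric] by linarith
qed

lemma frac_bigo: "frac \<in> O[at_top](\<lambda>x::real. x powr 0)"
  by (rule bigoI[of _ 1], rule eventually_mono[OF eventually_gt_at_top[of 0]])
     (auto simp: frac_lt_1 less_imp_le)

lemma ln_gap_bigo: "ln_gap \<in> O[at_top](\<lambda>x. x powr (-1))"
  by (rule bigoI[of _ 2], rule eventually_mono[OF eventually_ge_at_top[of 1]])
     (use ln_gap_bounds(1) in \<open>auto simp: powr_minus divide_inverse\<close>)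

lemma ln_gap_defect_bigo:
  "(\<lambda>x. real (nat \<lfloor>x\<rfloor>) * ln_gap x - frac x) \<in> O[at_top](\<lambda>x. x powr (-1))"
  by (rule bigoI[of _ 2], rule eventually_mono[OF eventually_ge_at_top[of 1]])
     (use ln_gap_bounds(2) in \<open>auto simp: powr_minus divide_inverse\<close>)

lemma inverse_gap_bigo:
  "(\<lambda>x. 1 / real (nat \<lfloor>x\<rfloor>) - 1 / x) \<in> O[at_top](\<lambda>x. x powr (-2))"
  by (rule bigoI[of _ 2], rule eventually_mono[OF eventually_ge_at_top[of 1]])
     (use ln_gap_bounds(3) in \<open>auto simp: powr_minus divide_inverse\<close>)

lemma inverse_nat_floor_bigo: "(\<lambda>x. 1 / real (nat \<lfloor>x\<rfloor>)) \<in> O[at_top](\<lambda>x. x powr (-1))"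
  by (rule bigo_nat_floor) (auto intro!: bigoI[of _ 1] simp: powr_minus divide_inverse)

lemma inverse_bigo: "(\<lambda>x. 1 / x) \<in> O[at_top](\<lambda>x::real. x powr (-1))"
  by (rule bigoI[of _ 1], rule eventually_mono[OF eventually_gt_at_top[of 0]])
     (auto simp: powr_minus divide_inverse)

text \<open>The exponent 1/8 is small enough that a logarithm times a harmonic error is still of
  order 1/8 - 7/4 = -13/8, below -3/2.\<close>

lemma ln_nat_floor_bigo: "(\<lambda>x. ln (real (nat \<lfloor>x\<rfloor>))) \<in> O[at_top](\<lambda>x. x powr (1/8))"
proof -
  have "(\<lambda>x. ln (real (nat \<lfloor>x\<rfloor>))) \<in> O[at_top](\<lambda>x. ln x)"
    by (rule bigoI[of _ 1], rule eventually_mono[OF eventually_ge_at_top[of 1]]) auto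
  also have "(\<lambda>x::real. ln x) \<in> O[at_top](\<lambda>x. x powr (1/8))" by real_asymp
  finally show ?thesis .
qed

lemma nat_floor_bigo: "(\<lambda>x. real (nat \<lfloor>x\<rfloor>)) \<in> O[at_top](\<lambda>x. x powr 1)"
  by (rule bigoI[of _ 1], rule eventually_mono[OF eventually_ge_at_top[of 1]]) auto

lemmas floor_err_bigo =
  bigo_nat_floor[OF harmonic_err_bigo, simplified] bigo_nat_floor[OF ln_over_sum_err_bigo, simplified]
  bigo_nat_floor[OF ln_sum_err_bigo, simplified] bigo_nat_floor[OF ln_squared_sum_err_bigo, simplified]

lemma H_floor: "H x = H (real (nat \<lfloor>x\<rfloor>))"
  by (simp add: H_def)

section \<open>Decay of R1 and R2\<close>

text \<open>An exact identity arranged so that each product on the right is visibly small: orders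
  -2, -2 and -7/4.\<close>

lemma R1_expansion:
  assumes "x \<ge> 1"
  defines "n \<equiv> nat \<lfloor>x\<rfloor>"
  shows "R1 x = (frac x - 1/2) * (1 / real n - 1 / x)
     + (real n * ln_gap x - frac x) * (1 / real n) - harmonic_err n"
proof -
  have "\<lfloor>x\<rfloor> \<ge> 1" using assms by simp
  then have n: "real n \<ge> 1" unfolding n_def by linarith
  have "R1 x = ln_gap x - 1 / (2 * real n) - harmonic_err n - (frac x - 1/2) / x"
    unfolding R1_def H_floor[of x] harmonic_err_def ln_gap_def n_def[symmetric] by simp
  then show ?thesis using n assms(1) by (simp add: field_simps)
qed

text \<open>As for \<open>R1\<close>: all terms of order x^(-1) or larger have cancelled, and the
  largest one left is \<open>a * harmonic_err n\<close>, of order -13/8.\<close>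

lemma R2_expansion:
  assumes "x \<ge> 1"
  defines "n \<equiv> nat \<lfloor>x\<rfloor>"
  defines "e \<equiv> ln_gap x" and "t \<equiv> real n * ln_gap x - frac x" and "a \<equiv> ln (real n)"
    and "d \<equiv> 1 / real n - 1 / x"
  shows "R2 x = (2 * frac x - 1) * d + e * (1 / x) / 2 + t * (1 / x) - ln_sum_err n * (1 / x)
    + 2 * (t * (1 / real n)) - e * e / 2 + a * harmonic_err n + e * (1 / real n) / 2 + e * harmonic_err n
    - ln_over_sum_err n - 2 * harmonic_err n"
proof -
  have "\<lfloor>x\<rfloor> \<ge> 1" using assms by simp
  then have n: "real n \<ge> 1" unfolding n_def by linarith
  define f where "f = frac x"
  have xn: "x = real n + f" using nat_floor_frac[of x] assms(1) by (simp add: n_def f_def)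
  have ln: "ln x = a + e" by (simp add: a_def e_def ln_gap_def n_def)
  define h where "h = harmonic_err n"
  have Hn: "(\<Sum>l=1..n. 1 / real l) = a + euler_mascheroni + 1 / (2 * real n) + h"
    unfolding h_def harmonic_err_def H_of_nat a_def by simp
  define s where "s = ln_sum_err n"
  have Fn: "(\<Sum>l=1..n. ln (real l)) = real n * a - real n + a / 2 + ln (2 * pi) / 2 + s"
    by (simp add: s_def ln_sum_err_def ln_sum_def a_def)
  define q where "q = ln_over_sum_err n"
  have Ln: "(\<Sum>l=1..n. ln (real l) / real l) = a\<^sup>2 / 2 + stieltjes_gamma1 + a / (2 * real n) + q"
    by (simp add: q_def ln_over_sum_err_def ln_over_sum_def a_def)
  have "(\<Sum>l=1..n. (1 + x / real l) * ln (x / real l) + 2 * (1 - x / real l)) =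
     (\<Sum>l=1..n. ln x - ln (real l) + x * ln x * (1 / real l) - x * (ln (real l) / real l) + 2 - 2 * x * (1 / real l))"
    by (intro sum.cong refl) (use assms(1) in \<open>simp add: ln_div field_simps\<close>)
  also have "\<dots> = real n * ln x - (\<Sum>l=1..n. ln (real l)) + x * ln x * (\<Sum>l=1..n. 1 / real l)
      - x * (\<Sum>l=1..n. ln (real l) / real l) + 2 * real n - 2 * x * (\<Sum>l=1..n. 1 / real l)"
    by (simp add: sum.distrib sum_subtractf sum_distrib_left)
  finally have S: "(\<Sum>l=1..n. (1 + x / real l) * ln (x / real l) + 2 * (1 - x / real l)) = \<dots>" .
  define jx where "jx = 1 / x"
  define jn where "jn = 1 / real n"
  have jx: "x * jx = 1" "real n * jx = 1 - f * jx" and jn: "real n * jn = 1"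
    using assms(1) n by (simp_all add: jx_def jn_def xn field_simps)
  have half: "1 / (2 * real n) = jn / 2" "a / (2 * real n) = a * jn / 2" by (simp_all add: jn_def)
  have t: "t = real n * e - f" by (simp add: t_def e_def f_def)
  have "R2 x = jx * (1/2 * ln (2 * pi) + 1 + 1/2 * (a + e))
     + (2 - euler_mascheroni) * (a + e) - 1/2 * (a + e)\<^sup>2 + 2 * euler_mascheroni + stieltjes_gamma1 - 3
     + jx * (real n * (a + e) - (real n * a - real n + a / 2 + ln (2 * pi) / 2 + s) + 2 * real n)
     + (x * jx) * ((a + e) * (a + euler_mascheroni + jn / 2 + h)
     - (a\<^sup>2 / 2 + stieltjes_gamma1 + a * jn / 2 + q) - 2 * (a + euler_mascheroni + jn / 2 + h))"
    unfolding R2_def n_def[symmetric] S Hn Fn Ln half unfolding ln jx_def[symmetric]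
    by (simp add: algebra_simps)
  \<comment> \<open>The last three summands vanish by \<open>n * jx = 1 - f * jx\<close>,
    \<open>n * jn = 1\<close> and \<open>t = n * e - f\<close>. Carrying them along turns the step
    into a polynomial identity.\<close>
  also have "\<dots> = (2 * f - 1) * (jn - jx) + e * jx / 2 + t * jx - s * jx
    + 2 * (t * jn) - e * e / 2 + a * h + e * jn / 2 + e * h - q - 2 * h
    + 3 * (real n * jx - 1 + f * jx) - 2 * e * (real n * jn - 1) + (2 * jn + jx) * (real n * e - f - t)"
    unfolding jx(1) by (simp add: algebra_simps add_divide_distrib power2_eq_square)
  finally show ?thesis
    unfolding jx(2) jn t by (simp add: f_def h_def s_def q_def jn_def jx_def d_def)
qed

lemma R1_bigo: "R1 \<in> O[at_top](\<lambda>x. x powr (-3/2))"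
proof -
  note m = bigo_powr_mult[OF _ _ _ filterlim_ident]
  have c: "(\<lambda>x. c) \<in> O[at_top](\<lambda>x::real. x powr 0)" for c :: real
    by (rule bigoI[of _ "\<bar>c\<bar>"], rule eventually_mono[OF eventually_gt_at_top[of 0]]) auto
  have "(\<lambda>x. (frac x - 1/2) * (1 / real (nat \<lfloor>x\<rfloor>) - 1 / x)
     + (real (nat \<lfloor>x\<rfloor>) * ln_gap x - frac x) * (1 / real (nat \<lfloor>x\<rfloor>)) - 1 * harmonic_err (nat \<lfloor>x\<rfloor>))
     \<in> O[at_top](\<lambda>x::real. x powr (-3/2))"
    by (intro sum_in_bigo m[OF sum_in_bigo(2)[OF frac_bigo c] inverse_gap_bigo]
          m[OF ln_gap_defect_bigo inverse_nat_floor_bigo] m[OF c floor_err_bigo(1)]) simp_all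
  also have "?this \<longleftrightarrow> ?thesis"
    by (rule landau_o.big.in_cong, rule eventually_mono[OF eventually_ge_at_top[of 1]])
       (simp add: R1_expansion)
  finally show ?thesis .
qed

lemma R2_bigo: "R2 \<in> O[at_top](\<lambda>x. x powr (-3/2))"
proof -
  note m = bigo_powr_mult[OF _ _ _ filterlim_ident]
  have c: "(\<lambda>x. c) \<in> O[at_top](\<lambda>x::real. x powr 0)" for c :: real
    by (rule bigoI[of _ "\<bar>c\<bar>"], rule eventually_mono[OF eventually_gt_at_top[of 0]]) auto
  have f: "(\<lambda>x. 2 * frac x - 1) \<in> O[at_top](\<lambda>x::real. x powr 0)"
    by (intro sum_in_bigo m[OF c frac_bigo] c) simp
  have cm: "h \<in> O[at_top](g) \<Longrightarrow> (\<lambda>x. c * h x) \<in> O[at_top](g)" for h g :: "real \<Rightarrow> real" and c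
    by simp
  have "(\<lambda>x. (2 * frac x - 1) * (1 / real (nat \<lfloor>x\<rfloor>) - 1 / x) + 1/2 * (ln_gap x * (1 / x))
    + (real (nat \<lfloor>x\<rfloor>) * ln_gap x - frac x) * (1 / x) - ln_sum_err (nat \<lfloor>x\<rfloor>) * (1 / x)
    + 2 * ((real (nat \<lfloor>x\<rfloor>) * ln_gap x - frac x) * (1 / real (nat \<lfloor>x\<rfloor>))) - 1/2 * (ln_gap x * ln_gap x)
    + ln (real (nat \<lfloor>x\<rfloor>)) * harmonic_err (nat \<lfloor>x\<rfloor>) + 1/2 * (ln_gap x * (1 / real (nat \<lfloor>x\<rfloor>)))
    + ln_gap x * harmonic_err (nat \<lfloor>x\<rfloor>) - 1 * ln_over_sum_err (nat \<lfloor>x\<rfloor>) - 2 * harmonic_err (nat \<lfloor>x\<rfloor>))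
     \<in> O[at_top](\<lambda>x::real. x powr (-3/2))"
    by (intro sum_in_bigo m[OF f inverse_gap_bigo] m[OF c floor_err_bigo(2)] m[OF c floor_err_bigo(1)] cm
      m[OF ln_gap_bigo inverse_bigo]
      m[OF ln_gap_defect_bigo inverse_bigo] m[OF floor_err_bigo(3) inverse_bigo]
      m[OF ln_gap_defect_bigo inverse_nat_floor_bigo] m[OF ln_gap_bigo ln_gap_bigo]
      m[OF ln_nat_floor_bigo floor_err_bigo(1)] m[OF ln_gap_bigo inverse_nat_floor_bigo]
      m[OF ln_gap_bigo floor_err_bigo(1)]) simp_all
  also have "?this \<longleftrightarrow> ?thesis"
    by (rule landau_o.big.in_cong, rule eventually_mono[OF eventually_ge_at_top[of 1]])
       (simp add: R2_expansion)
  finally show ?thesis .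
qed

lemma summable_dilation:
  fixes f :: "real \<Rightarrow> real"
  assumes f: "f \<in> O[at_top](\<lambda>x. x powr (-3/2))" and x: "x > 0"
  shows "summable (\<lambda>k. f (real (Suc k) * x))"
proof -
  have lim: "filterlim (\<lambda>k. real k * x) at_top sequentially"
    using x by real_asymp
  have "(\<lambda>k. f (real k * x)) \<in> O(\<lambda>k. (real k * x) powr (-3/2))"
    by (rule landau_o.big.compose[OF f lim])
  also have "(\<lambda>k. (real k * x) powr (-3/2)) = (\<lambda>k. real k powr (-3/2) * x powr (-3/2))"
    using x by (simp add: powr_mult)
  finally have "(\<lambda>k. f (real k * x)) \<in> O(\<lambda>k. norm (real k powr (-3/2)))"
    using x by simp
  then have "summable (\<lambda>k. f (real k * x))"
    by (rule summable_comparison_test_bigo[rotated]) (simp add: summable_real_powr_iff)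
  then show ?thesis by (subst summable_Suc_iff)
qed

section \<open>Exact evaluation of the truncated differences\<close>

text \<open>The first sum runs over the pairs with l r \<le> k, the second over those with k \<le> l
  r. By the choice of \<open>N\<close> both regions stay inside the rectangle, and the pairs with k
  = l r are counted twice but contribute 0.\<close>

lemma sum_floor_triangles:
  fixes g :: "nat \<Rightarrow> nat \<Rightarrow> real" and r :: real and M :: nat
  assumes r: "r > 0" and diag: "\<And>k l. real k = real l * r \<Longrightarrow> l > 0 \<Longrightarrow> g k l = 0"
  defines "N \<equiv> nat \<lfloor>r * real M\<rfloor>"
  shows "(\<Sum>k=1..N. \<Sum>l=1..nat \<lfloor>real k / r\<rfloor>. g k l) + (\<Sum>l=1..M. \<Sum>k=1..nat \<lfloor>real l * r\<rfloor>. g k l) =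
         (\<Sum>k=1..N. \<Sum>l=1..M. g k l)"
proof -
  have floor: "l \<le> nat \<lfloor>y\<rfloor> \<longleftrightarrow> real l \<le> y" if "y \<ge> 0" for l y
    using that by (simp add: le_nat_floor nat_le_eq_zle le_nat_iff le_floor_iff)
  have A: "(\<Sum>l=1..nat \<lfloor>real k / r\<rfloor>. g k l) = (\<Sum>l=1..M. if real l * r \<le> real k then g k l else 0)"
    if k: "k \<in> {1..N}" for k
  proof -
    have "real k \<le> r * real M" using k floor[of "r * real M" k] r by (simp add: N_def)
    then have "l \<le> M" if "real l * r \<le> real k" for l
      using that r by (metis mult.commute mult_le_cancel_left_pos of_nat_le_iff order_trans)
    then have "{1..nat \<lfloor>real k / r\<rfloor>} = {1..M} \<inter> {l. real l * r \<le> real k}"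
      using r by (auto simp: floor pos_le_divide_eq)
    then show ?thesis by (simp add: sum.If_cases)
  qed
  have B: "(\<Sum>k=1..nat \<lfloor>real l * r\<rfloor>. g k l) = (\<Sum>k=1..N. if real k \<le> real l * r then g k l else 0)"
    if l: "l \<in> {1..M}" for l
  proof -
    have lr: "real l * r \<le> r * real M" using l r by simp
    have "k \<le> N" if k: "real k \<le> real l * r" for k
      using order_trans[OF k lr] r by (simp add: N_def floor)
    then have "{1..nat \<lfloor>real l * r\<rfloor>} = {1..N} \<inter> {k. real k \<le> real l * r}"
      using r by (auto simp: floor)
    then show ?thesis by (simp add: sum.If_cases)
  qed
  have "(\<Sum>k=1..N. \<Sum>l=1..nat \<lfloor>real k / r\<rfloor>. g k l) + (\<Sum>l=1..M. \<Sum>k=1..nat \<lfloor>real l * r\<rfloor>. g k l) =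
     (\<Sum>k=1..N. \<Sum>l=1..M. if real l * r \<le> real k then g k l else 0) +
     (\<Sum>k=1..N. \<Sum>l=1..M. if real k \<le> real l * r then g k l else 0)"
  proof -
    have "(\<Sum>k=1..N. \<Sum>l=1..nat \<lfloor>real k / r\<rfloor>. g k l) =
        (\<Sum>k=1..N. \<Sum>l=1..M. if real l * r \<le> real k then g k l else 0)"
      by (intro sum.cong refl A)
    moreover have "(\<Sum>l=1..M. \<Sum>k=1..nat \<lfloor>real l * r\<rfloor>. g k l) =
        (\<Sum>l=1..M. \<Sum>k=1..N. if real k \<le> real l * r then g k l else 0)"
      by (intro sum.cong refl B)
    moreover have "\<dots> = (\<Sum>k=1..N. \<Sum>l=1..M. if real k \<le> real l * r then g k l else 0)"
      by (rule sum.swap)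
    ultimately show ?thesis by (simp only:)
  qed
  also have "\<dots> = (\<Sum>k=1..N. \<Sum>l=1..M. g k l)"
    unfolding sum.distrib[symmetric] by (intro sum.cong refl) (auto simp: diag)
  finally show ?thesis .
qed

text \<open>Replacing frac x by x minus its floor moves the floor into the sum, so the kernel 1/l -
  1/x vanishes at l = x; the remaining x/x is the source of the -1.\<close>

lemma R1_eq:
  assumes "x > 0"
  shows "R1 x = ln x + (euler_mascheroni - 1) + 1 / (2 * x) - (\<Sum>l=1..nat \<lfloor>x\<rfloor>. 1 / real l - 1 / x)"
proof -
  have "(\<Sum>l=1..nat \<lfloor>x\<rfloor>. 1 / real l - 1 / x) = H x - real (nat \<lfloor>x\<rfloor>) / x"
    by (simp add: sum_subtractf H_def)
  moreover have "real (nat \<lfloor>x\<rfloor>) = x - frac x" using nat_floor_frac[of x] assms by simp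
  ultimately show ?thesis using assms by (simp add: R1_def field_simps)
qed

text \<open>The two triangles enter the difference with the same sign, minus, so together they give
  minus the rectangle, which splits into products of single sums.\<close>

lemma sum_R1_difference:
  fixes r :: real
  assumes r: "r > 0"
  defines "N \<equiv> \<lambda>M. nat \<lfloor>r * real M\<rfloor>" and "\<gamma> \<equiv> euler_mascheroni"
  shows "(\<Sum>k=1..N M. R1 (real k / r)) - r * (\<Sum>l=1..M. R1 (real l * r)) =
     ln_sum (N M) - real (N M) * ln r + (\<gamma> - 1) * real (N M) + r * H (real (N M)) / 2
     - r * ln_sum M - r * real M * ln r - r * real M * (\<gamma> - 1) - H (real M) / 2
     - real (N M) * H (real M) + r * real M * H (real (N M))"
proof -
  let ?g = "\<lambda>k l. 1 / real l - r / real k"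
  have "(\<Sum>k=1..N M. R1 (real k / r)) = (\<Sum>k=1..N M. ln (real k) - ln r + (\<gamma> - 1) + r / 2 * (1 / real k)
      - (\<Sum>l=1..nat \<lfloor>real k / r\<rfloor>. ?g k l))"
    by (intro sum.cong refl) (use r in \<open>simp add: R1_eq ln_div \<gamma>_def\<close>)
  then have A: "(\<Sum>k=1..N M. R1 (real k / r)) = ln_sum (N M) - real (N M) * ln r + (\<gamma> - 1) * real (N M)
      + r / 2 * H (real (N M)) - (\<Sum>k=1..N M. \<Sum>l=1..nat \<lfloor>real k / r\<rfloor>. ?g k l)"
    unfolding sum.distrib sum_subtractf sum_distrib_left[symmetric] by (simp add: ln_sum_def H_of_nat algebra_simps)
  have "r * R1 (real l * r) = r * (ln (real l) + ln r + (\<gamma> - 1)) + 1 / 2 * (1 / real l)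
      + (\<Sum>k=1..nat \<lfloor>real l * r\<rfloor>. ?g k l)" if "l \<in> {1..M}" for l
  proof -
    \<comment> \<open>Antisymmetry of the kernel: exchanging \<open>k\<close> and \<open>l\<close>,
      with \<open>r\<close> replaced by 1/r, reproduces \<open>?g\<close> up to the factor
      -r.\<close>
    have "(\<Sum>k=1..nat \<lfloor>real l * r\<rfloor>. ?g k l) = - r * (\<Sum>k=1..nat \<lfloor>real l * r\<rfloor>. 1 / real k - 1 / (real l * r))"
      unfolding sum_distrib_left by (intro sum.cong refl) (use r that in \<open>simp add: field_simps\<close>)
    then show ?thesis using r that by (simp add: R1_eq ln_mult \<gamma>_def field_simps)
  qed
  then have "r * (\<Sum>l=1..M. R1 (real l * r)) = (\<Sum>l=1..M. r * (ln (real l) + ln r + (\<gamma> - 1)) + 1 / 2 * (1 / real l)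
      + (\<Sum>k=1..nat \<lfloor>real l * r\<rfloor>. ?g k l))"
    unfolding sum_distrib_left by (intro sum.cong refl) simp
  then have B: "r * (\<Sum>l=1..M. R1 (real l * r)) = r * (ln_sum M + real M * ln r + real M * (\<gamma> - 1)) + 1 / 2 * H (real M)
      + (\<Sum>l=1..M. \<Sum>k=1..nat \<lfloor>real l * r\<rfloor>. ?g k l)"
    unfolding sum.distrib sum_subtractf sum_distrib_left[symmetric] by (simp add: ln_sum_def H_of_nat algebra_simps)
  have "(\<Sum>k=1..N M. \<Sum>l=1..M. ?g k l) = (\<Sum>k=1..N M. H (real M) - r * real M * (1 / real k))"
    by (simp add: sum_subtractf H_of_nat mult.commute)
  also have "\<dots> = real (N M) * H (real M) - r * real M * H (real (N M))"
    unfolding sum_subtractf sum_distrib_left[symmetric] by (simp add: H_of_nat)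
  finally have C: "(\<Sum>k=1..N M. \<Sum>l=1..M. ?g k l) = \<dots>" .
  have "(\<Sum>k=1..N M. \<Sum>l=1..nat \<lfloor>real k / r\<rfloor>. ?g k l) + (\<Sum>l=1..M. \<Sum>k=1..nat \<lfloor>real l * r\<rfloor>. ?g k l) =
         (\<Sum>k=1..N M. \<Sum>l=1..M. ?g k l)"
    unfolding N_def by (rule sum_floor_triangles[OF r]) (use r in \<open>simp add: field_simps\<close>)
  then show ?thesis unfolding A B C by (simp add: algebra_simps)
qed

lemma R2_eq:
  fixes x :: real
  shows "R2 x = 1 / x * (1/2 * ln (2 * pi) + 1 + 1/2 * ln x)
     + (2 - euler_mascheroni) * ln x - 1/2 * (ln x)\<^sup>2 + (2 * euler_mascheroni + stieltjes_gamma1 - 3)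
     + (\<Sum>l=1..nat \<lfloor>x\<rfloor>. (1 / x + 1 / real l) * ln (x / real l) + 2 * (1 / x - 1 / real l))"
proof (cases "x = 0")
  case True
  then show ?thesis by (simp add: R2_def)
next
  case False
  then have "1 / x * (\<Sum>l=1..nat \<lfloor>x\<rfloor>. (1 + x / real l) * ln (x / real l) + 2 * (1 - x / real l)) =
     (\<Sum>l=1..nat \<lfloor>x\<rfloor>. (1 / x + 1 / real l) * ln (x / real l) + 2 * (1 / x - 1 / real l))"
    unfolding sum_distrib_left by (intro sum.cong refl) (simp add: field_simps)
  then show ?thesis by (simp add: R2_def)
qed

text \<open>The three bracketed groups are the elementary part at k/r, the elementary part at l r,
  and the rectangular double sum of the kernel.\<close>

lemma sum_R2_difference:
  fixes r :: real
  assumes r: "r > 0"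
  defines "N \<equiv> \<lambda>M. nat \<lfloor>r * real M\<rfloor>" and "\<gamma> \<equiv> euler_mascheroni" and "\<rho> \<equiv> ln r" and "\<Lambda> \<equiv> ln (2 * pi)"
    and "\<kappa> \<equiv> 2 * euler_mascheroni + stieltjes_gamma1 - 3"
  shows "(\<Sum>k=1..N M. R2 (real k / r)) - r * (\<Sum>l=1..M. R2 (real l * r)) =
     (r * ((\<Lambda> / 2 + 1 - \<rho> / 2) * H (real (N M)) + ln_over_sum (N M) / 2)
       + (2 - \<gamma>) * (ln_sum (N M) - real (N M) * \<rho>)
       - (ln_squared_sum (N M) - 2 * \<rho> * ln_sum (N M) + real (N M) * \<rho>\<^sup>2) / 2 + \<kappa> * real (N M))
     - ((\<Lambda> / 2 + 1 + \<rho> / 2) * H (real M) + ln_over_sum M / 2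
       + r * ((2 - \<gamma>) * (ln_sum M + real M * \<rho>)
       - (ln_squared_sum M + 2 * \<rho> * ln_sum M + real M * \<rho>\<^sup>2) / 2 + \<kappa> * real M))
     + (r * real M * ln_over_sum (N M) - r * H (real (N M)) * ln_sum M - r * real M * \<rho> * H (real (N M))
       + ln_sum (N M) * H (real M) - real (N M) * ln_over_sum M - real (N M) * \<rho> * H (real M)
       + 2 * (r * real M * H (real (N M)) - real (N M) * H (real M)))"
proof -
  let ?g = "\<lambda>k l. (r / real k + 1 / real l) * (ln (real k) - \<rho> - ln (real l)) + 2 * (r / real k - 1 / real l)"
  have "R2 (real k / r) = r * (\<Lambda> / 2 + 1 - \<rho> / 2) * (1 / real k) + r / 2 * (ln (real k) / real k)
      + (2 - \<gamma>) * (ln (real k) - \<rho>) - 1/2 * ((ln (real k))\<^sup>2 - 2 * \<rho> * ln (real k) + \<rho>\<^sup>2) + \<kappa>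
      + (\<Sum>l=1..nat \<lfloor>real k / r\<rfloor>. ?g k l)" if "k \<in> {1..N M}" for k
  proof -
    have k: "k > 0" using that by simp
    have ln: "ln (real k / r) = ln (real k) - \<rho>" using k r by (simp add: ln_div \<rho>_def)
    have "(\<Sum>l=1..nat \<lfloor>real k / r\<rfloor>. (1 / (real k / r) + 1 / real l) * ln (real k / r / real l) + 2 * (1 / (real k / r) - 1 / real l))
       = (\<Sum>l=1..nat \<lfloor>real k / r\<rfloor>. ?g k l)"
      by (intro sum.cong refl) (use k r in \<open>simp add: ln_div ln_mult \<rho>_def\<close>)
    then show ?thesis using k r unfolding R2_eq ln
      by (simp add: \<Lambda>_def \<kappa>_def \<gamma>_def field_simps power2_eq_square)
  qed
  then have "(\<Sum>k=1..N M. R2 (real k / r)) = (\<Sum>k=1..N M. r * (\<Lambda> / 2 + 1 - \<rho> / 2) * (1 / real k) + r / 2 * (ln (real k) / real k)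
      + (2 - \<gamma>) * (ln (real k) - \<rho>) - 1/2 * ((ln (real k))\<^sup>2 - 2 * \<rho> * ln (real k) + \<rho>\<^sup>2) + \<kappa>
      + (\<Sum>l=1..nat \<lfloor>real k / r\<rfloor>. ?g k l))"
    by (intro sum.cong refl)
  also have "\<dots> = r * (\<Lambda> / 2 + 1 - \<rho> / 2) * H (real (N M)) + r / 2 * ln_over_sum (N M)
      + (2 - \<gamma>) * (ln_sum (N M) - real (N M) * \<rho>)
      - 1/2 * (ln_squared_sum (N M) - 2 * \<rho> * ln_sum (N M) + real (N M) * \<rho>\<^sup>2) + real (N M) * \<kappa>
      + (\<Sum>k=1..N M. \<Sum>l=1..nat \<lfloor>real k / r\<rfloor>. ?g k l)"
    unfolding sum.distrib sum_subtractf sum_distrib_left[symmetric] sum_constant card_atLeastAtMost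
    by (simp only: H_of_nat ln_sum_def ln_over_sum_def ln_squared_sum_def diff_Suc_1 add_diff_cancel_right')
  finally have A: "(\<Sum>k=1..N M. R2 (real k / r)) = \<dots>" .
  have "r * R2 (real l * r) = (\<Lambda> / 2 + 1 + \<rho> / 2) * (1 / real l) + 1/2 * (ln (real l) / real l)
      + r * ((2 - \<gamma>) * (ln (real l) + \<rho>) - 1/2 * ((ln (real l))\<^sup>2 + 2 * \<rho> * ln (real l) + \<rho>\<^sup>2) + \<kappa>)
      - (\<Sum>k=1..nat \<lfloor>real l * r\<rfloor>. ?g k l)" if "l \<in> {1..M}" for l
  proof -
    have l: "l > 0" using that by simp
    have ln: "ln (real l * r) = ln (real l) + \<rho>" using l r by (simp add: ln_mult \<rho>_def)
    have "r * (\<Sum>k=1..nat \<lfloor>real l * r\<rfloor>. (1 / (real l * r) + 1 / real k) * ln (real l * r / real k) + 2 * (1 / (real l * r) - 1 / real k))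
       = (\<Sum>k=1..nat \<lfloor>real l * r\<rfloor>. - ?g k l)"
      unfolding sum_distrib_left
    proof (intro sum.cong refl)
      fix k assume "k \<in> {1..nat \<lfloor>real l * r\<rfloor>}"
      then have k: "k > 0" by simp
      have ln': "ln (real l * r / real k) = ln (real l) + \<rho> - ln (real k)"
        using k l r by (simp add: ln_mult ln_div \<rho>_def)
      show "r * ((1 / (real l * r) + 1 / real k) * ln (real l * r / real k) + 2 * (1 / (real l * r) - 1 / real k)) = - ?g k l"
        unfolding ln' using k l r by (simp add: field_simps)
    qed
    also have "\<dots> = - (\<Sum>k=1..nat \<lfloor>real l * r\<rfloor>. ?g k l)" by (rule sum_negf)
    finally have S: "r * (\<Sum>k=1..nat \<lfloor>real l * r\<rfloor>. (1 / (real l * r) + 1 / real k) * ln (real l * r / real k) + 2 * (1 / (real l * r) - 1 / real k)) = \<dots>" .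
    show ?thesis unfolding R2_eq distrib_left[of r] S ln using l r
      by (simp add: \<Lambda>_def \<kappa>_def \<gamma>_def field_simps power2_eq_square)
  qed
  then have "r * (\<Sum>l=1..M. R2 (real l * r)) = (\<Sum>l=1..M. (\<Lambda> / 2 + 1 + \<rho> / 2) * (1 / real l) + 1/2 * (ln (real l) / real l)
      + r * ((2 - \<gamma>) * (ln (real l) + \<rho>) - 1/2 * ((ln (real l))\<^sup>2 + 2 * \<rho> * ln (real l) + \<rho>\<^sup>2) + \<kappa>)
      - (\<Sum>k=1..nat \<lfloor>real l * r\<rfloor>. ?g k l))"
    unfolding sum_distrib_left by (intro sum.cong refl)
  also have "\<dots> = (\<Lambda> / 2 + 1 + \<rho> / 2) * H (real M) + 1/2 * ln_over_sum M
      + r * ((2 - \<gamma>) * (ln_sum M + real M * \<rho>) - 1/2 * (ln_squared_sum M + 2 * \<rho> * ln_sum M + real M * \<rho>\<^sup>2) + real M * \<kappa>)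
      - (\<Sum>l=1..M. \<Sum>k=1..nat \<lfloor>real l * r\<rfloor>. ?g k l)"
    unfolding sum.distrib sum_subtractf sum_distrib_left[symmetric] sum_constant card_atLeastAtMost
    by (simp only: H_of_nat ln_sum_def ln_over_sum_def ln_squared_sum_def diff_Suc_1 add_diff_cancel_right')
  finally have B: "r * (\<Sum>l=1..M. R2 (real l * r)) = \<dots>" .
  have "(\<Sum>k=1..N M. \<Sum>l=1..M. ?g k l) = (\<Sum>k=1..N M. \<Sum>l=1..M.
      r * (ln (real k) / real k) - r * \<rho> * (1 / real k) - r * (1 / real k) * ln (real l)
      + ln (real k) * (1 / real l) - \<rho> * (1 / real l) - ln (real l) / real l + 2 * (r * (1 / real k)) - 2 * (1 / real l))"
    by (intro sum.cong refl) (simp add: algebra_simps add_divide_distrib diff_divide_distrib)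
  also have "\<dots> = (\<Sum>k=1..N M.
      real M * (r * (ln (real k) / real k)) - real M * (r * \<rho> * (1 / real k)) - r * (1 / real k) * ln_sum M
      + ln (real k) * H (real M) - \<rho> * H (real M) - ln_over_sum M + real M * (2 * (r * (1 / real k))) - 2 * H (real M))"
    unfolding sum.distrib sum_subtractf sum_distrib_left[symmetric] sum_constant card_atLeastAtMost
    by (simp only: H_of_nat ln_sum_def ln_over_sum_def ln_squared_sum_def diff_Suc_1 add_diff_cancel_right' mult_ac)
  also have "\<dots> = real M * (r * ln_over_sum (N M)) - real M * (r * \<rho> * H (real (N M))) - r * H (real (N M)) * ln_sum M
      + ln_sum (N M) * H (real M) - real (N M) * (\<rho> * H (real M)) - real (N M) * ln_over_sum M
      + real M * (2 * (r * H (real (N M)))) - real (N M) * (2 * H (real M))"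
    unfolding sum.distrib sum_subtractf sum_distrib_left[symmetric] sum_distrib_right[symmetric] sum_constant card_atLeastAtMost
    by (simp only: H_of_nat ln_sum_def ln_over_sum_def ln_squared_sum_def diff_Suc_1 add_diff_cancel_right' mult_ac)
  finally have C: "(\<Sum>k=1..N M. \<Sum>l=1..M. ?g k l) = \<dots>" .
  have "(\<Sum>k=1..N M. \<Sum>l=1..nat \<lfloor>real k / r\<rfloor>. ?g k l) + (\<Sum>l=1..M. \<Sum>k=1..nat \<lfloor>real l * r\<rfloor>. ?g k l) =
         (\<Sum>k=1..N M. \<Sum>l=1..M. ?g k l)"
    unfolding N_def
  proof (rule sum_floor_triangles[OF r])
    fix k l assume kl: "real k = real l * r" "l > 0"
    show "?g k l = 0" unfolding kl(1) using kl(2) r by (simp add: ln_mult \<rho>_def)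
  qed
  note D = this[unfolded C]
  \<comment> \<open>The triangular sums occur in the difference only as \<open>U + V\<close>, so
    replacing \<open>U\<close> by the rectangle minus \<open>V\<close> eliminates both.\<close>
  define U where "U = (\<Sum>k=1..N M. \<Sum>l=1..nat \<lfloor>real k / r\<rfloor>. ?g k l)"
  define V where "V = (\<Sum>l=1..M. \<Sum>k=1..nat \<lfloor>real l * r\<rfloor>. ?g k l)"
  have U: "U = real M * (r * ln_over_sum (N M)) - real M * (r * \<rho> * H (real (N M))) - r * H (real (N M)) * ln_sum M
      + ln_sum (N M) * H (real M) - real (N M) * (\<rho> * H (real M)) - real (N M) * ln_over_sum M
      + real M * (2 * (r * H (real (N M)))) - real (N M) * (2 * H (real M)) - V"
    using D unfolding U_def[symmetric] V_def[symmetric] by simp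
  show ?thesis unfolding A B unfolding U_def[symmetric] V_def[symmetric] U
    by (simp add: algebra_simps add_divide_distrib diff_divide_distrib)
qed

section \<open>Asymptotics of the rectangular sums\<close>

text \<open>
  Here \<open>N = \<lfloor>r M\<rfloor>\<close>, \<open>f\<close> is the fractional part of \<open>r M\<close>, \<open>a = ln N\<close>, \<open>b = ln M\<close>, \<open>e = ln (r M) - a\<close>, and \<open>iN\<close>,
  \<open>jX\<close> are the inverses of \<open>N\<close> and \<open>r M\<close>. The letters \<open>h\<close>, \<open>s\<close>, \<open>q\<close>, \<open>c\<close> followed by \<open>N\<close> or \<open>M\<close> are the
  error terms at \<open>N\<close> and \<open>M\<close> of the sums of \<open>1 / k\<close>, \<open>ln k\<close>, \<open>ln k / k\<close> and \<open>(ln k)\<^sup>2\<close>. The remainders are the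
  normal forms modulo the four relations \<open>rel\<close>; in the convergence lemmas a sequence \<open>z_xy\<close> stands
  for the product of \<open>x\<close> and \<open>y\<close>, because one factor may be unbounded.
\<close>

lemma R1_asymptotic_identity:
  fixes r N M a b e t f iN jX \<rho> \<gamma> \<Lambda> hN hM sN sM :: real
  assumes rel: "r * M = N + f" "N * iN = 1" "N * jX = 1 - f * jX" "N * e = f + t" and b: "b = a + e - \<rho>"
  defines "HN \<equiv> a + \<gamma> + iN / 2 + hN"
  defines "HM \<equiv> b + \<gamma> + r * jX / 2 + hM"
  defines "FN \<equiv> N * a - N + a / 2 + \<Lambda> / 2 + sN"
  defines "FM \<equiv> M * b - M + b / 2 + \<Lambda> / 2 + sM"
  shows "FN - N * \<rho> + (\<gamma> - 1) * N + r * HN / 2 - r * FM - r * M * \<rho> - r * M * (\<gamma> - 1) - HM / 2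
     - N * HM + r * M * HN =
     (\<Lambda> - \<gamma> + 1) / 2 * (1 - r) + 1/2 * (1 + r) * \<rho> +
     (- (N * hM) + (N * hN) - 1/2 * e - (f * e) - 1/2 * e * r + (f * hN) + 1/2 * (f * iN)
      + 1/2 * (f * jX) * r - 1/2 * hM + 1/2 * hN * r + 1/4 * iN * r - 1/4 * jX * r - r * sM + sN
      - 2 * t)"
proof -
  \<comment> \<open>The right-hand side is a certificate: explicit cofactors times the four
    relations \<open>rel\<close>. With it the claim is a polynomial identity in free
    variables.\<close>
  have "(FN - N * \<rho> + (\<gamma> - 1) * N + r * HN / 2 - r * FM - r * M * \<rho> - r * M * (\<gamma> - 1) - HM / 2
     - N * HM + r * M * HN) -
     ((\<Lambda> - \<gamma> + 1) / 2 * (1 - r) + 1/2 * (1 + r) * \<rho> +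
     (- (N * hM) + (N * hN) - 1/2 * e - (f * e) - 1/2 * e * r + (f * hN) + 1/2 * (f * iN)
      + 1/2 * (f * jX) * r - 1/2 * hM + 1/2 * hN * r + 1/4 * iN * r - 1/4 * jX * r - r * sM + sN
      - 2 * t)) =
     (2 - e + hN + (1/2)*iN) * (r * M - (N + f)) + ((1/2)) * (N * iN - 1) + (- (1/2)*r) * (N * jX - (1 -
         f * jX)) + (- 2) * (N * e - (f + t))"
    unfolding FM_def FN_def HM_def HN_def b by (simp add: field_simps power2_eq_square)
  also have "\<dots> = 0" using rel by simp
  finally show ?thesis by simp
qed

lemma R1_remainder_tendsto_0:
  fixes e hM hN iN jX sM sN t z_NhM z_NhN z_fe z_fhN z_fiN z_fjX :: "nat \<Rightarrow> real"
  assumes "e \<longlonglongrightarrow> 0" "hM \<longlonglongrightarrow> 0" "hN \<longlonglongrightarrow>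
      0" "iN \<longlonglongrightarrow> 0" "jX \<longlonglongrightarrow> 0" "sM \<longlonglongrightarrow>
      0" "sN \<longlonglongrightarrow> 0" "t \<longlonglongrightarrow> 0" "z_NhM
      \<longlonglongrightarrow> 0" "z_NhN \<longlonglongrightarrow> 0" "z_fe \<longlonglongrightarrow> 0"
      "z_fhN \<longlonglongrightarrow> 0" "z_fiN \<longlonglongrightarrow> 0" "z_fjX
      \<longlonglongrightarrow> 0"
  shows "(\<lambda>n. - z_NhM n + z_NhN n - 1/2 * e n - z_fe n - 1/2 * e n * r + z_fhN n + 1/2 * z_fiN n
      + 1/2 * z_fjX n * r - 1/2 * hM n + 1/2 * hN n * r + 1/4 * iN n * r - 1/4 * jX n * r - r * sM n
      + sN n - 2 * t n) \<longlonglongrightarrow> 0"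
  by (auto intro!: tendsto_eq_intros assms)

text \<open>Proved by the same kind of certificate. The terms pi^2/48, ln(2 pi)^2/4 and -gamma^2/4
  of \<open>const_K2\<close> come from \<open>C\<close> alone, because the squared-logarithm sums
  carry the weights -1/2 and r/2.\<close>

lemma R2_asymptotic_identity:
  fixes r N M a b e t f iN jX \<rho> \<gamma> \<gamma>1 \<Lambda> hN hM sN sM qN qM cN cM :: real
  assumes rel: "r * M = N + f" "N * iN = 1" "N * jX = 1 - f * jX" "N * e = f + t" and b: "b = a + e - \<rho>"
  defines "HN \<equiv> a + \<gamma> + iN / 2 + hN"
  defines "HM \<equiv> b + \<gamma> + r * jX / 2 + hM"
  defines "FN \<equiv> N * a - N + a / 2 + \<Lambda> / 2 + sN"
  defines "FM \<equiv> M * b - M + b / 2 + \<Lambda> / 2 + sM"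
  defines "LN \<equiv> a\<^sup>2 / 2 + \<gamma>1 + a * iN / 2 + qN"
  defines "LM \<equiv> b\<^sup>2 / 2 + \<gamma>1 + b * (r * jX) / 2 + qM"
  defines "C \<equiv> \<gamma>1 + \<gamma>\<^sup>2 / 2 - pi\<^sup>2 / 24 - \<Lambda>\<^sup>2 / 2"
  defines "QN \<equiv> N * a\<^sup>2 - 2 * N * a + 2 * N + a\<^sup>2 / 2 + C + cN"
  defines "QM \<equiv> M * b\<^sup>2 - 2 * M * b + 2 * M + b\<^sup>2 / 2 + C + cM"
  shows "(r * ((\<Lambda> / 2 + 1 - \<rho> / 2) * HN + LN / 2) + (2 - \<gamma>) * (FN - N * \<rho>)
       - (QN - 2 * \<rho> * FN + N * \<rho>\<^sup>2) / 2 + (2 * \<gamma> + \<gamma>1 - 3) * N)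
     - ((\<Lambda> / 2 + 1 + \<rho> / 2) * HM + LM / 2
       + r * ((2 - \<gamma>) * (FM + M * \<rho>) - (QM + 2 * \<rho> * FM + M * \<rho>\<^sup>2) / 2 + (2 *
           \<gamma> + \<gamma>1 - 3) * M))
     + (r * M * LN - r * HN * FM - r * M * \<rho> * HN + FN * HM - N * LM - N * \<rho> * HM
       + 2 * (r * M * HN - N * HM)) =
     ((1 - \<gamma> / 2) * \<Lambda> + 1/4 * \<Lambda>\<^sup>2 + pi\<^sup>2 / 48 - \<gamma>\<^sup>2 / 4 -
         \<gamma> - \<gamma>1 + 3/2) * (1 - r)
      + (\<Lambda> - \<gamma> + 2) / 2 * (1 + r) * \<rho> + 1/4 * (1 - r) * \<rho>\<^sup>2 +
     ((a * (N * hM)) - (a * (N * hN)) - 3 * (N * hM) - (N * hM) * \<rho> + 3 * (N * hN)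
      - (N * qM) + (N * qN) - (a * (f * hN)) + 1/2 * (a * hM) - 1/2 * (a * hN) * r - (a * sM) * r
      + (a * sN) + 1/2 * cM * r - 1/2 * cN - 3/2 * e - 3 * (f * e) - (f * e) * hN
      - 1/2 * (f * e) * iN + 1/2 * (f * e) * jX * r - 1/2 * e * hN * r - 1/4 * e * iN * r
      - 1/4 * e * jX * r - 3/2 * e * r + e * sN - 1/4 * e * e + 1/2 * (f * e) * e + 1/4 * e * e * r
      + 2 * (f * hN) + 3/2 * (f * iN) + 3/2 * (f * jX) * r + (f * qN) - hM - 1/2 * hM * \<rho>
      + hM * sN + hN * r - hN * r * sM - hN * t + 1/2 * iN * r - 1/2 * iN * r * sM - 1/2 * jX * r
      + 1/2 * jX * r * sN - 1/2 * qM + 1/2 * qN * r + r * \<rho> * sM - 2 * r * sM + 2 * sN - 6 * t)"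
proof -
  have "((r * ((\<Lambda> / 2 + 1 - \<rho> / 2) * HN + LN / 2) + (2 - \<gamma>) * (FN - N * \<rho>)
       - (QN - 2 * \<rho> * FN + N * \<rho>\<^sup>2) / 2 + (2 * \<gamma> + \<gamma>1 - 3) * N)
     - ((\<Lambda> / 2 + 1 + \<rho> / 2) * HM + LM / 2
       + r * ((2 - \<gamma>) * (FM + M * \<rho>) - (QM + 2 * \<rho> * FM + M * \<rho>\<^sup>2) / 2 + (2 *
           \<gamma> + \<gamma>1 - 3) * M))
     + (r * M * LN - r * HN * FM - r * M * \<rho> * HN + FN * HM - N * LM - N * \<rho> * HM
       + 2 * (r * M * HN - N * HM))) -
     (((1 - \<gamma> / 2) * \<Lambda> + 1/4 * \<Lambda>\<^sup>2 + pi\<^sup>2 / 48 - \<gamma>\<^sup>2 / 4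
         - \<gamma> - \<gamma>1 + 3/2) * (1 - r)
      + (\<Lambda> - \<gamma> + 2) / 2 * (1 + r) * \<rho> + 1/4 * (1 - r) * \<rho>\<^sup>2 +
     ((a * (N * hM)) - (a * (N * hN)) - 3 * (N * hM) - (N * hM) * \<rho> + 3 * (N * hN)
      - (N * qM) + (N * qN) - (a * (f * hN)) + 1/2 * (a * hM) - 1/2 * (a * hN) * r - (a * sM) * r
      + (a * sN) + 1/2 * cM * r - 1/2 * cN - 3/2 * e - 3 * (f * e) - (f * e) * hN
      - 1/2 * (f * e) * iN + 1/2 * (f * e) * jX * r - 1/2 * e * hN * r - 1/4 * e * iN * r
      - 1/4 * e * jX * r - 3/2 * e * r + e * sN - 1/4 * e * e + 1/2 * (f * e) * e + 1/4 * e * e * r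
      + 2 * (f * hN) + 3/2 * (f * iN) + 3/2 * (f * jX) * r + (f * qN) - hM - 1/2 * hM * \<rho>
      + hM * sN + hN * r - hN * r * sM - hN * t + 1/2 * iN * r - 1/2 * iN * r * sM - 1/2 * jX * r
      + 1/2 * jX * r * sN - 1/2 * qM + 1/2 * qN * r + r * \<rho> * sM - 2 * r * sM + 2 * sN - 6 * t)) =
     (6 - a*hN - 3*e - e*hN - (1/2)*e*iN + (1/2)*e^2 + 3*hN + (3/2)*iN + qN) * (r * M - (N + f)) + ((3/2)
         - (1/2)*e) * (N * iN - 1) + (- (1/2)*e*r - (3/2)*r) * (N * jX - (1 - f * jX)) + (- 6 - hN) * (N
         * e - (f + t))"
    unfolding QM_def QN_def C_def LM_def LN_def FM_def FN_def HM_def HN_def b by (simp add: field_simps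
        power2_eq_square)
  also have "\<dots> = 0" using rel by simp
  finally show ?thesis by simp
qed

lemma R2_remainder_tendsto_0:
  fixes cM cN e hM hN iN jX qM qN sM sN t z_NhM z_NhN z_NqM z_NqN z_ahM z_ahN z_asM z_asN z_fe z_fhN
      z_fiN z_fjX z_fqN z_aNhM z_aNhN z_afhN :: "nat \<Rightarrow> real"
  assumes "cM \<longlonglongrightarrow> 0" "cN \<longlonglongrightarrow> 0" "e \<longlonglongrightarrow>
      0" "hM \<longlonglongrightarrow> 0" "hN \<longlonglongrightarrow> 0" "iN \<longlonglongrightarrow>
      0" "jX \<longlonglongrightarrow> 0" "qM \<longlonglongrightarrow> 0" "qN \<longlonglongrightarrow>
      0" "sM \<longlonglongrightarrow> 0" "sN \<longlonglongrightarrow> 0" "t \<longlonglongrightarrow>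
      0" "z_NhM \<longlonglongrightarrow> 0" "z_NhN \<longlonglongrightarrow> 0" "z_NqM
      \<longlonglongrightarrow> 0" "z_NqN \<longlonglongrightarrow> 0" "z_ahM \<longlonglongrightarrow>
      0" "z_ahN \<longlonglongrightarrow> 0" "z_asM \<longlonglongrightarrow> 0" "z_asN
      \<longlonglongrightarrow> 0" "z_fe \<longlonglongrightarrow> 0" "z_fhN \<longlonglongrightarrow> 0"
      "z_fiN \<longlonglongrightarrow> 0" "z_fjX \<longlonglongrightarrow> 0" "z_fqN
      \<longlonglongrightarrow> 0" "z_aNhM \<longlonglongrightarrow> 0" "z_aNhN \<longlonglongrightarrow>
      0" "z_afhN \<longlonglongrightarrow> 0"
  shows "(\<lambda>n. z_aNhM n - z_aNhN n - 3 * z_NhM n - z_NhM n * \<rho> + 3 * z_NhN n - z_NqM n + z_NqN n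
      - z_afhN n + 1/2 * z_ahM n - 1/2 * z_ahN n * r - z_asM n * r + z_asN n + 1/2 * cM n * r
      - 1/2 * cN n - 3/2 * e n - 3 * z_fe n - z_fe n * hN n - 1/2 * z_fe n * iN n
      + 1/2 * z_fe n * jX n * r - 1/2 * e n * hN n * r - 1/4 * e n * iN n * r - 1/4 * e n * jX n * r
      - 3/2 * e n * r + e n * sN n - 1/4 * e n * e n + 1/2 * z_fe n * e n + 1/4 * e n * e n * r
      + 2 * z_fhN n + 3/2 * z_fiN n + 3/2 * z_fjX n * r + z_fqN n - hM n - 1/2 * hM n * \<rho>
      + hM n * sN n + hN n * r - hN n * r * sM n - hN n * t n + 1/2 * iN n * r
      - 1/2 * iN n * r * sM n - 1/2 * jX n * r + 1/2 * jX n * r * sN n - 1/2 * qM n + 1/2 * qN n * r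
      + r * \<rho> * sM n - 2 * r * sM n + 2 * sN n - 6 * t n) \<longlonglongrightarrow> 0"
  by (auto intro!: tendsto_eq_intros assms)

section \<open>Passage to the limit\<close>

lemma partial_difference_limits:
  fixes r :: real
  assumes r: "r > 0"
  defines "N \<equiv> \<lambda>M. nat \<lfloor>r * real M\<rfloor>"
  shows "(\<lambda>M. (\<Sum>k=1..N M. R1 (real k / r)) - r * (\<Sum>l=1..M. R1 (real l * r)))
           \<longlonglongrightarrow> const_K * (1 - r) + 1/2 * (1 + r) * ln r" (is "?L1 \<longlonglongrightarrow> ?T1")
    and "(\<lambda>M. (\<Sum>k=1..N M. R2 (real k / r)) - r * (\<Sum>l=1..M. R2 (real l * r)))
           \<longlonglongrightarrow> const_K2 * (1 - r) + const_K1 * (1 + r) * ln r + 1/4 * (1 - r) * (ln r)\<^sup>2" (is "?L2 \<longlonglongrightarrow> ?T2")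
proof -
  have X: "filterlim (\<lambda>M. r * real M) at_top sequentially"
    using r by real_asymp
  note m = bigo_powr_mult[OF _ _ _ X]
  note lim = tendsto_0_bigo_powr[OF _ _ X]
  have comp: "(\<lambda>M. f (r * real M)) \<in> O(\<lambda>M. (r * real M) powr p)"
    if "f \<in> O[at_top](\<lambda>x. x powr p)" for f :: "real \<Rightarrow> real" and p
    by (rule landau_o.big.compose[OF that X])
  \<comment> \<open>Errors at \<open>M\<close> are measured on the same scale r M as those at
    \<open>N M\<close>, so that mixed products can be estimated.\<close>
  have seq: "f \<in> O(\<lambda>M. (r * real M) powr p)" if "f \<in> O(\<lambda>n. real n powr p)" for f :: "nat \<Rightarrow> real" and p
    using that r by (simp add: powr_mult)
  define f where "f = (\<lambda>M. frac (r * real M))"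
  define e where "e = (\<lambda>M. ln_gap (r * real M))"
  define t where "t = (\<lambda>M. real (N M) * e M - f M)"
  define a where "a = (\<lambda>M. ln (real (N M)))"
  define iN where "iN = (\<lambda>M. 1 / real (N M))"
  define jX where "jX = (\<lambda>M. 1 / (r * real M))"
  define n where "n = (\<lambda>M. real (N M))"
  define hN where "hN = (\<lambda>M. harmonic_err (N M))"
  define sN where "sN = (\<lambda>M. ln_sum_err (N M))"
  define qN where "qN = (\<lambda>M. ln_over_sum_err (N M))"
  define cN where "cN = (\<lambda>M. ln_squared_sum_err (N M))"
  have f: "f \<in> O(\<lambda>M. (r * real M) powr 0)"
    unfolding f_def by (rule comp[OF frac_bigo])
  have e: "e \<in> O(\<lambda>M. (r * real M) powr (-1))"
    unfolding e_def by (rule comp[OF ln_gap_bigo])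
  have t: "t \<in> O(\<lambda>M. (r * real M) powr (-1))"
    unfolding t_def e_def f_def N_def by (rule comp[OF ln_gap_defect_bigo])
  have a: "a \<in> O(\<lambda>M. (r * real M) powr (1/8))"
    unfolding a_def N_def by (rule comp[OF ln_nat_floor_bigo])
  have iN: "iN \<in> O(\<lambda>M. (r * real M) powr (-1))"
    unfolding iN_def N_def by (rule comp[OF inverse_nat_floor_bigo])
  have jX: "jX \<in> O(\<lambda>M. (r * real M) powr (-1))"
    unfolding jX_def by (rule comp[OF inverse_bigo])
  have n: "n \<in> O(\<lambda>M. (r * real M) powr 1)"
    unfolding n_def N_def by (rule comp[OF nat_floor_bigo])
  have hN: "hN \<in> O(\<lambda>M. (r * real M) powr (-7/4))"
    unfolding hN_def N_def by (rule comp, rule bigo_nat_floor[OF harmonic_err_bigo]) simp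
  have qN: "qN \<in> O(\<lambda>M. (r * real M) powr (-7/4))"
    unfolding qN_def N_def by (rule comp, rule bigo_nat_floor[OF ln_over_sum_err_bigo]) simp
  have sN: "sN \<in> O(\<lambda>M. (r * real M) powr (-3/4))"
    unfolding sN_def N_def by (rule comp, rule bigo_nat_floor[OF ln_sum_err_bigo]) simp
  have cN: "cN \<in> O(\<lambda>M. (r * real M) powr (-3/4))"
    unfolding cN_def N_def by (rule comp, rule bigo_nat_floor[OF ln_squared_sum_err_bigo]) simp
  note hM = seq[OF harmonic_err_bigo] and qM = seq[OF ln_over_sum_err_bigo]
    and sM = seq[OF ln_sum_err_bigo] and cM = seq[OF ln_squared_sum_err_bigo]
  have nh: "(\<lambda>M. n M * h M) \<in> O(\<lambda>M. (r * real M) powr (-3/4))"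
    if "h \<in> O(\<lambda>M. (r * real M) powr (-7/4))" for h
    by (rule m[OF n that]) simp
  \<comment> \<open>The threshold is -5/8 = -1/2 - 1/8, with 1/8 paying for the logarithm; the
    products \<open>n M * h M\<close> of order -3/4 still qualify.\<close>
  have ah: "(\<lambda>M. a M * h M) \<in> O(\<lambda>M. (r * real M) powr (-1/2))"
    if "h \<in> O(\<lambda>M. (r * real M) powr p)" "p \<le> -5/8" for h p
    by (rule m[OF a that(1)]) (use that(2) in simp)
  have fh: "(\<lambda>M. f M * h M) \<in> O(\<lambda>M. (r * real M) powr (-1))"
    if "h \<in> O(\<lambda>M. (r * real M) powr p)" "p \<le> -1" for h p
    by (rule m[OF f that(1)]) (use that(2) in simp)
  have rel: "r * real M = n M + f M" "n M * iN M = 1" "n M * jX M = 1 - f M * jX M" "n M * e M = f M + t M"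
      "ln (real M) = a M + e M - ln r" "1 / (2 * n M) = iN M / 2" "1 / (2 * real M) = r * jX M / 2"
      "a M / (2 * n M) = a M * iN M / 2" "ln (real M) / (2 * real M) = ln (real M) * (r * jX M) / 2"
    if M: "r * real M \<ge> 1" for M
  proof -
    have "\<lfloor>r * real M\<rfloor> \<ge> 1" using M by simp
    then have n1: "n M \<ge> 1" unfolding n_def N_def by linarith
    show nf: "r * real M = n M + f M"
      using nat_floor_frac[of "r * real M"] r by (simp add: n_def N_def f_def)
    show "n M * iN M = 1" using n1 by (simp add: iN_def n_def)
    show "n M * jX M = 1 - f M * jX M" using nf M by (simp add: jX_def field_simps)
    show "n M * e M = f M + t M" by (simp add: t_def n_def)
    have "real M > 0" using M r by (cases "M = 0") auto
    then show "ln (real M) = a M + e M - ln r"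
      using r by (simp add: a_def e_def ln_gap_def N_def ln_mult)
    show "1 / (2 * n M) = iN M / 2" "a M / (2 * n M) = a M * iN M / 2" by (simp_all add: iN_def n_def)
    show "1 / (2 * real M) = r * jX M / 2" "ln (real M) / (2 * real M) = ln (real M) * (r * jX M) / 2"
      using r by (simp_all add: jX_def)
  qed
  have large: "eventually (\<lambda>M. r * real M \<ge> 1) sequentially"
    using X by (auto simp: filterlim_at_top)
  have sums: "H (real (N M)) = a M + euler_mascheroni + iN M / 2 + hN M"
      "H (real M) = ln (real M) + euler_mascheroni + r * jX M / 2 + harmonic_err M"
      "ln_sum (N M) = n M * a M - n M + a M / 2 + ln (2 * pi) / 2 + sN M"
      "ln_sum M = real M * ln (real M) - real M + ln (real M) / 2 + ln (2 * pi) / 2 + ln_sum_err M"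
      "ln_over_sum (N M) = (a M)\<^sup>2 / 2 + stieltjes_gamma1 + a M * iN M / 2 + qN M"
      "ln_over_sum M = (ln (real M))\<^sup>2 / 2 + stieltjes_gamma1 + ln (real M) * (r * jX M) / 2 + ln_over_sum_err M"
      "ln_squared_sum (N M) = n M * (a M)\<^sup>2 - 2 * n M * a M + 2 * n M + (a M)\<^sup>2 / 2
         + (stieltjes_gamma1 + euler_mascheroni\<^sup>2 / 2 - pi\<^sup>2 / 24 - (ln (2 * pi))\<^sup>2 / 2) + cN M"
      "ln_squared_sum M = real M * (ln (real M))\<^sup>2 - 2 * real M * ln (real M) + 2 * real M + (ln (real M))\<^sup>2 / 2
         + (stieltjes_gamma1 + euler_mascheroni\<^sup>2 / 2 - pi\<^sup>2 / 24 - (ln (2 * pi))\<^sup>2 / 2) + ln_squared_sum_err M"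
    if M: "r * real M \<ge> 1" for M
    unfolding rel(6-9)[OF M, symmetric]
    by (simp_all add: harmonic_err_def ln_sum_err_def ln_over_sum_err_def ln_squared_sum_err_def
        hN_def sN_def qN_def cN_def a_def n_def)
  have lims: "e \<longlonglongrightarrow> 0" "t \<longlonglongrightarrow> 0" "iN \<longlonglongrightarrow> 0" "jX \<longlonglongrightarrow> 0"
      "hN \<longlonglongrightarrow> 0" "harmonic_err \<longlonglongrightarrow> 0" "qN \<longlonglongrightarrow> 0" "ln_over_sum_err \<longlonglongrightarrow> 0"
      "sN \<longlonglongrightarrow> 0" "ln_sum_err \<longlonglongrightarrow> 0" "cN \<longlonglongrightarrow> 0" "ln_squared_sum_err \<longlonglongrightarrow> 0"
    using lim[OF e] lim[OF t] lim[OF iN] lim[OF jX] lim[OF hN] lim[OF hM] lim[OF qN] lim[OF qM]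
      lim[OF sN] lim[OF sM] lim[OF cN] lim[OF cM] by simp_all
  have n_lim: "(\<lambda>M. n M * h M) \<longlonglongrightarrow> 0" if "h \<in> O(\<lambda>M. (r * real M) powr (-7/4))" for h
    by (rule lim[OF nh[OF that]]) simp
  have a_lim: "(\<lambda>M. a M * h M) \<longlonglongrightarrow> 0" if "h \<in> O(\<lambda>M. (r * real M) powr p)" "p \<le> -5/8" for h p
    by (rule lim[OF ah[OF that]]) simp
  have f_lim: "(\<lambda>M. f M * h M) \<longlonglongrightarrow> 0" if "h \<in> O(\<lambda>M. (r * real M) powr p)" "p \<le> -1" for h p
    by (rule lim[OF fh[OF that]]) simp
  have fhN: "(\<lambda>M. f M * hN M) \<in> O(\<lambda>M. (r * real M) powr (-1))"
    by (rule fh[OF hN]) simp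
  note n_lims = n_lim[OF hM] n_lim[OF hN] n_lim[OF qM] n_lim[OF qN]
  have a_lims: "(\<lambda>M. a M * harmonic_err M) \<longlonglongrightarrow> 0" "(\<lambda>M. a M * hN M) \<longlonglongrightarrow> 0"
      "(\<lambda>M. a M * ln_sum_err M) \<longlonglongrightarrow> 0" "(\<lambda>M. a M * sN M) \<longlonglongrightarrow> 0"
      "(\<lambda>M. a M * (n M * harmonic_err M)) \<longlonglongrightarrow> 0" "(\<lambda>M. a M * (n M * hN M)) \<longlonglongrightarrow> 0"
      "(\<lambda>M. a M * (f M * hN M)) \<longlonglongrightarrow> 0"
    using a_lim[OF hM] a_lim[OF hN] a_lim[OF sM] a_lim[OF sN] a_lim[OF nh[OF hM]] a_lim[OF nh[OF hN]]
      a_lim[OF fhN] by simp_all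
  have f_lims: "(\<lambda>M. f M * e M) \<longlonglongrightarrow> 0" "(\<lambda>M. f M * hN M) \<longlonglongrightarrow> 0" "(\<lambda>M. f M * iN M) \<longlonglongrightarrow> 0"
      "(\<lambda>M. f M * jX M) \<longlonglongrightarrow> 0" "(\<lambda>M. f M * qN M) \<longlonglongrightarrow> 0"
    using f_lim[OF e] f_lim[OF hN] f_lim[OF iN] f_lim[OF jX] f_lim[OF qN] by simp_all
  note Z1 = R1_remainder_tendsto_0[OF lims(1,6,5,3,4,10,9,2) n_lims(1,2) f_lims(1-4), of r]
  have N_at: "nat \<lfloor>r * real M\<rfloor> = N M" for M by (simp add: N_def)
  have n_at: "real (N M) = n M" for M by (simp add: n_def)
  \<comment> \<open>The asymptotic identities are applied only once r M \<ge> 1, where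
    \<open>N M\<close> is positive and its reciprocal and logarithm are genuine.\<close>
  have transfer: "L \<longlonglongrightarrow> T" if "Z \<longlonglongrightarrow> 0" "\<And>M. r * real M \<ge> 1 \<Longrightarrow> L M = T + Z M" for L Z :: "nat \<Rightarrow> real" and T
  proof -
    have "(\<lambda>M. T + Z M) \<longlonglongrightarrow> T" using tendsto_add[OF tendsto_const[of T] that(1)] by simp
    then show ?thesis
      by (rule Lim_transform_eventually) (use large that(2) in \<open>auto elim: eventually_mono\<close>)
  qed
  show "?L1 \<longlonglongrightarrow> ?T1"
  proof (rule transfer[OF Z1])
    fix M assume M: "r * real M \<ge> 1"
    show "?L1 M = ?T1 + (- (n M * harmonic_err M) + n M * hN M - 1/2 * e M - f M * e M - 1/2 * e M * r + f M * hN M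
      + 1/2 * (f M * iN M) + 1/2 * (f M * jX M) * r - 1/2 * harmonic_err M + 1/2 * hN M * r + 1/4 * iN M * r
      - 1/4 * jX M * r - r * ln_sum_err M + sN M - 2 * t M)"
      unfolding sum_R1_difference[OF r, unfolded N_at] sums[OF M] unfolding n_at const_K_def
      by (rule R1_asymptotic_identity[OF rel(1-5)[OF M]])
  qed
  note Z2 = R2_remainder_tendsto_0[OF lims(12,11,1,6,5,3,4,8,7,10,9,2) n_lims a_lims(1-4) f_lims a_lims(5-7), of "ln r" r]
  show "?L2 \<longlonglongrightarrow> ?T2"
  proof (rule transfer[OF Z2])
    fix M assume M: "r * real M \<ge> 1"
    show "?L2 M = ?T2 + ((a M * (n M * harmonic_err M)) - (a M * (n M * hN M)) - 3 * (n M * harmonic_err M) - (n M * harmonic_err M) * ln r + 3 * (n M * hN M) - (n M * ln_over_sum_err M) + (n M * qN M)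
      - (a M * (f M * hN M)) + 1/2 * (a M * harmonic_err M) - 1/2 * (a M * hN M) * r - (a M * ln_sum_err M) * r + (a M * sN M) + 1/2 * (ln_squared_sum_err M) * r
      - 1/2 * cN M - 3/2 * e M - 3 * (f M * e M) - (f M * e M) * hN M - 1/2 * (f M * e M) * iN M
      + 1/2 * (f M * e M) * jX M * r - 1/2 * e M * hN M * r - 1/4 * e M * iN M * r - 1/4 * e M * jX M * r
      - 3/2 * e M * r + e M * sN M - 1/4 * e M * e M + 1/2 * (f M * e M) * e M + 1/4 * e M * e M * r
      + 2 * (f M * hN M) + 3/2 * (f M * iN M) + 3/2 * (f M * jX M) * r + (f M * qN M) - (harmonic_err M) - 1/2 * (harmonic_err M) * ln r
      + (harmonic_err M) * sN M + hN M * r - hN M * r * (ln_sum_err M) - hN M * t M + 1/2 * iN M * r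
      - 1/2 * iN M * r * (ln_sum_err M) - 1/2 * jX M * r + 1/2 * jX M * r * sN M - 1/2 * (ln_over_sum_err M) + 1/2 * qN M * r
      + r * ln r * (ln_sum_err M) - 2 * r * (ln_sum_err M) + 2 * sN M - 6 * t M)"
      unfolding sum_R2_difference[OF r, unfolded N_at] sums[OF M]
      unfolding n_at const_K1_def const_K2_def
      by (rule R2_asymptotic_identity[OF rel(1-5)[OF M]])
  qed
qed

lemma dilation_sum_LIMSEQ:
  fixes f :: "real \<Rightarrow> real"
  assumes f: "f \<in> O[at_top](\<lambda>x. x powr (-3/2))" and x: "x > 0" and N: "filterlim N sequentially sequentially"
  shows "(\<lambda>M. \<Sum>k=1..N M. f (real k * x)) \<longlonglongrightarrow> (\<Sum>k. f (real (Suc k) * x))"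
proof -
  have "(\<lambda>n. \<Sum>k<n. f (real (Suc k) * x)) \<longlonglongrightarrow> (\<Sum>k. f (real (Suc k) * x))"
    by (rule summable_LIMSEQ[OF summable_dilation[OF f x]])
  from filterlim_compose[OF this N] show ?thesis
    by (simp only: One_nat_def sum.atLeast_Suc_atMost_Suc_shift sum.atLeast1_atMost_eq o_def)
qed

theorem corollary3p1:
  fixes r :: real
  assumes "r > 0"
  shows "S1 (1 / r) = r * S1 r + const_K * (1 - r) + 1/2 * (1 + r) * ln r
       \<and> S2 (1 / r) = r * S2 r + const_K2 * (1 - r) + const_K1 * (1 + r) * ln r
                      + 1/4 * (1 - r) * (ln r)\<^sup>2"
proof -
  have "filterlim (\<lambda>M. r * real M) at_top sequentially"
    using assms by real_asymp
  then have N: "filterlim (\<lambda>M. nat \<lfloor>r * real M\<rfloor>) sequentially sequentially"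
    by (rule filterlim_compose[OF filterlim_nat_floor])
  \<comment> \<open>Each series converges on its own, so the different truncation lengths that the
    rectangle requires do not affect the limit.\<close>
  have lim: "(\<lambda>M. (\<Sum>k=1..nat \<lfloor>r * real M\<rfloor>. R (real k / r)) - r * (\<Sum>l=1..M. R (real l * r)))
      \<longlonglongrightarrow> (\<Sum>k. R (real (Suc k) * (1 / r))) - r * (\<Sum>k. R (real (Suc k) * r))"
    if R: "R \<in> O[at_top](\<lambda>x. x powr (-3/2))" for R :: "real \<Rightarrow> real"
    using dilation_sum_LIMSEQ[OF R _ N, of "1 / r"] dilation_sum_LIMSEQ[OF R assms filterlim_ident] assms
    by (intro tendsto_diff tendsto_mult tendsto_const) simp_all
  have "S1 (1 / r) - r * S1 r = const_K * (1 - r) + 1/2 * (1 + r) * ln r"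
    unfolding S1_def by (rule LIMSEQ_unique[OF lim[OF R1_bigo] partial_difference_limits(1)[OF assms]])
  moreover have "S2 (1 / r) - r * S2 r = const_K2 * (1 - r) + const_K1 * (1 + r) * ln r + 1/4 * (1 - r) * (ln r)\<^sup>2"
    unfolding S2_def by (rule LIMSEQ_unique[OF lim[OF R2_bigo] partial_difference_limits(2)[OF assms]])
  ultimately show ?thesis by simp
qed

end
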